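(* Let $\eta$ be a non-zero complex number, let $\sigma$ be a real number, and let $\Psi\not\equiv0$ be a given entire function of order $\sigma(\Psi)=\sigma$. Then the equation $$F(z+\eta)=\Psi(z)F(z)$$ admits a meromorphic solution $F$ on $\mathbb{C}$ of order $\sigma(F)=\sigma+1$.
   Context: Meromorphic means meromorphic in the whole complex plane. $\sigma(g)$ denotes the order of growth of a meromorphic function $g$: $\sigma(g)=\limsup_{r\to\infty}\frac{\log^+T(r,g)}{\log r}$, where $T(r,g)=m(r,g)+N(r,g)$ is the Nevanlinna characteristic, with $m(r,g)=\frac1{2\pi}\int_0^{2\pi}\log^+|g(re^{i\theta})|\,d\theta$, $N(r,g)=\int_0^r\frac{n(t,g)-n(0,g)}{t}\,dt+n(0,g)\log r$, and $n(t,g)$ the number of poles of $g$ in $|z|\le t$ with multiplicity. *)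

theory Defs
  imports "HOL-Complex_Analysis.Complex_Analysis"
begin

text \<open>
  Taking the maximum inside the logarithm gives the usual value 0 at 0 as well, independently of the
  totalised \<open>ln\<close>.
\<close>
definition log_plus :: "real \<Rightarrow> real" where
  "log_plus x = ln (max 1 x)"

text \<open>
  The multiplicity of a pole is minus its \<open>zorder\<close>. The sum is finite when \<open>g\<close> is meromorphic on
  the whole plane.
\<close>
definition pole_count :: "real \<Rightarrow> (complex \<Rightarrow> complex) \<Rightarrow> nat" where
  "pole_count t g = (\<Sum>z | is_pole g z \<and> cmod z \<le> t. nat (- zorder g z))"

definition proximity_function :: "real \<Rightarrow> (complex \<Rightarrow> complex) \<Rightarrow> real" where
  "proximity_function r g =
     1 / (2 * pi) * integral {0..2 * pi} (\<lambda>\<theta>. log_plus (cmod (g (of_real r * cis \<theta>))))"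

definition counting_function :: "real \<Rightarrow> (complex \<Rightarrow> complex) \<Rightarrow> real" where
  "counting_function r g =
     integral {0..r} (\<lambda>t. (real (pole_count t g) - real (pole_count 0 g)) / t)
     + real (pole_count 0 g) * ln r"

definition nevanlinna_characteristic :: "real \<Rightarrow> (complex \<Rightarrow> complex) \<Rightarrow> real" where
  "nevanlinna_characteristic r g = proximity_function r g + counting_function r g"

definition order_of_growth :: "(complex \<Rightarrow> complex) \<Rightarrow> ereal" where
  "order_of_growth g =
     Limsup at_top (\<lambda>r::real. ereal (log_plus (nevanlinna_characteristic r g) / ln r))"

end

(*
Write Psi as a limit of finite products over its zeros a, times zero-free factors. Every zero a in
the right half-plane contributes to F the row of zeros a + 1, a + 2, ..., every other zero a the row
of poles a, a - 1, ... (in the coordinate in which eta = 1). In this way a row never comes back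
towards the origin, so the zeros and poles of F have exponent of convergence sigma + 1, and the
canonical products of genus q = floor(sigma) + 1 over them grow with order at most sigma + 1.
A row of genus q reproduces the linear factor a - z under z -> z + 1 up to the exponential of a
polynomial of degree less than q, because the Weierstrass exponents z^j/j lose a degree when
differenced. By Borel-Caratheodory the q-th derivative of the logarithm of the zero-free factors of
Psi tends to 0. Hence the products solve the equation up to exp(H) with H a polynomial of degree
less than q, which is absorbed by exp(S) with S(z + 1) - S(z) = H(z) and deg S <= q <= sigma + 1.
To make the order exactly sigma + 1, F is also given full rows u + Z of poles (which do not affect
the equation) for about 2^(N sigma) points u of modulus about 2^N on the imaginary axis. Jensen's
formula for the denominator B turns the growth of F = A/B into an upper bound for T(r, F), and
counting these poles gives the lower bound.
*)
theory Submission
  imports Defs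
begin

text \<open>The obstacle is that the products cannot be matched with Psi factor by factor: the
  exponents produced by shifting partial products are polynomials whose coefficients need not
  converge, and the logarithms of the zero-free factors live on growing discs. Only their class is
  known: degree below q, or a q-th derivative tending to 0. So N shells are compared at a time on
  one fixed disc free of zeros, and taking the q-th derivative of a logarithm erases every
  uncontrolled term. The choice of q serves two ends: q > sigma leaves room for some s with sigma <
  s < q, so that R^(s - q) tends to 0, and q <= sigma + 1 keeps exp(S) within the order allowed.
  Grouping zeros by dyadic modulus avoids enumerating them and turns bounds 2^(N s) on their number,
  for all s > sigma, into a geometric series. Extra poles are needed because Psi may have too few
  zeros: for Psi = 1 constants solve the equation, with order 0 instead of 1. Numerator and
  denominator stay separate entire functions until the very end, so that growth and zeros can be
  treated without poles.\<close>

abbreviation exp_growth :: "real \<Rightarrow> (complex \<Rightarrow> complex) \<Rightarrow> bool" where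
  "exp_growth s h \<equiv> \<exists>K\<ge>0. \<forall>z. cmod (h z) \<le> exp (K * (1 + cmod z) powr s)"

section \<open>Growth and convergence of infinite products\<close>

text \<open>The map u -> u / (2A - u) sends the half-plane Re u <= A into the unit disc and fixes 0,
  so the Schwarz lemma bounds the composite by |z|/R <= 1/2; solving back for \<open>f z\<close>
  gives the factor 2.\<close>

lemma Borel_Caratheodory_half:
  assumes hol: "f holomorphic_on ball 0 R" and f0: "f 0 = 0" and "A > 0"
    and bd: "\<And>z. z \<in> ball 0 R \<Longrightarrow> Re (f z) \<le> A" and z: "cmod z \<le> R / 2" and "R > 0"
  shows "cmod (f z) \<le> 2 * A"
proof -
  define g where "g = (\<lambda>w. f (of_real R * w) / (of_real (2 * A) - f (of_real R * w)))"
  have inb: "of_real R * w \<in> ball 0 R" if "cmod w < 1" for w :: complex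
    using that \<open>R > 0\<close> by (simp add: norm_mult)
  have nz: "of_real (2 * A) - f (of_real R * w) \<noteq> 0" if "cmod w < 1" for w
  proof
    assume "of_real (2 * A) - f (of_real R * w) = 0"
    then have "Re (f (of_real R * w)) = 2 * A" by (simp add: complex_eq_iff)
    with bd[OF inb[OF that]] \<open>A > 0\<close> show False by simp
  qed
  have "(f \<circ> (\<lambda>w. of_real R * w)) holomorphic_on ball 0 1"
    by (intro holomorphic_on_compose_gen[OF _ hol] holomorphic_intros) (use inb in auto)
  then have fh: "(\<lambda>w. f (of_real R * w)) holomorphic_on ball 0 1"
    by (simp add: o_def)
  have gh: "g holomorphic_on ball 0 1"
    unfolding g_def by (intro holomorphic_intros fh) (use nz in auto)
  have g0: "g 0 = 0" using f0 by (simp add: g_def)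
  have gle: "cmod (g w) \<le> 1" if w: "cmod w < 1" for w
  proof -
    define u where "u = f (of_real R * w)"
    have "Re u \<le> A" using bd[OF inb[OF w]] by (simp add: u_def)
    have "cmod u ^ 2 \<le> cmod (of_real (2 * A) - u) ^ 2"
    proof -
      have "cmod (of_real (2 * A) - u) ^ 2 - cmod u ^ 2 = 4 * A * (A - Re u)"
        by (simp only: cmod_power2) (simp add: power2_eq_square algebra_simps)
      also have "\<dots> \<ge> 0" using \<open>Re u \<le> A\<close> \<open>A > 0\<close> by simp
      finally show ?thesis by simp
    qed
    then have "cmod u \<le> cmod (of_real (2 * A) - u)"
      using power2_le_imp_le norm_ge_zero by blast
    moreover have "of_real (2 * A) - u \<noteq> 0" using nz[OF w] by (simp add: u_def)
    ultimately show ?thesis by (simp add: g_def u_def[symmetric] norm_divide divide_le_eq_1)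
  qed
  \<comment> \<open>The Schwarz lemma asks for a strict bound; equality somewhere would make
    \<open>g\<close> constant, against \<open>g 0 = 0\<close>.\<close>
  have glt: "cmod (g w) < 1" if w: "cmod w < 1" for w
  proof (rule ccontr)
    assume "\<not> cmod (g w) < 1"
    then have eq: "cmod (g w) = 1" using gle[OF w] by simp
    have "g constant_on ball 0 1"
      by (rule maximum_modulus_principle[OF gh, where U="ball 0 1" and \<xi>=w])
         (use w gle eq in auto)
    then obtain c where "\<And>x. x \<in> ball 0 1 \<Longrightarrow> g x = c"
      unfolding constant_on_def by blast
    then have "g w = g 0" using w by simp
    with g0 eq show False by simp
  qed
  define w where "w = z / of_real R"
  have wh: "cmod w \<le> 1 / 2" using z \<open>R > 0\<close> by (simp add: w_def norm_divide field_simps)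
  then have w1: "cmod w < 1" by simp
  have zw: "of_real R * w = z" using \<open>R > 0\<close> by (simp add: w_def)
  have "cmod (g w) \<le> cmod w" by (rule Schwarz_Lemma(1)[OF gh g0 glt w1])
  then have gw: "cmod (g w) \<le> 1 / 2" using wh by linarith
  have "f z = g w * (of_real (2 * A) - f z)"
    using nz[OF w1] by (simp add: g_def zw)
  then have "cmod (f z) = cmod (g w) * cmod (of_real (2 * A) - f z)"
    by (metis norm_mult)
  also have "\<dots> \<le> 1 / 2 * (2 * A + cmod (f z))"
  proof (rule mult_mono[OF gw])
    have "cmod (of_real (2 * A) - f z) \<le> cmod (of_real (2 * A)) + cmod (f z)" by (rule norm_triangle_ineq4)
    also have "cmod (of_real (2 * A) :: complex) = 2 * A" using \<open>A > 0\<close>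
      by (simp only: norm_of_real abs_of_pos mult_pos_pos zero_less_numeral)
    finally show "cmod (of_real (2 * A) - f z) \<le> 2 * A + cmod (f z)" .
  qed auto
  finally show ?thesis by simp
qed

lemma exp_sub_one_le:
  fixes c :: real
  assumes "0 \<le> c" "c \<le> 1"
  shows "exp c - 1 \<le> 2 * c"
proof -
  have "c * c \<le> c * 1" using assms by (intro mult_left_mono) auto
  then show ?thesis using exp_bound[OF assms] by (simp add: power2_eq_square)
qed

text \<open>Borel-Caratheodory for \<open>f - 1\<close>, whose real part is at most exp c - 1 <= 2c:
  an upper bound alone, with the value 1 at 0, forces closeness to 1.\<close>

lemma norm_diff_one_le_of_norm_le_exp:
  assumes hol: "f holomorphic_on ball 0 R" and f0: "f 0 = 1" and c: "0 \<le> c" "c \<le> 1" and "R > 0"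
    and bd: "\<And>z. z \<in> ball 0 R \<Longrightarrow> cmod (f z) \<le> exp c" and z: "cmod z \<le> R / 2"
  shows "cmod (f z - 1) \<le> 4 * c"
proof (rule field_le_epsilon)
  \<comment> \<open>The bound on the real part must be positive there, but \<open>c\<close> may be
    0; hence the slack \<open>e\<close>.\<close>
  fix e :: real assume "e > 0"
  have "cmod (f z - 1) \<le> 2 * (2 * c + e / 2)"
  proof (rule Borel_Caratheodory_half[where f="\<lambda>w. f w - 1", OF _ _ _ _ z \<open>R > 0\<close>])
    show "(\<lambda>w. f w - 1) holomorphic_on ball 0 R" by (intro holomorphic_intros hol)
    show "f 0 - 1 = 0" using f0 by simp
    show "0 < 2 * c + e / 2" using c \<open>e > 0\<close> by simp
    fix w :: complex assume w: "w \<in> ball 0 R"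
    have "Re (f w) \<le> exp c" using bd[OF w] complex_Re_le_cmod order_trans by blast
    then show "Re (f w - 1) \<le> 2 * c + e / 2" using exp_sub_one_le[OF c] \<open>e > 0\<close> by simp
  qed
  then show "cmod (f z - 1) \<le> 4 * c + e" by simp
qed

text \<open>Only upper bounds on the factors are assumed. Together with \<open>f n 0 = 1\<close>
  they bound \<open>f n - 1\<close> by a multiple of \<open>c n\<close> on every disc, which is what
  convergence needs. In this form the lemma serves twice: for the factors of one row and for the
  shells of a product of rows.\<close>

lemma canonical_product:
  fixes f :: "nat \<Rightarrow> complex \<Rightarrow> complex" and c :: "nat \<Rightarrow> real" and \<tau> :: real
  assumes hol: "\<And>n. f n holomorphic_on UNIV" and f0: "\<And>n. f n 0 = 1"
    and c0: "\<And>n. c n \<ge> 0" and sm: "summable c" and tau: "\<tau> > 0"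
    and bd: "\<And>n z. cmod (f n z) \<le> exp (c n * cmod z powr \<tau>)"
  shows "\<And>R. uniform_limit (cball 0 R) (\<lambda>N z. \<Prod>n<N. f n z) (\<lambda>z. \<Prod>n. f n z) sequentially"
    and "(\<lambda>z. \<Prod>n. f n z) holomorphic_on UNIV"
    and "\<And>z. cmod (\<Prod>n. f n z) \<le> exp (suminf c * cmod z powr \<tau>)"
    and "\<And>z. (\<Prod>n. f n z) = 0 \<longleftrightarrow> (\<exists>n. f n z = 0)"
proof -
  \<comment> \<open>The bound is taken on the disc of radius 2R because Borel-Caratheodory halves
    the radius; \<open>N\<close> makes the exponent at most 1 there.\<close>
  have near: "\<exists>N. \<forall>n\<ge>N. \<forall>z\<in>cball 0 R. cmod (f n z - 1) \<le> 4 * ((2 * R) powr \<tau>) * c n" if R: "R > 0" for R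
  proof -
    have "(\<lambda>n. c n * (2 * R) powr \<tau>) \<longlonglongrightarrow> 0 * (2 * R) powr \<tau>"
      by (intro tendsto_intros summable_LIMSEQ_zero[OF sm])
    then have "eventually (\<lambda>n. c n * (2 * R) powr \<tau> < 1) sequentially"
      by (rule order_tendstoD) auto
    then obtain N where N: "\<And>n. n \<ge> N \<Longrightarrow> c n * (2 * R) powr \<tau> < 1"
      by (auto simp: eventually_sequentially)
    show ?thesis
    proof (intro exI[of _ N] allI impI ballI)
      fix n z assume n: "N \<le> n" and z: "z \<in> cball (0::complex) R"
      have "cmod (f n z - 1) \<le> 4 * (c n * (2 * R) powr \<tau>)"
      proof (rule norm_diff_one_le_of_norm_le_exp[where f="f n" and R="2 * R"])
        show "f n holomorphic_on ball 0 (2 * R)" using hol holomorphic_on_subset by blast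
        show "cmod (f n w) \<le> exp (c n * (2 * R) powr \<tau>)" if "w \<in> ball 0 (2 * R)" for w
        proof -
          have "cmod w powr \<tau> \<le> (2 * R) powr \<tau>" using that tau by (intro powr_mono2) auto
          then have "c n * cmod w powr \<tau> \<le> c n * (2 * R) powr \<tau>" using c0 by (intro mult_left_mono) auto
          then show ?thesis using bd[of n w] by (meson exp_le_cancel_iff order_trans)
        qed
      qed (use f0 c0 N[OF n] R z in auto)
      then show "cmod (f n z - 1) \<le> 4 * ((2 * R) powr \<tau>) * c n" by (simp add: mult_ac)
    qed
  qed
  have usum: "uniformly_convergent_on (cball 0 R) (\<lambda>N z. \<Sum>n<N. norm (f n z - 1))" if R: "R > 0" for R
  proof -
    obtain N where N: "\<And>n z. n \<ge> N \<Longrightarrow> z \<in> cball 0 R \<Longrightarrow> cmod (f n z - 1) \<le> 4 * ((2 * R) powr \<tau>) * c n"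
      using near[OF R] by blast
    show ?thesis
    proof (rule Weierstrass_m_test'_ev)
      show "\<forall>\<^sub>F n in sequentially. \<forall>x\<in>cball 0 R. norm (norm (f n x - 1)) \<le> 4 * ((2 * R) powr \<tau>) * c n"
        unfolding eventually_sequentially using N by (intro exI[of _ N]) auto
      show "summable (\<lambda>n. 4 * ((2 * R) powr \<tau>) * c n)" by (intro summable_mult sm)
    qed
  qed
  have abs: "abs_convergent_prod (\<lambda>n. f n z)" for z
  proof (rule summable_imp_abs_convergent_prod)
    define R where "R = cmod z + 1"
    have "R > 0" unfolding R_def by (simp add: add_nonneg_pos)
    then obtain N where N: "\<And>n z. n \<ge> N \<Longrightarrow> z \<in> cball 0 R \<Longrightarrow> cmod (f n z - 1) \<le> 4 * ((2 * R) powr \<tau>) * c n"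
      using near by blast
    show "summable (\<lambda>n. norm (f n z - 1))"
    proof (rule summable_comparison_test_ev)
      show "\<forall>\<^sub>F n in sequentially. norm (norm (f n z - 1)) \<le> 4 * ((2 * R) powr \<tau>) * c n"
        unfolding eventually_sequentially using N by (intro exI[of _ N]) (auto simp: R_def)
      show "summable (\<lambda>n. 4 * ((2 * R) powr \<tau>) * c n)" by (intro summable_mult sm)
    qed
  qed
  then have conv: "convergent_prod (\<lambda>n. f n z)" for z
    using abs_convergent_prod_imp_convergent_prod by blast
  have lim: "(\<lambda>N. \<Prod>n<N. f n z) \<longlonglongrightarrow> (\<Prod>n. f n z)" for z
    using convergent_prod_LIMSEQ[OF conv, of z] by (simp add: LIMSEQ_lessThan_iff_atMost)
  show A: "uniform_limit (cball 0 R) (\<lambda>N z. \<Prod>n<N. f n z) (\<lambda>z. \<Prod>n. f n z) sequentially" for R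
  proof -
    define R' where "R' = \<bar>R\<bar> + 1"
    have "R' > 0" "R \<le> R'" by (auto simp: R'_def)
    have "uniformly_convergent_on (cball 0 R') (\<lambda>N z. \<Prod>n<N. f n z)"
    proof (rule uniformly_convergent_on_prod')
      show "continuous_on (cball 0 R') (f n)" for n
        using hol holomorphic_on_imp_continuous_on holomorphic_on_subset by blast
    qed (use usum[OF \<open>R' > 0\<close>] in auto)
    then obtain l where l: "uniform_limit (cball 0 R') (\<lambda>N z. \<Prod>n<N. f n z) l sequentially"
      unfolding uniformly_convergent_on_def by blast
    have "l z = (\<Prod>n. f n z)" if "z \<in> cball 0 R'" for z
      using tendsto_uniform_limitI[OF l that] lim LIMSEQ_unique by blast
    then have "uniform_limit (cball 0 R') (\<lambda>N z. \<Prod>n<N. f n z) (\<lambda>z. \<Prod>n. f n z) sequentially"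
      using l by (subst uniform_limit_cong'[where g="\<lambda>N z. \<Prod>n<N. f n z" and i=l]) auto
    then show ?thesis by (rule uniform_limit_on_subset) (use \<open>R \<le> R'\<close> in auto)
  qed
  show "(\<lambda>z. \<Prod>n. f n z) holomorphic_on UNIV"
  proof (rule holomorphic_uniform_sequence[where f="\<lambda>N z. \<Prod>n<N. f n z"])
    show "(\<lambda>z. \<Prod>n<N. f n z) holomorphic_on UNIV" for N by (intro holomorphic_intros hol)
    fix x :: complex
    have "cball x 1 \<subseteq> cball 0 (cmod x + 1)"
    proof
      fix y assume "y \<in> cball x 1"
      then have "cmod (y - x) \<le> 1" by (simp add: dist_norm norm_minus_commute)
      then show "y \<in> cball 0 (cmod x + 1)" using norm_triangle_sub[of y x] by simp
    qed
    then show "\<exists>d>0. cball x d \<subseteq> UNIV \<and> uniform_limit (cball x d) (\<lambda>N z. \<Prod>n<N. f n z) (\<lambda>z. \<Prod>n. f n z) sequentially"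
      using uniform_limit_on_subset[OF A] by (intro exI[of _ 1]) auto
  qed auto
  show "cmod (\<Prod>n. f n z) \<le> exp (suminf c * cmod z powr \<tau>)" for z
  proof (rule LIMSEQ_le_const2[OF tendsto_norm[OF lim]], intro exI allI impI)
    fix N
    have "cmod (\<Prod>n<N. f n z) = (\<Prod>n<N. cmod (f n z))" by (simp add: prod_norm)
    also have "\<dots> \<le> (\<Prod>n<N. exp (c n * cmod z powr \<tau>))" by (intro prod_mono) (use bd in auto)
    also have "\<dots> = exp ((\<Sum>n<N. c n) * cmod z powr \<tau>)" by (simp add: exp_sum sum_distrib_right)
    also have "\<dots> \<le> exp (suminf c * cmod z powr \<tau>)"
      using sum_le_suminf[OF sm] c0 by (simp add: mult_right_mono)
    finally show "cmod (\<Prod>n<N. f n z) \<le> exp (suminf c * cmod z powr \<tau>)" .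
  qed
  show "(\<Prod>n. f n z) = 0 \<longleftrightarrow> (\<exists>n. f n z = 0)" for z
    using has_prod_eq_0_iff[OF convergent_prod_has_prod[OF conv, of z]] by (metis rangeE rangeI)
qed

text \<open>Doubling makes the base at least 1, so the exponent may be raised.\<close>

lemma powr_le_power_bound:
  fixes x \<tau> :: real
  assumes "x \<ge> 1/2" "real j \<le> \<tau>"
  shows "x ^ j \<le> 2 powr \<tau> * x powr \<tau>"
proof -
  have "x ^ j \<le> (2 * x) ^ j" using assms by (intro power_mono) auto
  also have "\<dots> = (2 * x) powr real j" using assms by (simp add: powr_realpow)
  also have "\<dots> \<le> (2 * x) powr \<tau>" using assms by (intro powr_mono) auto
  also have "\<dots> = 2 powr \<tau> * x powr \<tau>" using assms by (simp add: powr_mult)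
  finally show ?thesis .
qed

text \<open>Each bound on \<open>\<tau>\<close> governs one range: for small u the distance to 1 is
  of size |u|^(q+1), at most |u|^\<open>\<tau>\<close> since \<open>\<tau>\<close> <= q + 1; for
  large u the exponent has degree q <= \<open>\<tau>\<close>.\<close>

lemma weierstrass_factor_exp_bound:
  fixes \<tau> :: real
  assumes "real q \<le> \<tau>" "\<tau> \<le> real q + 1" "q \<ge> 1"
  shows "\<exists>C>0. \<forall>u. cmod (weierstrass_factor q u) \<le> exp (C * cmod u powr \<tau>)"
proof (intro exI[of _ "3 + (1 + real q) * 2 powr \<tau>"] conjI allI)
  let ?C = "3 + (1 + real q) * 2 powr \<tau>"
  show "?C > 0" by (simp add: add_pos_nonneg)
  fix u :: complex
  show "cmod (weierstrass_factor q u) \<le> exp (?C * cmod u powr \<tau>)"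
  proof (cases "cmod u \<le> 1 / 2")
    case True
    have "cmod u ^ Suc q \<le> cmod u powr \<tau>"
    proof (cases "u = 0")
      case False
      have "cmod u ^ Suc q = cmod u powr real (Suc q)" using False by (subst powr_realpow) auto
      also have "\<dots> \<le> cmod u powr \<tau>" using True False assms by (intro powr_mono') auto
      finally show ?thesis .
    qed auto
    have "cmod (weierstrass_factor q u) \<le> 1 + cmod (weierstrass_factor q u - 1)"
      using norm_triangle_sub[of "weierstrass_factor q u" 1] by simp
    also have "\<dots> \<le> 1 + 3 * cmod u powr \<tau>"
      using weierstrass_factor_bound[OF True, of q] \<open>cmod u ^ Suc q \<le> cmod u powr \<tau>\<close> by linarith
    also have "\<dots> \<le> exp (3 * cmod u powr \<tau>)" by (rule exp_ge_add_one_self)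
    also have "\<dots> \<le> exp (?C * cmod u powr \<tau>)" by (simp add: mult_right_mono)
    finally show ?thesis .
  next
    case False
    then have u: "cmod u \<ge> 1/2" by simp
    have "cmod (\<Sum>k=1..q. u ^ k / of_nat k) \<le> (\<Sum>k=1..q. cmod u ^ k)"
    proof (rule order_trans[OF norm_sum], rule sum_mono)
      fix k assume "k \<in> {1..q}"
      then show "cmod (u ^ k / of_nat k) \<le> cmod u ^ k"
        by (simp add: norm_divide norm_power divide_le_eq mult_le_cancel_left1)
    qed
    also have "\<dots> \<le> (\<Sum>k=1..q. 2 powr \<tau> * cmod u powr \<tau>)"
      by (intro sum_mono powr_le_power_bound u) (use assms in auto)
    also have "\<dots> = real q * 2 powr \<tau> * cmod u powr \<tau>" by simp
    finally have s: "cmod (\<Sum>k=1..q. u ^ k / of_nat k) \<le> real q * 2 powr \<tau> * cmod u powr \<tau>" .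
    have "cmod u ^ 1 \<le> 2 powr \<tau> * cmod u powr \<tau>"
      by (intro powr_le_power_bound u) (use assms in auto)
    have "cmod (1 - u) \<le> 1 + cmod u" using norm_triangle_ineq4[of 1 u] by simp
    also have "\<dots> \<le> exp (cmod u)" by (rule exp_ge_add_one_self)
    also have "\<dots> \<le> exp (2 powr \<tau> * cmod u powr \<tau>)" using \<open>cmod u ^ 1 \<le> _\<close> by simp
    finally have f: "cmod (1 - u) \<le> exp (2 powr \<tau> * cmod u powr \<tau>)" .
    have "cmod (weierstrass_factor q u) = cmod (1 - u) * cmod (exp (\<Sum>k=1..q. u ^ k / of_nat k))"
      by (simp add: weierstrass_factor_def norm_mult)
    also have "\<dots> \<le> exp (2 powr \<tau> * cmod u powr \<tau>) * exp (real q * 2 powr \<tau> * cmod u powr \<tau>)"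
      by (intro mult_mono f order_trans[OF norm_exp]) (use s in auto)
    also have "\<dots> \<le> exp (?C * cmod u powr \<tau>)"
      by (simp add: algebra_simps flip: exp_add)
    finally show ?thesis .
  qed
qed

section \<open>Zeros of entire functions and Jensen's formula\<close>

definition zmult :: "(complex \<Rightarrow> complex) \<Rightarrow> complex \<Rightarrow> nat" where
  "zmult f a = nat (zorder f a)"

abbreviation circ :: "real \<Rightarrow> real \<Rightarrow> complex" where
  "circ R t \<equiv> of_real R * cis t"

abbreviation zero_log_sum :: "(complex \<Rightarrow> complex) \<Rightarrow> real \<Rightarrow> real" where
  "zero_log_sum f R \<equiv> (\<Sum>a | f a = 0 \<and> cmod a < R. real (zmult f a) * ln (R / cmod a))"

abbreviation zero_prod :: "(complex \<Rightarrow> complex) \<Rightarrow> real \<Rightarrow> complex \<Rightarrow> complex" where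
  "zero_prod f R z \<equiv> (\<Prod>a | f a = 0 \<and> cmod a < R. (z - a) ^ zmult f a)"

lemma entire_factor_zero:
  assumes hol: "f holomorphic_on UNIV" and nz: "\<exists>z. f z \<noteq> 0"
  obtains k where "k holomorphic_on UNIV" "\<And>z. f z = k z * (z - a) ^ zmult f a" "k a \<noteq> 0"
proof -
  define n where "n = zmult f a"
  have nz': "\<exists>w\<in>UNIV. f w \<noteq> 0" using nz by simp
  from conjunct2[OF zorder_exist_zero[OF hol open_UNIV connected_UNIV UNIV_I nz', of a]]
  obtain r where r: "r > 0" and gh: "zor_poly f a holomorphic_on cball a r"
    and gf': "\<forall>w\<in>cball a r. f w = zor_poly f a w * (w - a) ^ n \<and> zor_poly f a w \<noteq> 0"
    unfolding n_def zmult_def by (elim exE conjE)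
  have gf: "f w = zor_poly f a w * (w - a) ^ n \<and> zor_poly f a w \<noteq> 0" if "w \<in> cball a r" for w
    using gf' that by (rule bspec)
  define k where "k = (\<lambda>w. if w = a then zor_poly f a a else f w / (w - a) ^ n)"
  have keq: "k w = zor_poly f a w" if "w \<in> ball a r" for w
    using gf[of w] that unfolding k_def by auto
  have "k holomorphic_on ball a r"
    by (rule holomorphic_transform[OF holomorphic_on_subset[OF gh ball_subset_cball]]) (simp add: keq)
  moreover have "(\<lambda>w. f w / (w - a) ^ n) holomorphic_on (- {a})"
    by (intro holomorphic_intros holomorphic_on_subset[OF hol]) auto
  then have "k holomorphic_on (- {a})"
    by (rule holomorphic_transform) (auto simp: k_def)
  ultimately have "k holomorphic_on (ball a r \<union> (- {a}))"
    by (intro holomorphic_on_Un) auto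
  moreover have "ball a r \<union> (- {a}) = UNIV" using r by auto
  ultimately have 1: "k holomorphic_on UNIV" by simp
  have 2: "f z = k z * (z - a) ^ n" for z
    using gf[of a] r by (cases "z = a") (auto simp: k_def)
  have 3: "k a \<noteq> 0" using gf[of a] r by (auto simp: k_def)
  show ?thesis using that[OF 1 _ 3] 2 unfolding n_def by blast
qed

lemma entire_factor_zeros:
  assumes "finite Z" and hol: "f holomorphic_on UNIV" and nz: "\<exists>z. f z \<noteq> 0"
  shows "\<exists>k. k holomorphic_on UNIV \<and> (\<forall>z. f z = k z * (\<Prod>a\<in>Z. (z - a) ^ zmult f a)) \<and> (\<forall>a\<in>Z. k a \<noteq> 0)"
  using assms(1)
proof (induction Z)
  case empty
  show ?case by (rule exI[of _ f]) (simp add: hol)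
next
  case (insert b Z)
  from insert.IH obtain k where k1: "k holomorphic_on UNIV"
    and k2: "\<forall>z. f z = k z * (\<Prod>a\<in>Z. (z - a) ^ zmult f a)" and k3: "\<forall>a\<in>Z. k a \<noteq> 0"
    by (elim exE conjE)
  note k = k1 spec[OF k2] bspec[OF k3]
  have knz: "\<exists>z. k z \<noteq> 0"
  proof -
    obtain z where "f z \<noteq> 0" using nz by blast
    then have "k z \<noteq> 0" unfolding k(2)[of z] by auto
    then show ?thesis by blast
  qed
  obtain k' where k': "k' holomorphic_on UNIV" "\<And>z. k z = k' z * (z - b) ^ zmult k b" "k' b \<noteq> 0"
    using entire_factor_zero[OF k(1) knz] by blast
  define h where "h = (\<lambda>z. k' z * (\<Prod>a\<in>Z. (z - a) ^ zmult f a))"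
  \<comment> \<open>Dividing out the other zeros does not change the order at \<open>b\<close>,
    since their linear factors do not vanish there.\<close>
  have "zorder f b = int (zmult k b)"
  proof (rule zorder_eqI[OF open_UNIV UNIV_I])
    show "h holomorphic_on UNIV" unfolding h_def by (intro holomorphic_intros k')
    show "h b \<noteq> 0" using insert.hyps k'(3) by (auto simp: h_def)
    show "f w = h w * (w - b) powi int (zmult k b)" for w
      unfolding k(2)[of w] k'(2)[of w] h_def power_int_of_nat by (simp only: mult_ac)
  qed
  then have "zmult f b = zmult k b" by (simp add: zmult_def)
  then have "f z = k' z * (\<Prod>a\<in>insert b Z. (z - a) ^ zmult f a)" for z
    unfolding k(2)[of z] k'(2)[of z] using insert.hyps by simp
  moreover have "k' a \<noteq> 0" if "a \<in> insert b Z" for a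
    using that k(3)[of a] k'(3) unfolding k'(2)[of a] by auto
  ultimately show ?case using k'(1) by blast
qed

lemma finite_zeros_cball:
  assumes hol: "f holomorphic_on UNIV" and nz: "\<exists>z. f z \<noteq> (0::complex)"
  shows "finite {z \<in> cball 0 R. f z = 0}"
proof (cases "f constant_on UNIV")
  case True
  then have "{z \<in> cball 0 R. f z = 0} = {}" using nz unfolding constant_on_def by auto
  then show ?thesis by (metis finite.emptyI)
next
  case False
  then show ?thesis by (intro holomorphic_compact_finite_zeros[OF hol]) auto
qed

text \<open>The Poisson kernel is the Cauchy kernel at z plus a kernel whose pole is the reflection
  of z in the circle.\<close>

lemma Poisson_kernel_eq:
  assumes u: "cmod u = R" and z: "cmod z < R"
  shows "u / (u - z) + cnj z * u / (of_real (R\<^sup>2) - cnj z * u) = of_real ((R\<^sup>2 - (cmod z)\<^sup>2) / (cmod (u - z))\<^sup>2)"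
proof -
  have uz: "u - z \<noteq> 0" using u z by auto
  then have cuz: "cnj u - cnj z \<noteq> 0" by (metis complex_cnj_diff complex_cnj_zero_iff)
  have u0: "u \<noteq> 0" using u z by auto
  have R: "of_real (R\<^sup>2) = u * cnj u" using u complex_norm_square[of u] by simp
  have "cnj z * u / (of_real (R\<^sup>2) - cnj z * u) = cnj z * u / (u * (cnj u - cnj z))"
    unfolding R by (simp add: algebra_simps)
  also have "\<dots> = cnj z / (cnj u - cnj z)" using u0 by simp
  finally have "u / (u - z) + cnj z * u / (of_real (R\<^sup>2) - cnj z * u) = u / (u - z) + cnj z / (cnj u - cnj z)" by simp
  also have "\<dots> = (u * cnj u - z * cnj z) / ((u - z) * cnj (u - z))"
    using uz cuz by (simp add: add_frac_eq algebra_simps)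
  also have "\<dots> = of_real ((R\<^sup>2 - (cmod z)\<^sup>2) / (cmod (u - z))\<^sup>2)"
    by (simp only: of_real_divide of_real_diff complex_norm_square u[symmetric])
  finally show ?thesis .
qed

text \<open>Cauchy's formula gives the first part of the kernel; the second part contributes 0,
  because the reflected point lies outside the circle.\<close>

lemma Poisson_integral:
  fixes g :: "complex \<Rightarrow> complex"
  assumes hol: "g holomorphic_on ball 0 R'" and R: "R < R'" and z: "cmod z < R"
  shows "((\<lambda>t. of_real ((R\<^sup>2 - (cmod z)\<^sup>2) / (cmod (circ R t - z))\<^sup>2) * g (circ R t))
           has_integral (2 * pi * g z)) {0..2*pi}"
proof -
  have "R > 0" using z norm_ge_zero[of z] by linarith
  have sub: "cball 0 R \<subseteq> ball (0::complex) R'" using R by auto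
  have "((\<lambda>u. g u / (u - z)) has_contour_integral (2 * of_real pi * \<i> * g z)) (circlepath 0 R)"
    by (rule Cauchy_integral_circlepath)
       (use z R holomorphic_on_subset[OF hol sub] holomorphic_on_subset[OF hol, of "ball 0 R"] holomorphic_on_imp_continuous_on in auto)
  moreover have "((\<lambda>u. g u * (cnj z / (of_real (R\<^sup>2) - cnj z * u))) has_contour_integral 0) (circlepath 0 R)"
  proof (rule Cauchy_theorem_convex_simple)
    \<comment> \<open>The largest disc inside the domain of \<open>g\<close> that avoids the
      reflected point, of modulus R^2 / |z|.\<close>
    define R2 where "R2 = (if z = 0 then R' else min R' (R\<^sup>2 / cmod z))"
    have R2: "R < R2" "R2 \<le> R'"
      using R z \<open>R > 0\<close> by (auto simp: R2_def field_simps power2_eq_square)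
    show "(\<lambda>u. g u * (cnj z / (of_real (R\<^sup>2) - cnj z * u))) holomorphic_on ball 0 R2"
    proof (intro holomorphic_intros holomorphic_on_subset[OF hol])
      fix u :: complex assume u: "u \<in> ball 0 R2"
      show "of_real (R\<^sup>2) - cnj z * u \<noteq> 0"
      proof
        assume "of_real (R\<^sup>2) - cnj z * u = 0"
        then have "cmod (cnj z * u) = cmod (of_real (R\<^sup>2))" by simp
        then have e: "cmod z * cmod u = R\<^sup>2"
          by (simp only: norm_mult complex_mod_cnj norm_of_real) simp
        then have "z \<noteq> 0" using \<open>R > 0\<close> by auto
        then have "cmod u < R\<^sup>2 / cmod z" using u by (auto simp: R2_def)
        then show False using e \<open>z \<noteq> 0\<close> by (simp add: field_simps)
      qed
    qed (use R2 in auto)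
    show "path_image (circlepath 0 R) \<subseteq> ball 0 R2" using R2 \<open>R > 0\<close> by auto
  qed auto
  ultimately have "((\<lambda>u. g u / (u - z) + g u * (cnj z / (of_real (R\<^sup>2) - cnj z * u)))
      has_contour_integral (2 * of_real pi * \<i> * g z + 0)) (circlepath 0 R)"
    by (rule has_contour_integral_add)
  then have "((\<lambda>t. (g (circ R t) / (circ R t - z) + g (circ R t) * (cnj z / (of_real (R\<^sup>2) - cnj z * (circ R t)))) * R * \<i> * cis t)
      has_integral (2 * of_real pi * \<i> * g z)) {0..2*pi}"
    unfolding circlepath_def by (subst (asm) has_contour_integral_part_circlepath_iff) auto
  then have "((\<lambda>t. (- \<i>) * ((g (circ R t) / (circ R t - z) + g (circ R t) * (cnj z / (of_real (R\<^sup>2) - cnj z * (circ R t)))) * R * \<i> * cis t))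
      has_integral ((- \<i>) * (2 * of_real pi * \<i> * g z))) {0..2*pi}"
    by (rule has_integral_mult_right)
  moreover have "(- \<i>) * (2 * of_real pi * \<i> * g z) = 2 * pi * g z" by (simp add: mult.assoc)
  moreover have "(- \<i>) * ((g (circ R t) / (circ R t - z) + g (circ R t) * (cnj z / (of_real (R\<^sup>2) - cnj z * (circ R t)))) * R * \<i> * cis t)
      = of_real ((R\<^sup>2 - (cmod z)\<^sup>2) / (cmod (circ R t - z))\<^sup>2) * g (circ R t)" (is "?l = _") for t
  proof -
    define u where "u = circ R t"
    have u: "cmod u = R" using \<open>R > 0\<close> by (simp add: u_def norm_mult)
    have "?l = (u / (u - z) + cnj z * u / (of_real (R\<^sup>2) - cnj z * u)) * g u"
      unfolding u_def[symmetric] by (simp add: u_def algebra_simps add_divide_distrib)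
    also have "\<dots> = of_real ((R\<^sup>2 - (cmod z)\<^sup>2) / (cmod (u - z))\<^sup>2) * g u"
      by (subst Poisson_kernel_eq[OF u z]) simp
    finally show ?thesis by (simp add: u_def)
  qed
  ultimately show ?thesis by (simp only:)
qed

lemma ln_prod_power:
  fixes c :: "'a \<Rightarrow> real"
  assumes "finite Z" "\<And>a. a \<in> Z \<Longrightarrow> c a > 0"
  shows "ln (\<Prod>a\<in>Z. c a ^ n a) = (\<Sum>a\<in>Z. real (n a) * ln (c a))" "(\<Prod>a\<in>Z. c a ^ n a) > 0"
  using assms by (induction Z) (auto simp: ln_mult ln_realpow prod_pos less_imp_neq[symmetric])

text \<open>Replacing each factor z - a by (R^2 - cnj a z) / R keeps the modulus on the circle, does
  not decrease it inside and removes the zeros in the closed disc. The result has a logarithm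
  \<open>g\<close>, and Re g is a harmonic majorant of ln |f| with equal boundary values; its value
  at 0 yields Jensen's formula.\<close>

lemma Blaschke_outer:
  assumes hol: "f holomorphic_on UNIV" and nz: "\<exists>z. f z \<noteq> 0" and "R > 0"
    and circ: "\<And>z. cmod z = R \<Longrightarrow> f z \<noteq> 0"
  obtains R' g where "R < R'" "g holomorphic_on ball 0 R'"
    "\<forall>z. cmod z = R \<longrightarrow> cmod (f z) = exp (Re (g z))"
    "\<forall>z. cmod z \<le> R \<longrightarrow> cmod (f z) \<le> exp (Re (g z))"
    "f 0 \<noteq> 0 \<longrightarrow> Re (g 0) = ln (cmod (f 0)) + zero_log_sum f R"
proof -
  define Z where "Z = {a. f a = 0 \<and> cmod a < R}"
  have "finite Z" by (rule finite_subset[OF _ finite_zeros_cball[OF hol nz, of R]]) (auto simp: Z_def)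
  obtain k where k: "k holomorphic_on UNIV" "\<And>z. f z = k z * (\<Prod>a\<in>Z. (z - a) ^ zmult f a)" "\<And>a. a \<in> Z \<Longrightarrow> k a \<noteq> 0"
    using entire_factor_zeros[OF \<open>finite Z\<close> hol nz] by blast
  define h where "h = (\<lambda>z. k z * (\<Prod>a\<in>Z. ((of_real (R\<^sup>2) - cnj a * z) / of_real R) ^ zmult f a))"
  have hh: "h holomorphic_on UNIV" unfolding h_def by (intro holomorphic_intros k) (use \<open>R > 0\<close> in auto)
  \<comment> \<open>The source of both the inequality inside and the equality on the circle: the
    last term is a product of two nonnegative factors, one of which vanishes for |z| = R.\<close>
  have key: "cmod (z - a) ^ 2 * R ^ 2 = cmod (of_real (R\<^sup>2) - cnj a * z) ^ 2 - (R\<^sup>2 - (cmod a)\<^sup>2) * (R\<^sup>2 - (cmod z)\<^sup>2)" for z a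
    by (simp only: cmod_power2) (simp add: power2_eq_square algebra_simps)
  have le: "cmod (z - a) \<le> cmod ((of_real (R\<^sup>2) - cnj a * z) / of_real R)" if "a \<in> Z" "cmod z \<le> R" for z a
  proof -
    have "(R\<^sup>2 - (cmod a)\<^sup>2) * (R\<^sup>2 - (cmod z)\<^sup>2) \<ge> 0"
      using that by (intro mult_nonneg_nonneg) (auto simp: Z_def power2_le_iff_abs_le intro!: power_mono)
    then have "(cmod (z - a) * R) ^ 2 \<le> cmod (of_real (R\<^sup>2) - cnj a * z) ^ 2"
      using key[of z a] by (simp add: power_mult_distrib)
    then have "cmod (z - a) * R \<le> cmod (of_real (R\<^sup>2) - cnj a * z)"
      using power2_le_imp_le norm_ge_zero by blast
    then show ?thesis using \<open>R > 0\<close> by (simp add: norm_divide field_simps)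
  qed
  have eq: "cmod (z - a) = cmod ((of_real (R\<^sup>2) - cnj a * z) / of_real R)" if "cmod z = R" for z a
  proof -
    have "(cmod (z - a) * R) ^ 2 = cmod (of_real (R\<^sup>2) - cnj a * z) ^ 2"
      using key[of z a] that by (simp add: power_mult_distrib)
    then have "cmod (z - a) * R = cmod (of_real (R\<^sup>2) - cnj a * z)"
      using \<open>R > 0\<close> by (simp add: power2_eq_iff_nonneg)
    then show ?thesis using \<open>R > 0\<close> by (simp add: norm_divide field_simps)
  qed
  have fl: "cmod (f z) \<le> cmod (h z)" if "cmod z \<le> R" for z
  proof -
    have "(\<Prod>a\<in>Z. cmod (z - a) ^ zmult f a) \<le> (\<Prod>a\<in>Z. cmod ((of_real (R\<^sup>2) - cnj a * z) / of_real R) ^ zmult f a)"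
      by (rule prod_mono) (simp only: le that power_mono norm_ge_zero zero_le_power simp_thms)
    then have "cmod (k z) * (\<Prod>a\<in>Z. cmod (z - a) ^ zmult f a) \<le> cmod (k z) * (\<Prod>a\<in>Z. cmod ((of_real (R\<^sup>2) - cnj a * z) / of_real R) ^ zmult f a)"
      by (rule mult_left_mono) simp
    then show ?thesis
      by (simp only: k(2)[of z] h_def norm_mult prod_norm[symmetric] norm_power)
  qed
  have fe: "cmod (f z) = cmod (h z)" if "cmod z = R" for z
    by (simp only: k(2)[of z] h_def norm_mult prod_norm[symmetric] norm_power eq[OF that])
  have hnz: "h z \<noteq> 0" if "cmod z \<le> R" for z
  proof -
    have "k z \<noteq> 0"
    proof
      assume "k z = 0"
      then have "f z = 0" by (simp add: k(2))
      moreover have "cmod z \<noteq> R" using circ[of z] calculation by blast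
      ultimately have "z \<in> Z" using that unfolding Z_def by simp
      with k(3) \<open>k z = 0\<close> show False by blast
    qed
    moreover have "of_real (R\<^sup>2) - cnj a * z \<noteq> 0" if "a \<in> Z" for a
    proof
      assume "of_real (R\<^sup>2) - cnj a * z = 0"
      then have "cmod (cnj a * z) = cmod (of_real (R\<^sup>2))" by simp
      then have e: "cmod a * cmod z = R\<^sup>2"
        by (simp only: norm_mult complex_mod_cnj norm_of_real) simp
      have "cmod a * cmod z \<le> cmod a * R" using \<open>cmod z \<le> R\<close> by (intro mult_left_mono) auto
      also have "\<dots> < R * R" using \<open>a \<in> Z\<close> \<open>R > 0\<close> by (auto simp: Z_def)
      finally show False using e by (simp add: power2_eq_square)
    qed
    ultimately show ?thesis using \<open>finite Z\<close> \<open>R > 0\<close> by (auto simp: h_def)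
  qed
  have h_nz: "\<exists>z. h z \<noteq> 0" using hnz[of 0] \<open>R > 0\<close> by auto
  \<comment> \<open>The least modulus of a zero of \<open>h\<close> beyond the closed disc gives a
    larger zero-free disc; R + 1 covers the case of no nearby zero.\<close>
  define S where "S = insert (R + 1) (cmod ` {z \<in> cball 0 (R+1). h z = 0})"
  have "finite S" unfolding S_def by (intro finite.insertI finite_imageI finite_zeros_cball[OF hh h_nz])
  define R' where "R' = Min S"
  have "R' \<in> S" unfolding R'_def by (rule Min_in) (use \<open>finite S\<close> S_def in auto)
  then have "R < R'" unfolding S_def using hnz by force
  have "R' \<le> R + 1" unfolding R'_def by (rule Min_le) (use \<open>finite S\<close> S_def in auto)
  have hnz': "h z \<noteq> 0" if "z \<in> ball 0 R'" for z
  proof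
    assume "h z = 0"
    then have "cmod z \<in> S" using that \<open>R' \<le> R + 1\<close> unfolding S_def by auto
    then have "R' \<le> cmod z" unfolding R'_def using \<open>finite S\<close> by (rule Min_le[rotated])
    then show False using that by simp
  qed
  obtain g where g: "g holomorphic_on ball 0 R'" "\<And>x. x \<in> ball 0 R' \<Longrightarrow> exp (g x) = h x"
    by (rule holomorphic_logarithm_exists[of "ball 0 R'" h 0])
       (use hnz' holomorphic_on_subset[OF hh] \<open>R > 0\<close> \<open>R < R'\<close> in auto)
  have gx: "exp (Re (g z)) = cmod (h z)" if "cmod z \<le> R" for z
    using g(2)[of z] that \<open>R < R'\<close> by (metis norm_exp_eq_Re mem_ball_0 order_le_less_trans)
  have g0: "Re (g 0) = ln (cmod (f 0)) + (\<Sum>a\<in>Z. real (zmult f a) * ln (R / cmod a))" if "f 0 \<noteq> 0"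
  proof -
    have a0: "cmod a > 0" if "a \<in> Z" for a using that \<open>f 0 \<noteq> 0\<close> by (auto simp: Z_def)
    have k0: "k 0 \<noteq> 0" using that k(2)[of 0] by auto
    have f0: "cmod (f 0) = cmod (k 0) * (\<Prod>a\<in>Z. cmod a ^ zmult f a)"
      by (simp add: k(2)[of 0] norm_mult prod_norm[symmetric] norm_power)
    have h0: "cmod (h 0) = cmod (k 0) * (\<Prod>a\<in>Z. R ^ zmult f a)"
      using \<open>R > 0\<close> by (simp add: h_def norm_mult prod_norm[symmetric] norm_power norm_divide power2_eq_square)
    have "Re (g 0) = ln (cmod (h 0))" using gx[of 0] \<open>R > 0\<close> by (metis ln_exp less_imp_le norm_zero)
    also have "\<dots> = ln (cmod (k 0)) + (\<Sum>a\<in>Z. real (zmult f a) * ln R)"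
      unfolding h0 using k0 ln_prod_power[OF \<open>finite Z\<close>, of "\<lambda>_. R" "zmult f"] \<open>R > 0\<close> by (subst ln_mult) auto
    also have "\<dots> = ln (cmod (k 0)) + (\<Sum>a\<in>Z. real (zmult f a) * ln (cmod a)) + (\<Sum>a\<in>Z. real (zmult f a) * ln (R / cmod a))"
      using a0 \<open>R > 0\<close> by (simp add: ln_div algebra_simps flip: sum.distrib)
    also have "ln (cmod (k 0)) + (\<Sum>a\<in>Z. real (zmult f a) * ln (cmod a)) = ln (cmod (f 0))"
      unfolding f0 using k0 ln_prod_power[OF \<open>finite Z\<close>, of cmod "zmult f"] a0 by (subst ln_mult) auto
    finally show ?thesis .
  qed
  show ?thesis
    by (rule that[OF \<open>R < R'\<close> g(1)]) (use fe fl gx g0 in \<open>auto simp: Z_def\<close>)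
qed

lemma log_plus_exp: "log_plus (exp x) = max 0 x"
  by (auto simp: log_plus_def max_def)

lemma log_plus_nonneg [simp]: "log_plus x \<ge> 0"
  by (simp add: log_plus_def)

lemma log_plus_mono: "x \<le> y \<Longrightarrow> log_plus x \<le> log_plus y"
  by (auto simp: log_plus_def)

lemma continuous_on_log_plus [continuous_intros]:
  "continuous_on A f \<Longrightarrow> continuous_on A (\<lambda>x. log_plus (f x))"
  unfolding log_plus_def by (intro continuous_intros) auto

lemma circle_integrable:
  assumes "f holomorphic_on UNIV"
  shows "(\<lambda>t. log_plus (cmod (f (circ r t)))) integrable_on {0..2*pi}"
proof (intro integrable_continuous_interval continuous_intros)
  show "continuous_on {0..2*pi} (\<lambda>t. f (circ r t))"
    by (rule continuous_on_compose2[OF holomorphic_on_imp_continuous_on[OF assms]])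
       (auto intro!: continuous_intros)
qed

text \<open>For |z| <= R/2 the Poisson kernel is at most (R + |z|) / (R - |z|) <= 3. Replacing ln
  |f| by its positive part on the circle then bounds the majorant by three times the mean.\<close>

lemma norm_le_exp_proximity:
  assumes hol: "f holomorphic_on UNIV" and nz: "\<exists>z. f z \<noteq> 0" and "R > 0"
    and circ: "\<And>z. cmod z = R \<Longrightarrow> f z \<noteq> 0" and z: "cmod z \<le> R / 2"
  shows "cmod (f z) \<le> exp (3 * proximity_function R f)"
proof -
  obtain R' g where g: "R < R'" "g holomorphic_on ball 0 R'"
    "\<forall>z. cmod z = R \<longrightarrow> cmod (f z) = exp (Re (g z))"
    "\<forall>z. cmod z \<le> R \<longrightarrow> cmod (f z) \<le> exp (Re (g z))"
    by (rule Blaschke_outer[OF hol nz \<open>R > 0\<close>], erule circ) (rule that; assumption)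
  define P where "P = (\<lambda>t. (R\<^sup>2 - (cmod z)\<^sup>2) / (cmod (circ R t - z))\<^sup>2)"
  have zR: "cmod z < R" using z \<open>R > 0\<close> by simp
  have P: "0 \<le> P t" "P t \<le> 3" for t
  proof -
    have "R - cmod z \<le> cmod (circ R t - z)"
      using norm_triangle_ineq2[of "circ R t" z] \<open>R > 0\<close> by (simp add: norm_mult)
    then have "(R - cmod z)\<^sup>2 \<le> (cmod (circ R t - z))\<^sup>2"
      using zR by (intro power_mono) auto
    moreover have "R\<^sup>2 - (cmod z)\<^sup>2 \<le> 3 * (R - cmod z)\<^sup>2"
    proof -
      have "3 * (R - cmod z)\<^sup>2 - (R\<^sup>2 - (cmod z)\<^sup>2) = 2 * (R - cmod z) * (R - 2 * cmod z)"
        by (simp add: power2_eq_square algebra_simps)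
      also have "\<dots> \<ge> 0" using z zR by (intro mult_nonneg_nonneg) auto
      finally show ?thesis by simp
    qed
    moreover have "(R - cmod z)\<^sup>2 > 0" using zR by simp
    ultimately show "P t \<le> 3" unfolding P_def by (subst pos_divide_le_eq) linarith+
    have "(cmod z)\<^sup>2 \<le> R\<^sup>2" using zR by (intro power_mono) auto
    then show "0 \<le> P t" unfolding P_def by (intro divide_nonneg_nonneg) auto
  qed
  have "((\<lambda>t. Re (of_real (P t) * g (circ R t))) has_integral Re (2 * pi * g z)) {0..2*pi}"
    unfolding P_def by (rule has_integral_Re[OF Poisson_integral[OF g(2) g(1) zR]])
  then have 1: "((\<lambda>t. P t * Re (g (circ R t))) has_integral (2 * pi * Re (g z))) {0..2*pi}"
    by simp
  have 2: "((\<lambda>t. 3 * log_plus (cmod (f (circ R t)))) has_integral (3 * (2 * pi * proximity_function R f))) {0..2*pi}"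
    using has_integral_mult_right[OF integrable_integral[OF circle_integrable[OF hol]], of 3 R]
    by (simp add: proximity_function_def)
  have "2 * pi * Re (g z) \<le> 3 * (2 * pi * proximity_function R f)"
  proof (rule has_integral_le[OF 1 2])
    fix t
    have "cmod (circ R t) = R" using \<open>R > 0\<close> by (simp add: norm_mult)
    then have "log_plus (cmod (f (circ R t))) = max 0 (Re (g (circ R t)))"
      by (simp only: g(3)[rule_format] log_plus_exp)
    moreover have "P t * Re (g (circ R t)) \<le> P t * max 0 (Re (g (circ R t)))"
      using P by (intro mult_left_mono) auto
    moreover have "P t * max 0 (Re (g (circ R t))) \<le> 3 * max 0 (Re (g (circ R t)))"
      using P by (intro mult_right_mono) auto
    ultimately show "P t * Re (g (circ R t)) \<le> 3 * log_plus (cmod (f (circ R t)))"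
      by linarith
  qed
  then have "2 * pi * Re (g z) \<le> 2 * pi * (3 * proximity_function R f)" by (simp only: mult_ac)
  then have "Re (g z) \<le> 3 * proximity_function R f" by (subst (asm) mult_le_cancel_left_pos) auto
  then show ?thesis using g(4)[rule_format, of z] zR by (smt (verit) exp_le_cancel_iff)
qed

text \<open>At the centre the Poisson kernel is 1, so the mean over the circle is the value Re (g
  0).\<close>

lemma Jensen_formula:
  assumes hol: "f holomorphic_on UNIV" and f0: "f 0 \<noteq> 0" and "R > 0"
    and circ: "\<And>z. cmod z = R \<Longrightarrow> f z \<noteq> 0"
  shows "((\<lambda>t. ln (cmod (f (circ R t)))) has_integral
     2 * pi * (ln (cmod (f 0)) + zero_log_sum f R)) {0..2*pi}"
proof -
  obtain R' g where g: "R < R'" "g holomorphic_on ball 0 R'"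
    "\<forall>z. cmod z = R \<longrightarrow> cmod (f z) = exp (Re (g z))"
    "\<forall>z. cmod z \<le> R \<longrightarrow> cmod (f z) \<le> exp (Re (g z))"
    and g0: "f 0 \<noteq> 0 \<longrightarrow> Re (g 0) = ln (cmod (f 0)) + zero_log_sum f R"
    by (rule Blaschke_outer[OF hol exI[of "\<lambda>z. f z \<noteq> 0", OF f0] \<open>R > 0\<close>], erule circ) (rule that; assumption)
  have "((\<lambda>t. Re (of_real ((R\<^sup>2 - (cmod 0)\<^sup>2) / (cmod (circ R t - 0))\<^sup>2) * g (circ R t)))
      has_integral Re (2 * pi * g 0)) {0..2*pi}"
    by (rule has_integral_Re[OF Poisson_integral[OF g(2) g(1)]]) (use \<open>R > 0\<close> in simp)
  moreover have "Re (of_real ((R\<^sup>2 - (cmod 0)\<^sup>2) / (cmod (circ R t - 0))\<^sup>2) * g (circ R t))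
     = ln (cmod (f (circ R t)))" for t
  proof -
    have "cmod (circ R t) = R" using \<open>R > 0\<close> by (simp add: norm_mult)
    then show ?thesis using g(3)[rule_format, of "circ R t"] \<open>R > 0\<close> by simp
  qed
  moreover have "Re (2 * pi * g 0) = 2 * pi * (ln (cmod (f 0)) + zero_log_sum f R)"
    by (simp only: mp[OF g0 f0, symmetric]) simp
  ultimately show ?thesis by (simp only:)
qed

text \<open>Finitely many moduli of zeros cannot exhaust an open interval.\<close>

lemma zero_free_circle:
  assumes hol: "f holomorphic_on UNIV" and nz: "\<exists>z. f z \<noteq> 0" and "a < b"
  obtains R where "a < R" "R < b" "\<And>z. cmod z = R \<Longrightarrow> f z \<noteq> (0::complex)"
proof -
  have "infinite ({a<..<b} - cmod ` {z \<in> cball 0 b. f z = 0})"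
    by (intro Diff_infinite_finite finite_imageI finite_zeros_cball[OF hol nz] infinite_Ioo \<open>a < b\<close>)
  then obtain R where R: "R \<in> {a<..<b} - cmod ` {z \<in> cball 0 b. f z = 0}"
    by (metis ex_in_conv finite.emptyI)
  show ?thesis by (rule that[of R]) (use R in auto)
qed

text \<open>Integrating log+ (a/b) <= log+ a + log+ b - ln b over the circle and inserting Jensen's
  formula for ln b produces the zero sum of the denominator, which will pay for the poles in the
  characteristic.\<close>

lemma proximity_quotient_le:
  assumes hol: "f holomorphic_on UNIV" and f0: "f 0 \<noteq> 0" and "R > 0"
    and circ: "\<And>z. cmod z = R \<Longrightarrow> f z \<noteq> 0" and holA: "A holomorphic_on UNIV"
  shows "proximity_function R (\<lambda>z. A z / f z) + zero_log_sum f R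
     \<le> proximity_function R A + proximity_function R f - ln (cmod (f 0))"
proof -
  define S where "S = ln (cmod (f 0)) + zero_log_sum f R"
  have nzc: "f (circ R t) \<noteq> 0" for t
    using circ \<open>R > 0\<close> by (simp add: norm_mult)
  have contc: "continuous_on {0..2*pi} (\<lambda>t. h (circ R t))" if "h holomorphic_on UNIV" for h :: "complex \<Rightarrow> complex"
    by (rule continuous_on_compose2[OF holomorphic_on_imp_continuous_on[OF that]])
       (auto intro!: continuous_intros)
  have I1: "((\<lambda>t. log_plus (cmod (A (circ R t)))) has_integral 2 * pi * proximity_function R A) {0..2*pi}"
    using integrable_integral[OF circle_integrable[OF holA]] by (simp add: proximity_function_def)
  have I2: "((\<lambda>t. log_plus (cmod (f (circ R t)))) has_integral 2 * pi * proximity_function R f) {0..2*pi}"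
    using integrable_integral[OF circle_integrable[OF hol]] by (simp add: proximity_function_def)
  have "(\<lambda>t. log_plus (cmod (A (circ R t) / f (circ R t)))) integrable_on {0..2*pi}"
    by (intro integrable_continuous_interval continuous_intros contc hol holA) (use nzc in auto)
  then have I3: "((\<lambda>t. log_plus (cmod (A (circ R t) / f (circ R t)))) has_integral
      2 * pi * proximity_function R (\<lambda>z. A z / f z)) {0..2*pi}"
    using integrable_integral by (simp add: proximity_function_def has_integral_integral)
  have "2 * pi * proximity_function R (\<lambda>z. A z / f z)
     \<le> 2 * pi * proximity_function R A + 2 * pi * proximity_function R f - 2 * pi * S"
    unfolding S_def
  proof (rule has_integral_le[OF I3 has_integral_diff[OF has_integral_add[OF I1 I2] Jensen_formula[OF hol f0 \<open>R > 0\<close> circ]]])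
    fix t
    define a b where "a = cmod (A (circ R t))" and "b = cmod (f (circ R t))"
    have "b > 0" "a \<ge> 0" using nzc by (auto simp: a_def b_def)
    have "log_plus (a / b) \<le> log_plus a + log_plus b - ln b"
    proof (cases "a / b \<le> 1")
      case True
      then have "log_plus (a / b) = 0" by (simp add: log_plus_def max_def)
      moreover have "ln b \<le> log_plus b" using \<open>b > 0\<close> by (simp add: log_plus_def)
      ultimately show ?thesis using log_plus_nonneg[of a] by linarith
    next
      case False
      then have "a > 0" using \<open>a \<ge> 0\<close> \<open>b > 0\<close> by (cases "a = 0") auto
      have "log_plus (a / b) = ln a - ln b" using False \<open>a > 0\<close> \<open>b > 0\<close> by (simp add: log_plus_def max_def ln_div)
      moreover have "ln a \<le> log_plus a" using \<open>a > 0\<close> by (simp add: log_plus_def)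
      ultimately show ?thesis using log_plus_nonneg[of b] by linarith
    qed
    then show "log_plus (cmod (A (circ R t) / f (circ R t)))
      \<le> log_plus (cmod (A (circ R t))) + log_plus (cmod (f (circ R t))) - ln (cmod (f (circ R t)))"
      by (simp add: norm_divide a_def b_def)
  qed auto
  then have "2 * pi * proximity_function R (\<lambda>z. A z / f z) \<le> 2 * pi * (proximity_function R A + proximity_function R f - S)"
    by (simp only: distrib_left right_diff_distrib)
  then show ?thesis by (subst (asm) mult_le_cancel_left_pos) (auto simp: S_def)
qed

lemma proximity_le:
  assumes bd: "\<And>z. cmod z = r \<Longrightarrow> cmod (f z) \<le> exp M" and "M \<ge> 0" "r \<ge> 0"
  shows "proximity_function r f \<le> M"
proof -
  have "integral {0..2*pi} (\<lambda>t. log_plus (cmod (f (circ r t)))) \<le> 2 * pi * M"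
  \<comment> \<open>No regularity of \<open>f\<close> is assumed; where the integrand is not
    integrable, \<open>integral\<close> is 0.\<close>
  proof (cases "(\<lambda>t. log_plus (cmod (f (circ r t)))) integrable_on {0..2*pi}")
    case True
    have "((\<lambda>t. M) has_integral M * (2 * pi - 0)) {0..2*pi}"
      using has_integral_const_real[of M 0 "2*pi"] by (simp add: mult_ac)
    then have "integral {0..2*pi} (\<lambda>t. log_plus (cmod (f (circ r t)))) \<le> M * (2 * pi - 0)"
    proof (rule has_integral_le[OF integrable_integral[OF True]])
      fix t
      have "log_plus (cmod (f (circ r t))) \<le> log_plus (exp M)"
        by (intro log_plus_mono bd) (use \<open>r \<ge> 0\<close> in \<open>simp add: norm_mult\<close>)
      then show "log_plus (cmod (f (circ r t))) \<le> M" using \<open>M \<ge> 0\<close> by (simp add: log_plus_exp)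
    qed
    then show ?thesis by (simp add: mult_ac)
  qed (use \<open>M \<ge> 0\<close> in \<open>simp add: not_integrable_integral\<close>)
  then show ?thesis by (simp add: proximity_function_def field_simps)
qed

text \<open>In Jensen's formula on a circle of radius T > 3R each zero in |a| < R weighs at least ln
  3 >= 1, while the mean of ln |f| is bounded by the growth.\<close>

lemma zero_count_bound:
  fixes s :: real
  assumes hol: "f holomorphic_on UNIV" and f0: "f 0 \<noteq> 0" and C: "C \<ge> 0" and s: "s \<ge> 0"
    and bd: "\<And>z. cmod (f z) \<le> exp (C * (1 + cmod z) powr s)"
  shows "\<exists>K\<ge>0. \<forall>R\<ge>0. real (\<Sum>a | f a = 0 \<and> cmod a < R. zmult f a) \<le> K * (1 + R) powr s"
proof (intro exI[of _ "C * 4 powr s + \<bar>ln (cmod (f 0))\<bar>"] conjI allI impI)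
  have nz: "\<exists>z. f z \<noteq> 0" using f0 by blast
  show "0 \<le> C * 4 powr s + \<bar>ln (cmod (f 0))\<bar>" using C by simp
  fix R :: real assume "R \<ge> 0"
  obtain T where T: "3 * R < T" "T < 3 * R + 1" "\<And>z. cmod z = T \<Longrightarrow> f z \<noteq> 0"
    using zero_free_circle[OF hol nz, of "3 * R" "3 * R + 1"] by auto
  have "T > 0" using T \<open>R \<ge> 0\<close> by simp
  have fin: "finite {a. f a = 0 \<and> cmod a < r}" for r
    by (rule finite_subset[OF _ finite_zeros_cball[OF hol nz, of r]]) auto
  have "2 * pi * (ln (cmod (f 0)) + zero_log_sum f T)
     \<le> (C * (1 + T) powr s) * (2 * pi - 0)"
  proof (rule has_integral_le[OF Jensen_formula[OF hol f0 \<open>T > 0\<close> T(3)]])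
    show "((\<lambda>t. C * (1 + T) powr s) has_integral (C * (1 + T) powr s) * (2 * pi - 0)) {0..2*pi}"
      using has_integral_const_real[of "C * (1 + T) powr s" 0 "2*pi"] by (simp add: mult_ac)
    fix t
    have n: "cmod (circ T t) = T" using \<open>T > 0\<close> by (simp add: norm_mult)
    have "ln (cmod (f (circ T t))) \<le> ln (exp (C * (1 + T) powr s))"
      by (subst ln_le_cancel_iff) (use bd[of "circ T t"] T(3)[OF n] n in auto)
    then show "ln (cmod (f (circ T t))) \<le> C * (1 + T) powr s" by simp
  qed auto
  then have "2 * pi * (ln (cmod (f 0)) + zero_log_sum f T)
     \<le> 2 * pi * (C * (1 + T) powr s)" by (simp add: mult_ac)
  then have 1: "zero_log_sum f T \<le> C * (1 + T) powr s + \<bar>ln (cmod (f 0))\<bar>"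
    by (subst (asm) mult_le_cancel_left_pos) auto
  have apos: "cmod a > 0" if "f a = 0" for a using f0 that by auto
  have "real (\<Sum>a | f a = 0 \<and> cmod a < R. zmult f a) = (\<Sum>a | f a = 0 \<and> cmod a < R. real (zmult f a) * 1)"
    by simp
  also have "\<dots> \<le> (\<Sum>a | f a = 0 \<and> cmod a < R. real (zmult f a) * ln (T / cmod a))"
  proof (intro sum_mono mult_left_mono)
    fix a assume a: "a \<in> {a. f a = 0 \<and> cmod a < R}"
    have "3 \<le> T / cmod a" using a T apos[of a] by (simp add: field_simps)
    moreover have "exp 1 \<le> (3::real)" by (rule exp_le)
    ultimately have "exp 1 \<le> T / cmod a" by linarith
    then show "1 \<le> ln (T / cmod a)" by (subst ln_ge_iff) (use a apos \<open>T > 0\<close> in auto)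
  qed auto
  also have "\<dots> \<le> zero_log_sum f T"
    using T \<open>R \<ge> 0\<close> apos by (intro sum_mono2[OF fin]) (auto intro!: mult_nonneg_nonneg ln_ge_zero simp: field_simps)
  also note 1
  also have "C * (1 + T) powr s + \<bar>ln (cmod (f 0))\<bar> \<le> C * (4 powr s * (1 + R) powr s) + \<bar>ln (cmod (f 0))\<bar> * (1 + R) powr s"
  proof (intro add_mono mult_left_mono C)
    have "(1 + T) powr s \<le> (4 * (1 + R)) powr s"
      by (rule powr_mono2) (use T \<open>R \<ge> 0\<close> s in auto)
    also have "\<dots> = 4 powr s * (1 + R) powr s" by (rule powr_mult)
    finally show "(1 + T) powr s \<le> 4 powr s * (1 + R) powr s" .
    have "1 \<le> (1 + R) powr s" using \<open>R \<ge> 0\<close> s by (simp add: ge_one_powr_ge_zero)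
    then show "\<bar>ln (cmod (f 0))\<bar> \<le> \<bar>ln (cmod (f 0))\<bar> * (1 + R) powr s" by (simp add: mult_le_cancel_left1)
  qed
  finally show "real (\<Sum>a | f a = 0 \<and> cmod a < R. zmult f a) \<le> (C * 4 powr s + \<bar>ln (cmod (f 0))\<bar>) * (1 + R) powr s"
    by (simp add: algebra_simps)
qed

section \<open>From the order of growth to pointwise bounds\<close>

lemma order_of_growth_nonneg: "order_of_growth g \<ge> 0"
proof -
  have "eventually (\<lambda>r::real. 0 \<le> ereal (log_plus (nevanlinna_characteristic r g) / ln r)) at_top"
    using eventually_gt_at_top[of 1] by eventually_elim simp
  then show ?thesis unfolding order_of_growth_def by (intro le_Limsup) auto
qed

lemma eventually_characteristic_le:
  assumes "order_of_growth g < ereal s"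
  shows "eventually (\<lambda>r. nevanlinna_characteristic r g \<le> r powr s) at_top"
proof -
  have "eventually (\<lambda>r. ereal (log_plus (nevanlinna_characteristic r g) / ln r) < ereal s) at_top"
    using Limsup_lessD assms unfolding order_of_growth_def by blast
  then show ?thesis using eventually_gt_at_top[of 1]
  proof eventually_elim
    case (elim r)
    then have "ln (max 1 (nevanlinna_characteristic r g)) < s * ln r"
      by (simp add: log_plus_def field_simps)
    also have "\<dots> = ln (r powr s)" using elim by (simp add: ln_powr)
    finally have "max 1 (nevanlinna_characteristic r g) < r powr s"
      using elim by (subst (asm) ln_less_cancel_iff) auto
    then show ?case by simp
  qed
qed

text \<open>An entire function has no poles, so its characteristic is the proximity function, and a
  zero-free circle of radius slightly above 2|z| controls the value at z.\<close>

lemma entire_order_imp_growth: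
  assumes hol: "f holomorphic_on UNIV" and nz: "\<exists>z. f z \<noteq> 0" and ord: "order_of_growth f < ereal s"
  shows "exp_growth s f"
proof -
  have s: "s > 0" using order_of_growth_nonneg[of f] ord
    by (metis ereal_less(2) order_le_less_trans)
  have np: "\<not> is_pole f z" for z
    using not_is_pole_holomorphic[of UNIV z f] hol by auto
  have "pole_count t f = 0" for t unfolding pole_count_def using np by simp
  then have N: "nevanlinna_characteristic r f = proximity_function r f" for r
    by (simp add: nevanlinna_characteristic_def counting_function_def)
  obtain r0 where r0: "\<And>r. r \<ge> r0 \<Longrightarrow> proximity_function r f \<le> r powr s"
    using eventually_characteristic_le[OF ord] unfolding N eventually_at_top_linorder by blast
  define K where "K = 2 * \<bar>r0\<bar> + 3"
  show ?thesis
  proof (intro exI[of _ "3 * K powr s"] conjI allI)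
    fix z
    \<comment> \<open>Large enough for both requirements on the circle: |z| <= R/2, and R beyond the
      threshold of the characteristic bound.\<close>
    define b where "b = 2 * cmod z + \<bar>r0\<bar> + 1"
    obtain R where R: "b < R" "R < b + 1" "\<And>z. cmod z = R \<Longrightarrow> f z \<noteq> 0"
      using zero_free_circle[OF hol nz, of b "b + 1"] by auto
    have "R > 0" "R \<ge> r0" "cmod z \<le> R / 2" using R(1,2) norm_ge_zero[of z] unfolding b_def by linarith+
    have "cmod (f z) \<le> exp (3 * proximity_function R f)"
      by (rule norm_le_exp_proximity[OF hol nz \<open>R > 0\<close> R(3) \<open>cmod z \<le> R / 2\<close>])
    also have "\<dots> \<le> exp (3 * R powr s)" using r0[OF \<open>R \<ge> r0\<close>] by simp
    also have "\<dots> \<le> exp (3 * K powr s * (1 + cmod z) powr s)"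
    proof -
      have "R \<le> K * (1 + cmod z)"
      proof -
        have "K * (1 + cmod z) = (2 * \<bar>r0\<bar> + 3) + (2 * \<bar>r0\<bar>) * cmod z + 3 * cmod z"
          by (simp add: K_def algebra_simps)
        moreover have "(2 * \<bar>r0\<bar>) * cmod z \<ge> 0" by simp
        ultimately show ?thesis using R(2) norm_ge_zero[of z] unfolding b_def by linarith
      qed
      then have "R powr s \<le> (K * (1 + cmod z)) powr s" using \<open>R > 0\<close> s by (intro powr_mono2) auto
      also have "\<dots> = K powr s * (1 + cmod z) powr s" by (subst powr_mult) (auto simp: K_def)
      finally show ?thesis by simp
    qed
    finally show "cmod (f z) \<le> exp (3 * K powr s * (1 + cmod z) powr s)" .
  qed (simp add: K_def)
qed

section \<open>Rows of zeros\<close>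

text \<open>Stated by coefficients so that the zero polynomial qualifies for every q, also q = 0,
  and closure under sums is immediate.\<close>

definition poly_deg_lt :: "nat \<Rightarrow> complex poly \<Rightarrow> bool" where
  "poly_deg_lt q P \<longleftrightarrow> (\<forall>i\<ge>q. coeff P i = 0)"

lemma poly_deg_lt_0 [simp]: "poly_deg_lt q 0"
  by (simp add: poly_deg_lt_def)

lemma poly_deg_lt_const: "q \<ge> 1 \<Longrightarrow> poly_deg_lt q [:c:]"
  by (auto simp: poly_deg_lt_def coeff_pCons split: nat.split)

lemma poly_deg_lt_add: "poly_deg_lt q P \<Longrightarrow> poly_deg_lt q Q \<Longrightarrow> poly_deg_lt q (P + Q)"
  by (simp add: poly_deg_lt_def)

lemma poly_deg_lt_diff: "poly_deg_lt q P \<Longrightarrow> poly_deg_lt q Q \<Longrightarrow> poly_deg_lt q (P - Q)"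
  by (simp add: poly_deg_lt_def)

lemma poly_deg_lt_smult: "poly_deg_lt q P \<Longrightarrow> poly_deg_lt q (smult c P)"
  by (simp add: poly_deg_lt_def)

lemma poly_deg_lt_sum: "(\<And>i. i \<in> I \<Longrightarrow> poly_deg_lt q (P i)) \<Longrightarrow> poly_deg_lt q (\<Sum>i\<in>I. P i)"
  by (simp add: poly_deg_lt_def coeff_sum)

lemma poly_deg_lt_alt: "poly_deg_lt q P \<longleftrightarrow> P = 0 \<or> degree P < q"
proof
  assume P: "poly_deg_lt q P"
  show "P = 0 \<or> degree P < q"
  proof (rule ccontr)
    assume "\<not> (P = 0 \<or> degree P < q)"
    then have "P \<noteq> 0" "degree P \<ge> q" by auto
    then have "coeff P (degree P) = 0" using P unfolding poly_deg_lt_def by blast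
    then show False using \<open>P \<noteq> 0\<close> by simp
  qed
qed (auto simp: poly_deg_lt_def intro: coeff_eq_0)

lemma poly_deg_lt_shift_diff:
  assumes "j \<le> q" "j \<ge> 1"
  shows "poly_deg_lt q ([:1, 1:] ^ j - [:0, 1:] ^ j)"
proof -
  have 1: "degree ([:1, 1::complex:] ^ j) = j" "coeff ([:1, 1::complex:] ^ j) j = 1"
    using degree_linear_power[of "1::complex" j] coeff_linear_power[of "1::complex" j] by auto
  have 2: "[:0, 1::complex:] ^ j = monom 1 j" by (simp add: monom_altdef)
  show ?thesis unfolding poly_deg_lt_def
  proof (intro allI impI)
    fix i assume "q \<le> i"
    show "coeff ([:1, 1:] ^ j - [:0, 1:] ^ j) i = (0::complex)"
    proof (cases "i = j")
      case False
      then have "i > j" using \<open>q \<le> i\<close> assms by simp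
      then have "coeff ([:1, 1::complex:] ^ j) i = 0" using 1 by (intro coeff_eq_0) simp
      with False show ?thesis by (simp add: 2)
    qed (use 1 in \<open>simp add: 2\<close>)
  qed
qed

abbreviation row_factor :: "nat \<Rightarrow> complex \<Rightarrow> nat \<Rightarrow> complex \<Rightarrow> complex" where
  "row_factor q b k z \<equiv> weierstrass_factor q (z / (b + of_nat k))"

text \<open>For q >= 1 and b not in {0, -1, -2, ...} this is 1/Gamma(b - z) up to the exponential of
  a polynomial.\<close>

definition row :: "nat \<Rightarrow> complex \<Rightarrow> complex \<Rightarrow> complex" where
  "row q b z = (\<Prod>k. row_factor q b k z)"

lemma summable_Suc_powr:
  assumes "s > 1"
  shows "summable (\<lambda>k. (real k + 1) powr - s)"
proof -
  have "summable (\<lambda>k. real k powr - s)" using assms by (subst summable_real_powr_iff) auto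
  then have "summable (\<lambda>k. real (Suc k) powr - s)" by (subst summable_Suc_iff)
  then show ?thesis by (simp add: add_ac)
qed

lemma row_factor_bound:
  fixes \<tau> :: real
  assumes C: "\<And>u. cmod (weierstrass_factor q u) \<le> exp (C * cmod u powr \<tau>)" and "C > 0"
    and d: "cmod b powr - \<tau> \<le> d"
  shows "cmod (weierstrass_factor q (z / b)) \<le> exp (C * d * cmod z powr \<tau>)"
proof -
  have "cmod (z / b) powr \<tau> = cmod b powr - \<tau> * cmod z powr \<tau>"
    unfolding norm_divide powr_divide powr_minus by (simp add: divide_inverse)
  also have "\<dots> \<le> d * cmod z powr \<tau>" using d by (intro mult_right_mono) auto
  finally have "C * cmod (z / b) powr \<tau> \<le> C * (d * cmod z powr \<tau>)" using \<open>C > 0\<close> by simp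
  then show ?thesis using C[of "z / b"] by (smt (verit) exp_le_cancel_iff mult.assoc)
qed

lemma row_basic:
  assumes q: "q \<ge> 1" and c: "c > 0" and b: "\<And>k. cmod (b + of_nat k) \<ge> c * (real k + 1)"
  shows "row q b holomorphic_on UNIV"
    and "(\<lambda>K. \<Prod>k<K. row_factor q b k z) \<longlonglongrightarrow> row q b z"
    and "row q b z = 0 \<longleftrightarrow> (\<exists>k. z = b + of_nat k)"
    and "row q b 0 = 1"
proof -
  \<comment> \<open>The largest exponent the factor bound admits; being at least 2, it makes the sum
    over a row with |b + k| of linear growth converge.\<close>
  define \<tau> where "\<tau> = real q + 1"
  obtain C where C: "C > 0" "\<And>u. cmod (weierstrass_factor q u) \<le> exp (C * cmod u powr \<tau>)"
    using weierstrass_factor_exp_bound[of q \<tau>] q unfolding \<tau>_def by auto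
  define d where "d = (\<lambda>k. c powr - \<tau> * (real k + 1) powr - \<tau>)"
  have d: "cmod (b + of_nat k) powr - \<tau> \<le> d k" for k
  proof -
    have "cmod (b + of_nat k) powr - \<tau> \<le> (c * (real k + 1)) powr - \<tau>"
      using b c by (intro powr_mono2') (auto simp: \<tau>_def)
    then show ?thesis unfolding d_def by (simp add: powr_mult)
  qed
  have sm: "summable (\<lambda>k. C * d k)"
    unfolding d_def using q by (intro summable_mult summable_Suc_powr) (auto simp: \<tau>_def)
  have nz: "b + of_nat k \<noteq> 0" for k
  proof
    assume "b + of_nat k = 0"
    then have "c * (real k + 1) \<le> 0" using b[of k] by simp
    then show False using c by (simp add: mult_le_0_iff)
  qed
  have row: "row q b = (\<lambda>z. \<Prod>k. row_factor q b k z)"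
    by (simp add: row_def fun_eq_iff)
  note cp = canonical_product[where f="\<lambda>k z. row_factor q b k z" and c="\<lambda>k. C * d k" and \<tau>=\<tau>]
  have hyps: "\<And>n. (\<lambda>z. row_factor q b n z) holomorphic_on UNIV"
    by (intro holomorphic_intros nz)
  have h2: "\<And>n. weierstrass_factor q (0 / (b + of_nat n)) = 1" by simp
  have h3: "\<And>n. 0 \<le> C * d n" using C c by (simp add: d_def)
  have h4: "\<tau> > 0" by (simp add: \<tau>_def)
  have h5: "\<And>n z. cmod (row_factor q b n z) \<le> exp (C * d n * cmod z powr \<tau>)"
    by (rule row_factor_bound[OF C(2) C(1) d])
  note cp = cp[OF hyps h2 h3 sm h4 h5]
  show "row q b holomorphic_on UNIV" unfolding row by (rule cp(2))
  show "(\<lambda>K. \<Prod>k<K. row_factor q b k z) \<longlonglongrightarrow> row q b z"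
    unfolding row by (rule tendsto_uniform_limitI[OF cp(1)[of "cmod z"]]) auto
  show "row q b z = 0 \<longleftrightarrow> (\<exists>k. z = b + of_nat k)"
    unfolding row cp(4) weierstrass_factor_eq_0_iff by (simp only: divide_eq_1_iff nz simp_thms)
  show "row q b 0 = 1" by (simp add: row_def)
qed

text \<open>The point is the decay in |a|, uniform over all rows. In (|a| +
  k)^(-\<open>\<tau>\<close>) the exponent 1 + \<open>\<delta>\<close> is spent on summing over k
  and the rest bounds the row by a power of |a|; the exponent 1 lost here is why order sigma becomes
  sigma + 1. In K, 2^\<open>\<tau>\<close> comes from the factor 1/2 in the hypothesis and the power
  of \<open>\<rho>\<close> from |a| + k >= \<open>\<rho>\<close> (k + 1).\<close>

lemma row_bound:
  fixes \<tau> \<delta> \<rho> :: real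
  assumes q: "q \<ge> 1" and tau: "real q \<le> \<tau>" "\<tau> \<le> real q + 1" and del: "\<delta> > 0" "1 + \<delta> \<le> \<tau>"
    and rho: "0 < \<rho>" "\<rho> \<le> 1"
  shows "\<exists>K\<ge>0. \<forall>a b. \<rho> \<le> cmod a \<longrightarrow> (\<forall>k. cmod (b + of_nat k) \<ge> (cmod a + real k) / 2) \<longrightarrow>
    (\<forall>z. cmod (row q b z) \<le> exp (K * cmod a powr - (\<tau> - 1 - \<delta>) * cmod z powr \<tau>))"
proof -
  obtain C where C: "C > 0" "\<And>u. cmod (weierstrass_factor q u) \<le> exp (C * cmod u powr \<tau>)"
    using weierstrass_factor_exp_bound[of q \<tau>] q tau by auto
  define S where "S = (\<Sum>k. (real k + 1) powr - (1 + \<delta>))"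
  have smS: "summable (\<lambda>k. (real k + 1) powr - (1 + \<delta>))" using del by (intro summable_Suc_powr) auto
  have "S \<ge> 0" unfolding S_def using smS by (intro suminf_nonneg) auto
  define K where "K = C * (2 powr \<tau> * \<rho> powr - (1 + \<delta>)) * S"
  show ?thesis
  proof (intro exI[of _ K] conjI allI impI)
    show "K \<ge> 0" using C \<open>S \<ge> 0\<close> by (simp add: K_def)
    fix a b z :: complex assume a: "\<rho> \<le> cmod a" and b: "\<forall>k. (cmod a + real k) / 2 \<le> cmod (b + of_nat k)"
    have a0: "cmod a > 0" using a rho by linarith
    define d where "d = (\<lambda>k. (2 powr \<tau> * \<rho> powr - (1 + \<delta>)) * cmod a powr - (\<tau> - 1 - \<delta>) * (real k + 1) powr - (1 + \<delta>))"
    have d: "cmod (b + of_nat k) powr - \<tau> \<le> d k" for k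
    proof -
      have "cmod (b + of_nat k) powr - \<tau> \<le> ((cmod a + real k) / 2) powr - \<tau>"
        using b a0 tau by (intro powr_mono2') (auto intro: add_pos_nonneg)
      also have "\<dots> = 2 powr \<tau> * (cmod a + real k) powr - \<tau>"
        unfolding powr_divide powr_minus by (simp add: divide_inverse)
      also have "(cmod a + real k) powr - \<tau> = (cmod a + real k) powr - (\<tau> - 1 - \<delta>) * (cmod a + real k) powr - (1 + \<delta>)"
        by (simp flip: powr_add)
      also have "\<dots> \<le> cmod a powr - (\<tau> - 1 - \<delta>) * (\<rho> * (real k + 1)) powr - (1 + \<delta>)"
      proof (intro mult_mono)
        show "(cmod a + real k) powr - (\<tau> - 1 - \<delta>) \<le> cmod a powr - (\<tau> - 1 - \<delta>)"
          using a0 del by (intro powr_mono2') auto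
        have "\<rho> * real k \<le> 1 * real k" using rho by (intro mult_right_mono) auto
        then have "\<rho> * (real k + 1) \<le> cmod a + real k" using a by (simp add: algebra_simps)
        then show "(cmod a + real k) powr - (1 + \<delta>) \<le> (\<rho> * (real k + 1)) powr - (1 + \<delta>)"
          using rho del by (intro powr_mono2') auto
      qed auto
      also have "(\<rho> * (real k + 1)) powr - (1 + \<delta>) = \<rho> powr - (1 + \<delta>) * (real k + 1) powr - (1 + \<delta>)"
        by (rule powr_mult)
      finally show ?thesis by (simp add: d_def mult_ac)
    qed
    have dd: "C * d k = (C * (2 powr \<tau> * \<rho> powr - (1 + \<delta>)) * cmod a powr - (\<tau> - 1 - \<delta>)) * (real k + 1) powr - (1 + \<delta>)" for k
      by (simp only: d_def mult_ac)
    have dS: "summable (\<lambda>k. C * d k)" "(\<Sum>k. C * d k) = K * cmod a powr - (\<tau> - 1 - \<delta>)"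
      unfolding dd by (rule summable_mult[OF smS]) (subst suminf_mult[OF smS], simp only: K_def S_def mult_ac)
    have nz: "b + of_nat k \<noteq> 0" for k
      using b[rule_format, of k] a0 of_nat_0_le_iff[of k, where 'a=real] by (metis add_pos_nonneg half_gt_zero not_le norm_zero)
    have h1: "\<And>n. (\<lambda>z. row_factor q b n z) holomorphic_on UNIV"
      by (intro holomorphic_intros nz)
    have h2: "\<And>n. weierstrass_factor q (0 / (b + of_nat n)) = 1" by simp
    have h3: "\<And>n. 0 \<le> C * d n" using C by (simp add: d_def)
    have h4: "\<tau> > 0" using tau q by simp
    have h5: "\<And>n z. cmod (row_factor q b n z) \<le> exp (C * d n * cmod z powr \<tau>)"
      by (rule row_factor_bound[OF C(2) C(1) d])
    show "cmod (row q b z) \<le> exp (K * cmod a powr - (\<tau> - 1 - \<delta>) * cmod z powr \<tau>)"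
      unfolding row_def dS(2)[symmetric]
      by (rule canonical_product(3)[where f="\<lambda>k z. row_factor q b k z" and c="\<lambda>k. C * d k" and \<tau>=\<tau>, OF h1 h2 h3 dS(1) h4 h5])
  qed
qed

text \<open>The analogue of Gamma(z + 1) = z Gamma(z), with telescoping partial products. The terms
  j >= 2 of the exponents converge; the term j = 1 diverges, but does not depend on z, so its
  renormalised limit can be read off at a single point instead of being computed.\<close>

lemma row_shift:
  assumes q: "q \<ge> 1" and c: "c > 0" and b: "\<And>k. cmod (b + of_nat k) \<ge> c * (real k + 1)"
  shows "\<exists>P. poly_deg_lt q P \<and> (\<forall>z. row q b (z + 1) = (b - 1 - z) * exp (poly P z) * row q b z)"
proof -
  have nz: "b + of_nat k \<noteq> 0" for k
  proof
    assume "b + of_nat k = 0"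
    then have "c * (real k + 1) \<le> 0" using b[of k] by simp
    then show False using c by (simp add: mult_le_0_iff)
  qed
  define RK where "RK = (\<lambda>K z. \<Prod>k<K. row_factor q b k z)"
  have RKlim: "(\<lambda>K. RK K z) \<longlonglongrightarrow> row q b z" for z
    unfolding RK_def by (rule row_basic(2)[OF q c b])
  define D where "D = (\<lambda>j z. ((z + 1) ^ j - z ^ j) / of_nat j :: complex)"
  define S where "S = (\<lambda>j K. \<Sum>k<K. 1 / (b + of_nat k) ^ j)"
  \<comment> \<open>b + K - 1 - z is the linear factor left over at the far end of the telescoping
    product, b - 1 - z the one at the near end.\<close>
  have fin: "(b + of_nat K - 1 - z) * RK K (z + 1) = (b - 1 - z) * RK K z * exp (\<Sum>j=1..q. D j z * S j K)" for K z
  proof (induction K)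
    case 0
    show ?case by (simp add: RK_def S_def)
  next
    case (Suc K)
    have x: "b + of_nat K \<noteq> 0" by (rule nz)
    have e: "(\<Sum>j=1..q. ((z + 1) / (b + of_nat K)) ^ j / of_nat j) =
        (\<Sum>j=1..q. (z / (b + of_nat K)) ^ j / of_nat j) + (\<Sum>j=1..q. D j z * (1 / (b + of_nat K) ^ j))"
      unfolding sum.distrib[symmetric]
      by (intro sum.cong refl) (simp add: D_def power_divide left_diff_distrib diff_divide_distrib mult.commute)
    have S: "(\<Sum>j=1..q. D j z * S j (Suc K)) = (\<Sum>j=1..q. D j z * S j K) + (\<Sum>j=1..q. D j z * (1 / (b + of_nat K) ^ j))"
      by (simp add: S_def distrib_left sum.distrib)
    have t: "(b + of_nat (Suc K) - 1 - z) * (1 - (z + 1) / (b + of_nat K)) = (b + of_nat K - 1 - z) * (1 - z / (b + of_nat K))"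
    proof -
      have "1 - (z + 1) / (b + of_nat K) = (b + of_nat K - 1 - z) / (b + of_nat K)"
        "1 - z / (b + of_nat K) = (b + of_nat K - z) / (b + of_nat K)"
        using x by (simp_all add: field_simps)
      then show ?thesis by (simp add: mult_ac)
    qed
    define A where "A = (\<Sum>j=1..q. (z / (b + of_nat K)) ^ j / of_nat j)"
    define B where "B = (\<Sum>j=1..q. D j z * (1 / (b + of_nat K) ^ j))"
    have "(b + of_nat (Suc K) - 1 - z) * RK (Suc K) (z + 1)
       = ((b + of_nat (Suc K) - 1 - z) * (1 - (z + 1) / (b + of_nat K))) * RK K (z + 1) * exp (A + B)"
      by (simp only: RK_def weierstrass_factor_def prod.lessThan_Suc e A_def B_def mult_ac)
    also have "\<dots> = ((b + of_nat K - 1 - z) * RK K (z + 1)) * (1 - z / (b + of_nat K)) * exp (A + B)"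
      unfolding t by (simp add: mult_ac)
    also have "\<dots> = (b - 1 - z) * RK K z * exp (\<Sum>j=1..q. D j z * S j K) * (1 - z / (b + of_nat K)) * exp (A + B)"
      unfolding Suc.IH ..
    also have "\<dots> = (b - 1 - z) * (RK K z * ((1 - z / (b + of_nat K)) * exp A)) * exp ((\<Sum>j=1..q. D j z * S j K) + B)"
      by (simp add: exp_add mult_ac)
    also have "RK K z * ((1 - z / (b + of_nat K)) * exp A) = RK (Suc K) z"
      by (simp add: RK_def weierstrass_factor_def A_def)
    also have "(\<Sum>j=1..q. D j z * S j K) + B = (\<Sum>j=1..q. D j z * S j (Suc K))"
      unfolding S B_def ..
    finally show ?case .
  qed
  have smS: "summable (\<lambda>k. 1 / (b + of_nat k) ^ j)" if "j \<ge> 2" for j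
  proof (rule summable_comparison_test')
    show "summable (\<lambda>k. c powr - 2 * (real k + 1) powr - 2 * (if j = 2 then 1 else c powr (2 - real j)))"
      by (intro summable_mult summable_mult2 summable_Suc_powr) auto
    fix k
    have pos: "c * (real k + 1) > 0" using c by simp
    have "norm (1 / (b + of_nat k) ^ j) = 1 / cmod (b + of_nat k) ^ j" by (simp add: norm_divide norm_power)
    also have "\<dots> \<le> 1 / (c * (real k + 1)) ^ j"
    proof (intro divide_left_mono power_mono mult_pos_pos zero_less_power)
      show "0 < cmod (b + of_nat k)" using b[of k] pos by linarith
    qed (use b pos c in auto)
    also have "\<dots> = c powr - real j * (real k + 1) powr - real j"
      unfolding power_mult_distrib powr_minus using c by (simp add: powr_realpow divide_inverse)
    also have "\<dots> \<le> c powr - real j * (real k + 1) powr - 2"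
      using that by (intro mult_left_mono powr_mono) auto
    also have "\<dots> = c powr - 2 * (real k + 1) powr - 2 * (if j = 2 then 1 else c powr (2 - real j))"
      using c by (simp add: mult_ac flip: powr_add)
    finally show "norm (1 / (b + of_nat k) ^ j) \<le> c powr - 2 * (real k + 1) powr - 2 * (if j = 2 then 1 else c powr (2 - real j))" .
  qed
  define \<zeta> where "\<zeta> = (\<lambda>j. \<Sum>k. 1 / (b + of_nat k) ^ j)"
  have Slim: "(\<lambda>K. S j K) \<longlonglongrightarrow> \<zeta> j" if "j \<ge> 2" for j
    unfolding S_def \<zeta>_def by (rule summable_LIMSEQ[OF smS[OF that]])
  define T where "T = (\<lambda>z K. \<Sum>j=2..q. D j z * S j K)"
  define T' where "T' = (\<lambda>z. \<Sum>j=2..q. D j z * \<zeta> j)"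
  have Tlim: "(\<lambda>K. T z K) \<longlonglongrightarrow> T' z" for z
    unfolding T_def T'_def by (intro tendsto_intros Slim) auto
  have split: "(\<Sum>j=1..q. D j z * S j K) = S 1 K + T z K" for z K
  proof -
    have "{1..q} = insert 1 {2..q}" using q by auto
    then show ?thesis by (simp add: T_def D_def)
  qed
  \<comment> \<open>\<open>D 1 z\<close> is 1, so the divergent sum \<open>S 1 K\<close> enters
    without z; exp of it grows like a constant times K and is balanced by the leftover linear
    factor.\<close>
  define e where "e = (\<lambda>K. exp (S 1 K) / (b + of_nat K - 1))"
  have inf: "filterlim (\<lambda>K. b + of_nat K - 1 :: complex) at_infinity sequentially"
  proof -
    have "filterlim (\<lambda>K. of_nat K :: complex) at_infinity sequentially" by (rule tendsto_of_nat)
    from tendsto_add_filterlim_at_infinity[OF tendsto_const this, of "b - 1"] show ?thesis by (simp add: algebra_simps)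
  qed
  have ev: "eventually (\<lambda>K. b + of_nat K - 1 \<noteq> 0) sequentially"
  proof -
    have "b + of_nat K - 1 \<noteq> 0" if "K \<ge> 1" for K
      using nz[of "K - 1"] that by (simp add: of_nat_diff algebra_simps)
    then show ?thesis unfolding eventually_sequentially by blast
  qed
  have l1: "(\<lambda>K. 1 - z / (b + of_nat K - 1)) \<longlonglongrightarrow> 1" for z
    using tendsto_diff[OF tendsto_const tendsto_divide_0[OF tendsto_const inf], of 1 z] by simp
  have main: "eventually (\<lambda>K. (1 - z / (b + of_nat K - 1)) * RK K (z + 1) = ((b - 1 - z) * RK K z * exp (T z K)) * e K) sequentially" for z
    using ev
  proof eventually_elim
    case (elim K)
    have "(1 - z / (b + of_nat K - 1)) * RK K (z + 1) = (b + of_nat K - 1 - z) * RK K (z + 1) / (b + of_nat K - 1)"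
      using elim by (simp add: field_simps)
    also have "\<dots> = ((b - 1 - z) * RK K z * exp (T z K)) * e K"
      unfolding fin split exp_add e_def by (simp add: mult_ac)
    finally show ?case .
  qed
  have rm1: "row q b (- 1) \<noteq> 0"
  proof
    assume "row q b (- 1) = 0"
    then obtain k where "- 1 = b + of_nat k" using row_basic(3)[OF q c b, of "-1"] by blast
    then have "b + of_nat (Suc k) = 0" by (simp add: algebra_simps) (metis add.commute add.right_inverse add.assoc)
    then show False using nz by blast
  qed
  \<comment> \<open>At z = -1 the shifted row is evaluated at 0, where it is 1. Hence
    \<open>e\<close> converges to 1/V, with no knowledge of harmonic sums.\<close>
  define V where "V = (b - 1 - (-1)) * row q b (- 1) * exp (T' (- 1))"
  have b0: "b \<noteq> 0" using nz[of 0] by simp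
  have "V \<noteq> 0" using rm1 b0 by (simp add: V_def)
  have elim: "e \<longlonglongrightarrow> 1 / V"
  proof -
    have "(\<lambda>K. ((1 - (-1) / (b + of_nat K - 1)) * RK K (-1 + 1)) / ((b - 1 - (-1)) * RK K (-1) * exp (T (-1) K)))
        \<longlonglongrightarrow> (1 * row q b (-1 + 1)) / V"
      unfolding V_def
      by (intro tendsto_intros l1 RKlim Tlim) (use \<open>V \<noteq> 0\<close> in \<open>simp add: V_def\<close>)
    moreover have "row q b (-1 + 1) = 1" using row_basic(4)[OF q c b] by simp
    moreover have "eventually (\<lambda>K. RK K (-1) \<noteq> 0) sequentially"
      using tendsto_imp_eventually_ne[OF RKlim rm1] .
    then have "eventually (\<lambda>K. ((1 - (-1) / (b + of_nat K - 1)) * RK K (-1 + 1)) / ((b - 1 - (-1)) * RK K (-1) * exp (T (-1) K)) = e K) sequentially"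
      using main[of "-1"]
    proof eventually_elim
      case (elim K)
      show ?case unfolding elim(2) using elim(1) b0 by simp
    qed
    ultimately show ?thesis using Lim_transform_eventually by fastforce
  qed
  define P where "P = [:Ln (1 / V):] + (\<Sum>j=2..q. smult (\<zeta> j / of_nat j) ([:1, 1:] ^ j - [:0, 1:] ^ j))"
  have "poly_deg_lt q P"
    unfolding P_def by (intro poly_deg_lt_add poly_deg_lt_const q poly_deg_lt_sum poly_deg_lt_smult poly_deg_lt_shift_diff) auto
  moreover have "row q b (z + 1) = (b - 1 - z) * exp (poly P z) * row q b z" for z
  proof -
    have l: "(\<lambda>K. (1 - z / (b + of_nat K - 1)) * RK K (z + 1)) \<longlonglongrightarrow> 1 * row q b (z + 1)"
      by (intro tendsto_intros l1 RKlim)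
    have r: "(\<lambda>K. ((b - 1 - z) * RK K z * exp (T z K)) * e K) \<longlonglongrightarrow> ((b - 1 - z) * row q b z * exp (T' z)) * (1 / V)"
      by (intro tendsto_intros RKlim Tlim elim)
    have "1 * row q b (z + 1) = ((b - 1 - z) * row q b z * exp (T' z)) * (1 / V)"
      by (rule LIMSEQ_unique[OF Lim_transform_eventually[OF l main] r])
    moreover have "exp (poly P z) = exp (T' z) * (1 / V)"
    proof -
      have "poly P z = Ln (1 / V) + T' z"
        by (simp add: P_def poly_sum T'_def D_def poly_power mult_ac add_ac)
      moreover have "exp (Ln (1 / V)) = 1 / V" by (rule exp_Ln) (use \<open>V \<noteq> 0\<close> in simp)
      ultimately show ?thesis by (simp only: exp_add mult.commute)
    qed
    ultimately show ?thesis by (simp add: mult_ac)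
  qed
  ultimately show ?thesis by blast
qed

section \<open>Products of rows over dyadic shells\<close>

text \<open>\<open>A N\<close> holds centres of modulus about 2^N, at least \<open>\<rho>\<close>
  2^N, and \<open>b a\<close> is the first zero of the row attached to the centre a.
  \<open>cone\<close> says that the row moves away from the origin; \<open>count\<close> says that
  the centres have exponent of convergence at most \<open>\<sigma>\<close>. Three instances are
  used: for the numerator and for the two halves of the denominator.\<close>

locale shells =
  fixes q :: nat and \<sigma> \<rho> :: real and A :: "nat \<Rightarrow> complex set" and m :: "complex \<Rightarrow> nat"
    and b :: "complex \<Rightarrow> complex"
  assumes q: "1 \<le> q" "real q \<le> \<sigma> + 1" "\<sigma> < real q" and rho: "0 < \<rho>" "\<rho> \<le> 1"
    and fin: "\<And>N. finite (A N)" and lo: "\<And>N a. a \<in> A N \<Longrightarrow> \<rho> * 2 ^ N \<le> cmod a"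
    and cone: "\<And>N a k. a \<in> A N \<Longrightarrow> (cmod a + real k) / 2 \<le> cmod (b a + of_nat k)"
    and count: "\<And>s. s > \<sigma> \<Longrightarrow> \<exists>K\<ge>0. \<forall>N. real (\<Sum>a\<in>A N. m a) \<le> K * 2 powr (real N * s)"
begin

definition shellf :: "nat \<Rightarrow> complex \<Rightarrow> complex" where
  "shellf N z = (\<Prod>a\<in>A N. row q (b a) z ^ m a)"

definition G :: "complex \<Rightarrow> complex" where
  "G z = (\<Prod>N. shellf N z)"

definition GN :: "nat \<Rightarrow> complex \<Rightarrow> complex" where
  "GN N z = (\<Prod>n<N. shellf n z)"

lemma lo': "a \<in> A N \<Longrightarrow> \<rho> \<le> cmod a"
proof -
  assume "a \<in> A N"
  have "\<rho> * 1 \<le> \<rho> * 2 ^ N" using rho by (intro mult_left_mono) auto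
  then show ?thesis using lo[OF \<open>a \<in> A N\<close>] by simp
qed

lemma row_cond: "a \<in> A N \<Longrightarrow> cmod (b a + of_nat k) \<ge> \<rho> / 2 * (real k + 1)"
proof -
  assume a: "a \<in> A N"
  have "\<rho> * real k \<le> 1 * real k" using rho by (intro mult_right_mono) auto
  then have "\<rho> / 2 * (real k + 1) \<le> (cmod a + real k) / 2" using lo'[OF a] by (simp add: algebra_simps)
  with cone[OF a] show ?thesis by (rule order_trans[rotated])
qed

lemmas row_at_center = row_basic[OF q(1) half_gt_zero[OF rho(1)] row_cond]

lemma shellf_holo: "shellf N holomorphic_on UNIV"
proof -
  have "(\<lambda>z. \<Prod>a\<in>A N. row q (b a) z ^ m a) holomorphic_on UNIV"
    by (intro holomorphic_intros) (rule row_at_center(1))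
  then show ?thesis unfolding shellf_def[abs_def] .
qed

lemma shellf_0: "shellf N 0 = 1"
  using row_at_center(4) by (simp add: shellf_def)

lemma shellf_eq_0: "shellf N z = 0 \<longleftrightarrow> (\<exists>a\<in>A N. m a > 0 \<and> (\<exists>k. z = b a + of_nat k))"
  using fin row_at_center(3) by (auto simp: shellf_def)

lemma shellf_bound:
  fixes \<tau> :: real
  assumes tau: "\<sigma> + 1 < \<tau>" "\<tau> \<le> real q + 1"
  obtains D \<delta> where "D \<ge> 0" "\<delta> > 0" "\<And>N z. cmod (shellf N z) \<le> exp (D * (2 powr - \<delta>) ^ N * cmod z powr \<tau>)"
proof -
  \<comment> \<open>About 2^(N (\<open>\<sigma>\<close> + \<open>\<delta>\<close>)) rows, each
    bounded with the weight 2^(-N (\<open>\<tau>\<close> - 1 - \<open>\<delta>\<close>)) = 2^(-N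
    (\<open>\<sigma>\<close> + 2 \<open>\<delta>\<close>)), leave the geometric factor 2^(-N
    \<open>\<delta>\<close>).\<close>
  define \<delta> where "\<delta> = (\<tau> - 1 - \<sigma>) / 3"
  have d: "\<delta> > 0" "\<tau> - 1 - \<delta> = \<sigma> + 2 * \<delta>" using tau by (simp_all add: \<delta>_def field_simps)
  have s0: "\<sigma> \<ge> 0" using q by linarith
  define e where "e = \<tau> - 1 - \<delta>"
  have e0: "e \<ge> 0" using d s0 by (simp add: e_def)
  obtain K where K: "K \<ge> 0" "\<And>a b z. \<rho> \<le> cmod a \<Longrightarrow> (\<forall>k. cmod (b + of_nat k) \<ge> (cmod a + real k) / 2) \<Longrightarrow>
     cmod (row q b z) \<le> exp (K * cmod a powr - e * cmod z powr \<tau>)"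
    using row_bound[of q \<tau> \<delta> \<rho>] q tau d rho s0 unfolding e_def by (auto simp: algebra_simps)
  obtain K2 where K2: "K2 \<ge> 0" "\<And>N. real (\<Sum>a\<in>A N. m a) \<le> K2 * 2 powr (real N * (\<sigma> + \<delta>))"
    using count[of "\<sigma> + \<delta>"] d by auto
  define D where "D = K * \<rho> powr - e * K2"
  have "cmod (shellf N z) \<le> exp (D * (2 powr - \<delta>) ^ N * cmod z powr \<tau>)" for N z
  proof -
    have "cmod (shellf N z) = (\<Prod>a\<in>A N. cmod (row q (b a) z) ^ m a)"
      by (simp add: shellf_def norm_power flip: prod_norm)
    also have "\<dots> \<le> (\<Prod>a\<in>A N. exp (K * (\<rho> * 2 ^ N) powr - e * cmod z powr \<tau>) ^ m a)"
    proof (intro prod_mono conjI power_mono)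
      fix a assume a: "a \<in> A N"
      have "cmod (row q (b a) z) \<le> exp (K * cmod a powr - e * cmod z powr \<tau>)"
        using K(2)[OF lo'[OF a], of "b a"] cone[OF a] by blast
      also have "cmod a powr - e \<le> (\<rho> * 2 ^ N) powr - e"
        using lo[OF a] rho e0 by (intro powr_mono2') auto
      then have "exp (K * cmod a powr - e * cmod z powr \<tau>) \<le> exp (K * (\<rho> * 2 ^ N) powr - e * cmod z powr \<tau>)"
        using K(1) by (simp add: mult_left_mono mult_right_mono)
      finally show "cmod (row q (b a) z) \<le> exp (K * (\<rho> * 2 ^ N) powr - e * cmod z powr \<tau>)" .
    qed auto
    also have "\<dots> = exp (real (\<Sum>a\<in>A N. m a) * (K * (\<rho> * 2 ^ N) powr - e * cmod z powr \<tau>))"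
      by (simp add: exp_sum fin sum_distrib_right exp_of_nat_mult)
    also have "\<dots> \<le> exp ((K2 * 2 powr (real N * (\<sigma> + \<delta>))) * (K * (\<rho> * 2 ^ N) powr - e * cmod z powr \<tau>))"
      using K2(2)[of N] K(1) by (intro exp_le_cancel_iff[THEN iffD2] mult_right_mono) auto
    also have "(\<rho> * 2 ^ N) powr - e = \<rho> powr - e * 2 powr (real N * - e)"
    proof -
      have "(2::real) ^ N = 2 powr real N" by (simp add: powr_realpow)
      then show ?thesis by (simp only: powr_mult powr_powr)
    qed
    also have "(K2 * 2 powr (real N * (\<sigma> + \<delta>))) * (K * (\<rho> powr - e * 2 powr (real N * - e)) * cmod z powr \<tau>)
      = D * (2 powr (real N * (\<sigma> + \<delta>)) * 2 powr (real N * - e)) * cmod z powr \<tau>"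
      by (simp only: D_def mult_ac)
    also have "2 powr (real N * (\<sigma> + \<delta>)) * 2 powr (real N * - e) = 2 powr (real N * - \<delta>)"
    proof -
      have "real N * (\<sigma> + \<delta>) + real N * - e = real N * - \<delta>" using d(2) unfolding e_def by (simp add: algebra_simps)
      then show ?thesis by (simp only: powr_add[symmetric])
    qed
    also have "2 powr (real N * - \<delta>) = (2 powr - \<delta>) ^ N"
      by (simp add: powr_power mult.commute)
    finally show ?thesis .
  qed
  moreover have "D \<ge> 0" using K(1) K2(1) by (simp add: D_def)
  ultimately show ?thesis using that d(1) by blast
qed

lemma G_product:
  fixes \<tau> :: real
  assumes tau: "\<sigma> + 1 < \<tau>" "\<tau> \<le> real q + 1"
  shows "uniform_limit (cball 0 R) GN G sequentially" "G holomorphic_on UNIV"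
    "\<exists>K\<ge>0. \<forall>z. cmod (G z) \<le> exp (K * cmod z powr \<tau>)"
    "G z = 0 \<longleftrightarrow> (\<exists>N. shellf N z = 0)"
proof -
  obtain D \<delta> where D: "D \<ge> 0" "\<delta> > 0" "\<And>N z. cmod (shellf N z) \<le> exp (D * (2 powr - \<delta>) ^ N * cmod z powr \<tau>)"
    using shellf_bound[OF tau] by blast
  have "2 powr - \<delta> < 2 powr (0::real)" using D(2) by (intro powr_less_mono) auto
  then have sm: "summable (\<lambda>N. D * (2 powr - \<delta>) ^ N)" by (intro summable_mult summable_geometric) auto
  have t0: "\<tau> > 0" using tau q by linarith
  have c0: "\<And>N. 0 \<le> D * (2 powr - \<delta>) ^ N" using D by simp
  have GG: "G = (\<lambda>z. \<Prod>N. shellf N z)" "GN = (\<lambda>N z. \<Prod>n<N. shellf n z)" by (auto simp: G_def GN_def fun_eq_iff)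
  note cp = canonical_product[where f=shellf and c="\<lambda>N. D * (2 powr - \<delta>) ^ N" and \<tau>=\<tau>, OF shellf_holo shellf_0 c0 sm t0 D(3)]
  show "uniform_limit (cball 0 R) GN G sequentially" unfolding GG by (rule cp(1))
  show "G holomorphic_on UNIV" unfolding GG by (rule cp(2))
  show "G z = 0 \<longleftrightarrow> (\<exists>N. shellf N z = 0)" unfolding GG by (rule cp(4))
  show "\<exists>K\<ge>0. \<forall>z. cmod (G z) \<le> exp (K * cmod z powr \<tau>)"
    by (rule exI[of _ "suminf (\<lambda>N. D * (2 powr - \<delta>) ^ N)"]) (use cp(3) suminf_nonneg[OF sm c0] in \<open>auto simp: GG\<close>)
qed

lemma tau_ok: "\<sigma> + 1 < real q + 1" "real q + 1 \<le> real q + 1"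
  using q by auto

lemmas G_ulim = G_product(1)[OF tau_ok]
lemmas G_holo = G_product(2)[OF tau_ok]

lemma G_eq_0: "G z = 0 \<longleftrightarrow> (\<exists>N. \<exists>a\<in>A N. m a > 0 \<and> (\<exists>k. z = b a + of_nat k))"
  unfolding G_product(4)[OF tau_ok] shellf_eq_0 ..

lemma G_growth:
  assumes "\<tau> > \<sigma> + 1"
  shows "exp_growth \<tau> G"
proof -
  \<comment> \<open>The estimate of a factor of genus q stops at the exponent q + 1; larger
    exponents follow by monotonicity once |z| is replaced by 1 + |z|.\<close>
  define \<tau>' where "\<tau>' = min \<tau> (real q + 1)"
  have t: "\<sigma> + 1 < \<tau>'" "\<tau>' \<le> real q + 1" "\<tau>' \<le> \<tau>" "\<tau>' \<ge> 0" using assms q by (auto simp: \<tau>'_def)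
  obtain K where K: "K \<ge> 0" "\<And>z. cmod (G z) \<le> exp (K * cmod z powr \<tau>')" using G_product(3)[OF t(1,2)] by blast
  have "cmod (G z) \<le> exp (K * (1 + cmod z) powr \<tau>)" for z
  proof -
    have "cmod z powr \<tau>' \<le> (1 + cmod z) powr \<tau>'" using t by (intro powr_mono2) auto
    also have "\<dots> \<le> (1 + cmod z) powr \<tau>" using t by (intro powr_mono) auto
    finally have "K * cmod z powr \<tau>' \<le> K * (1 + cmod z) powr \<tau>" using K(1) by (rule mult_left_mono)
    then show ?thesis using K(2)[of z] by (meson exp_le_cancel_iff order_trans)
  qed
  with K(1) show ?thesis by blast
qed

text \<open>Stated for partial products only: the polynomial depends on N, and nothing but its
  degree is known or needed.\<close>

lemma GN_shift: "\<exists>P. poly_deg_lt q P \<and>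
   (\<forall>z. GN N (z + 1) = (\<Prod>n<N. \<Prod>a\<in>A n. (b a - 1 - z) ^ m a) * exp (poly P z) * GN N z)"
proof -
  have "\<forall>a\<in>(\<Union>n. A n). \<exists>P. poly_deg_lt q P \<and> (\<forall>z. row q (b a) (z + 1) = (b a - 1 - z) * exp (poly P z) * row q (b a) z)"
  proof
    fix a assume "a \<in> (\<Union>n. A n)"
    then obtain n where n: "a \<in> A n" by blast
    show "\<exists>P. poly_deg_lt q P \<and> (\<forall>z. row q (b a) (z + 1) = (b a - 1 - z) * exp (poly P z) * row q (b a) z)"
      by (rule row_shift[OF q(1) half_gt_zero[OF rho(1)] row_cond[OF n]])
  qed
  from bchoice[OF this] obtain Q where Q: "\<forall>a\<in>(\<Union>n. A n). poly_deg_lt q (Q a) \<and>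
      (\<forall>z. row q (b a) (z + 1) = (b a - 1 - z) * exp (poly (Q a) z) * row q (b a) z)" ..
  define P where "P = (\<Sum>n<N. \<Sum>a\<in>A n. smult (of_nat (m a)) (Q a))"
  have "poly_deg_lt q P" unfolding P_def
    by (intro poly_deg_lt_sum poly_deg_lt_smult) (use Q in blast)
  moreover have "GN N (z + 1) = (\<Prod>n<N. \<Prod>a\<in>A n. (b a - 1 - z) ^ m a) * exp (poly P z) * GN N z" for z
  proof -
    have "GN N (z + 1) = (\<Prod>n<N. \<Prod>a\<in>A n. (b a - 1 - z) ^ m a * exp (of_nat (m a) * poly (Q a) z) * row q (b a) z ^ m a)"
      unfolding GN_def shellf_def
    proof (intro prod.cong refl)
      fix n a assume "a \<in> A n"
      then have "row q (b a) (z + 1) = (b a - 1 - z) * exp (poly (Q a) z) * row q (b a) z" using Q by blast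
      then show "row q (b a) (z + 1) ^ m a = (b a - 1 - z) ^ m a * exp (of_nat (m a) * poly (Q a) z) * row q (b a) z ^ m a"
        by (simp only: power_mult_distrib exp_of_nat_mult)
    qed
    also have "\<dots> = (\<Prod>n<N. \<Prod>a\<in>A n. (b a - 1 - z) ^ m a) * (\<Prod>n<N. \<Prod>a\<in>A n. exp (of_nat (m a) * poly (Q a) z)) * GN N z"
      unfolding GN_def shellf_def by (simp only: prod.distrib)
    also have "(\<Prod>n<N. \<Prod>a\<in>A n. exp (of_nat (m a) * poly (Q a) z)) = exp (poly P z)"
      by (simp add: P_def poly_sum exp_sum fin)
    finally show ?thesis .
  qed
  ultimately show ?thesis by blast
qed

end

section \<open>Polynomials and logarithms through higher derivatives\<close>

lemma higher_deriv_poly: "(deriv ^^ n) (poly P) = poly ((pderiv ^^ n) P)"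
  for P :: "complex poly"
proof (induction n arbitrary: P)
  case (Suc n)
  have "deriv (poly P) = poly (pderiv P)" by (rule ext) (rule DERIV_imp_deriv[OF poly_DERIV])
  then show ?case using Suc[of "pderiv P"] by (simp only: funpow_Suc_right o_apply)
qed auto

lemma poly_deg_lt_higher_pderiv: "poly_deg_lt q P \<Longrightarrow> (pderiv ^^ q) P = 0"
proof (induction q arbitrary: P)
  case 0
  then show ?case by (simp add: poly_deg_lt_def poly_eq_iff)
next
  case (Suc q)
  have "poly_deg_lt q (pderiv P)" using Suc.prems by (auto simp: poly_deg_lt_def coeff_pderiv)
  then show ?case using Suc.IH by (simp only: funpow_Suc_right o_apply)
qed

lemma higher_deriv_eq_0_imp_poly:
  assumes hol: "h holomorphic_on ball w r" and r: "r > 0"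
    and d: "\<And>z. z \<in> ball w r \<Longrightarrow> (deriv ^^ q) h z = 0"
  shows "\<exists>P. poly_deg_lt q P \<and> (\<forall>z\<in>ball w r. h z = poly P z)"
proof -
  have dn: "(deriv ^^ n) h w = 0" if "n \<ge> q" for n
  proof -
    have zero: "\<forall>z\<in>ball w r. (deriv ^^ (q + k)) h z = 0" for k
    proof (induction k)
      case 0 then show ?case using d by simp
    next
      case (Suc k)
      show ?case
      proof
        fix z assume z: "z \<in> ball w r"
        have "eventually (\<lambda>x. x \<in> ball w r) (nhds z)" using z by (intro eventually_nhds_in_open) auto
        then have "eventually (\<lambda>x. (deriv ^^ (q + k)) h x = 0) (nhds z)" by eventually_elim (use Suc in blast)
        then have "deriv ((deriv ^^ (q + k)) h) z = deriv (\<lambda>_. 0) z" by (rule deriv_cong_ev) simp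
        then show "(deriv ^^ (q + Suc k)) h z = 0" by simp
      qed
    qed
    show ?thesis using zero[of "n - q"] that r by simp
  qed
  define c where "c = (\<lambda>n. (deriv ^^ n) h w / fact n)"
  define P where "P = (\<Sum>n<q. smult (c n) ([:- w, 1:] ^ n))"
  have "poly_deg_lt q P" unfolding P_def
  proof (intro poly_deg_lt_sum poly_deg_lt_smult)
    fix n assume "n \<in> {..<q}"
    then show "poly_deg_lt q ([:- w, 1:] ^ n)"
      unfolding poly_deg_lt_alt by (simp add: degree_linear_power)
  qed
  moreover have "h z = poly P z" if z: "z \<in> ball w r" for z
  proof -
    have "((\<lambda>n. (deriv ^^ n) h w / fact n * (z - w) ^ n) sums h z)"
      by (rule holomorphic_power_series[OF hol z])
    moreover have "((\<lambda>n. (deriv ^^ n) h w / fact n * (z - w) ^ n) sums (\<Sum>n<q. (deriv ^^ n) h w / fact n * (z - w) ^ n))"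
      by (rule sums_finite) (use dn in auto)
    ultimately have "h z = (\<Sum>n<q. (deriv ^^ n) h w / fact n * (z - w) ^ n)" by (rule sums_unique2)
    also have "\<dots> = poly P z" by (simp add: P_def poly_sum c_def poly_power)
    finally show ?thesis .
  qed
  ultimately show ?thesis by blast
qed

text \<open>From exp W -> 1 one cannot conclude W -> 0, since W may drift by multiples of 2 pi i.
  The principal logarithm of exp W does tend to 0 and has the same first derivative as W, so the
  claim holds from order 1 on, hence \<open>Suc p\<close>.\<close>

lemma higher_deriv_log_tendsto_0:
  assumes S: "open S" "z \<in> S" and hol: "\<And>N. N \<ge> N0 \<Longrightarrow> W N holomorphic_on S"
    and ul: "uniform_limit S (\<lambda>N z. exp (W N z)) (\<lambda>_. 1) sequentially"
  shows "(\<lambda>N. (deriv ^^ Suc p) (W N) z) \<longlonglongrightarrow> 0"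
proof -
  have ev: "eventually (\<lambda>N. N \<ge> N0 \<and> (\<forall>x\<in>S. cmod (exp (W N x) - 1) < 1 / 2)) sequentially"
    using uniform_limitD[OF ul half_gt_zero[OF zero_less_one]] eventually_ge_at_top[of N0]
    by eventually_elim (auto simp: dist_norm)
  define L where "L = (\<lambda>N x. Ln (exp (W N x)))"
  have nonneg: "exp (W N x) \<notin> \<real>\<^sub>\<le>\<^sub>0" if "cmod (exp (W N x) - 1) < 1 / 2" for N x
  proof
    assume "exp (W N x) \<in> \<real>\<^sub>\<le>\<^sub>0"
    then have "Re (exp (W N x)) \<le> 0" by (simp add: complex_nonpos_Reals_iff)
    then have "1 \<le> \<bar>Re (exp (W N x) - 1)\<bar>" by simp
    then show False using abs_Re_le_cmod[of "exp (W N x) - 1"] that by linarith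
  qed
  have ulL: "uniform_limit S L (\<lambda>_. 0) sequentially"
  proof (rule uniform_limitI)
    fix e :: real assume "e > 0"
    then have "min (e / 2) (1/2) > 0" by simp
    from uniform_limitD[OF ul this]
    show "\<forall>\<^sub>F n in sequentially. \<forall>x\<in>S. dist (L n x) 0 < e"
    proof eventually_elim
      case (elim n)
      show ?case
      proof
        fix x assume "x \<in> S"
        then have lt: "cmod (exp (W n x) - 1) < min (e / 2) (1 / 2)" using elim by (auto simp: dist_norm)
        then have "cmod (Ln (1 + (exp (W n x) - 1))) \<le> 2 * cmod (exp (W n x) - 1)" by (intro norm_Ln_le) auto
        then show "dist (L n x) 0 < e" using lt by (simp add: L_def)
      qed
    qed
  qed
  have holL: "eventually (\<lambda>N. L N holomorphic_on S) sequentially"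
    using ev
  proof eventually_elim
    case (elim N)
    then show ?case unfolding L_def by (intro holomorphic_intros hol) (use nonneg in auto)
  qed
  have lim: "(\<lambda>N. (deriv ^^ Suc p) (L N) z) \<longlonglongrightarrow> (deriv ^^ Suc p) (\<lambda>_. 0) z"
    by (rule higher_deriv_complex_uniform_limit[OF ulL holL]) (use S in auto)
  have "eventually (\<lambda>N. (deriv ^^ Suc p) (L N) z = (deriv ^^ Suc p) (W N) z) sequentially"
    using ev
  proof eventually_elim
    case (elim N)
    have "deriv (L N) x = deriv (W N) x" if "x \<in> S" for x
    proof -
      have "(W N has_field_derivative deriv (W N) x) (at x)"
        using hol elim that S holomorphic_derivI by blast
      then have 1: "((\<lambda>x. exp (W N x)) has_field_derivative exp (W N x) * deriv (W N) x) (at x)"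
        by (auto intro!: derivative_eq_intros)
      have "(Ln has_field_derivative inverse (exp (W N x))) (at (exp (W N x)))"
        using nonneg elim that by (intro has_field_derivative_Ln) blast
      from DERIV_chain2[OF this 1]
      have "(L N has_field_derivative inverse (exp (W N x)) * (exp (W N x) * deriv (W N) x)) (at x)"
        unfolding L_def .
      moreover have "inverse (exp (W N x)) * (exp (W N x) * deriv (W N) x) = deriv (W N) x" by simp
      ultimately have "(L N has_field_derivative deriv (W N) x) (at x)" by (simp only:)
      then show ?thesis by (rule DERIV_imp_deriv)
    qed
    then have "eventually (\<lambda>x. deriv (L N) x = deriv (W N) x) (nhds z)"
      using eventually_nhds_in_open[OF S] by (auto elim: eventually_mono)
    then have "(deriv ^^ p) (deriv (L N)) z = (deriv ^^ p) (deriv (W N)) z"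
      by (rule higher_deriv_cong_ev) simp
    then show ?case by (simp only: funpow_Suc_right o_apply)
  qed
  then show ?thesis using lim Lim_transform_eventually by fastforce
qed

section \<open>Limits of exponentials\<close>

lemma uniform_limit_mult_compact:
  fixes f g :: "'a :: topological_space \<Rightarrow> complex"
  assumes "compact S" "continuous_on S f" "continuous_on S g"
    and "uniform_limit S F f sequentially" "uniform_limit S G g sequentially"
  shows "uniform_limit S (\<lambda>N z. F N z * G N z) (\<lambda>z. f z * g z) sequentially"
  by (intro uniform_lim_mult assms compact_imp_bounded compact_continuous_image)

lemma uniform_limit_const_fun: "uniform_limit S (\<lambda>N. f) f F"
  by (intro uniform_limitI always_eventually) auto

text \<open>Let h be a logarithm of num/den on the disc. Then exp (V N - h) -> 1 uniformly, so the
  q-th derivatives of V N tend to that of h; by \<open>d0\<close> they tend to 0. Hence h is a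
  polynomial of degree below q, and the identity extends to the plane by analytic
  continuation.\<close>

lemma quotient_limit_exp_poly:
  fixes num den :: "complex \<Rightarrow> complex"
  assumes r: "r > 0" and q: "q \<ge> 1" and hol: "num holomorphic_on UNIV" "den holomorphic_on UNIV"
    and ul: "uniform_limit (cball w r) numN num sequentially" "uniform_limit (cball w r) denN den sequentially"
    and nz: "\<And>z. z \<in> cball w r \<Longrightarrow> num z \<noteq> 0" "\<And>z. z \<in> cball w r \<Longrightarrow> den z \<noteq> 0"
    and V: "\<And>N. N \<ge> N0 \<Longrightarrow> V N holomorphic_on ball w r"
    and eq: "\<And>N z. N \<ge> N0 \<Longrightarrow> z \<in> ball w r \<Longrightarrow> exp (V N z) * denN N z = numN N z"
    and d0: "\<And>z. z \<in> ball w r \<Longrightarrow> (\<lambda>N. (deriv ^^ q) (V N) z) \<longlonglongrightarrow> 0"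
  shows "\<exists>P. poly_deg_lt q P \<and> (\<forall>z. num z = exp (poly P z) * den z)"
proof -
  have cont: "continuous_on (cball w r) num" "continuous_on (cball w r) den"
    using hol holomorphic_on_imp_continuous_on continuous_on_subset by blast+
  have holb: "num holomorphic_on ball w r" "den holomorphic_on ball w r"
    using hol holomorphic_on_subset by blast+
  have "(\<lambda>z. num z / den z) holomorphic_on ball w r"
    by (intro holomorphic_intros holb) (use nz in auto)
  then obtain h where h: "h holomorphic_on ball w r" "\<And>z. z \<in> ball w r \<Longrightarrow> exp (h z) = num z / den z"
    by (rule holomorphic_logarithm_exists[OF convex_ball open_ball, of _ w r w]) (use nz r in auto)
  define W where "W = (\<lambda>N z. V N z - h z)"
  have Whol: "W N holomorphic_on ball w r" if "N \<ge> N0" for N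
    unfolding W_def by (intro holomorphic_intros V h that)
  have p: "continuous_on (cball w r) (\<lambda>z. den z * num z)" by (intro continuous_intros cont)
  have "\<exists>x\<in>cball w r. \<forall>y\<in>cball w r. cmod (den x * num x) \<le> cmod (den y * num y)"
    by (rule continuous_attains_inf) (use r in \<open>auto intro!: continuous_intros cont\<close>)
  then obtain x where x: "x \<in> cball w r" "\<And>y. y \<in> cball w r \<Longrightarrow> cmod (den x * num x) \<le> cmod (den y * num y)" by blast
  \<comment> \<open>A positive lower bound for |den num| on the compact disc: it allows the uniform
    division below and keeps \<open>denN\<close> free of zeros for large N.\<close>
  define \<beta> where "\<beta> = cmod (den x * num x)"
  have "\<beta> > 0" using nz x(1) by (simp add: \<beta>_def)
  have u1: "uniform_limit (cball w r) (\<lambda>N z. numN N z * den z) (\<lambda>z. num z * den z) sequentially"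
    by (intro uniform_limit_mult_compact compact_cball cont ul uniform_limit_const_fun)
  have u2: "uniform_limit (cball w r) (\<lambda>N z. denN N z * num z) (\<lambda>z. den z * num z) sequentially"
    by (intro uniform_limit_mult_compact compact_cball cont ul uniform_limit_const_fun)
  have u3: "uniform_limit (cball w r) (\<lambda>N z. (numN N z * den z) / (denN N z * num z)) (\<lambda>z. (num z * den z) / (den z * num z)) sequentially"
  proof (rule uniform_lim_divide[OF u1 u2 _ _ \<open>\<beta> > 0\<close>])
    show "bounded ((\<lambda>z. num z * den z) ` cball w r)"
      by (intro compact_imp_bounded compact_continuous_image continuous_intros cont compact_cball)
  qed (use x(2) in \<open>auto simp: \<beta>_def\<close>)
  have evnz: "eventually (\<lambda>N. N \<ge> N0 \<and> (\<forall>z\<in>cball w r. denN N z \<noteq> 0)) sequentially"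
    using uniform_limitD[OF u2 \<open>\<beta> > 0\<close>] eventually_ge_at_top[of N0]
  proof eventually_elim
    case (elim N)
    have "denN N z \<noteq> 0" if z: "z \<in> cball w r" for z
    proof
      assume "denN N z = 0"
      moreover have "dist (denN N z * num z) (den z * num z) < \<beta>" using elim(1) z by blast
      ultimately have "cmod (den z * num z) < \<beta>" by (simp only: mult_zero_left dist_0_norm)
      then show False using x(2)[OF z] by (simp add: \<beta>_def)
    qed
    with elim show ?case by blast
  qed
  have u4: "uniform_limit (ball w r) (\<lambda>N z. exp (W N z)) (\<lambda>_. 1) sequentially"
  proof (rule uniform_limitI)
    fix e :: real assume "e > 0"
    show "\<forall>\<^sub>F N in sequentially. \<forall>z\<in>ball w r. dist (exp (W N z)) 1 < e"
      using evnz uniform_limitD[OF u3 \<open>e > 0\<close>]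
    proof eventually_elim
      case (elim N)
      show ?case
      proof
        fix z assume z: "z \<in> ball w r"
        then have z': "z \<in> cball w r" by simp
        have "exp (V N z) = numN N z / denN N z"
          using eq[of N z] elim(1) z z' by (simp add: eq_divide_eq)
        then have "exp (W N z) = (numN N z * den z) / (denN N z * num z)"
          by (simp add: W_def exp_diff h(2)[OF z])
        moreover have "(num z * den z) / (den z * num z) = 1" using nz[OF z'] by simp
        ultimately show "dist (exp (W N z)) 1 < e" using elim(2) z' by metis
      qed
    qed
  qed
  obtain p where qp: "q = Suc p" using q by (cases q) auto
  have "(deriv ^^ q) h z = 0" if z: "z \<in> ball w r" for z
  proof -
    have "(\<lambda>N. (deriv ^^ q) (W N) z) \<longlonglongrightarrow> 0"
      unfolding qp by (rule higher_deriv_log_tendsto_0[OF open_ball z Whol u4])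
    moreover have "eventually (\<lambda>N. (deriv ^^ q) (W N) z = (deriv ^^ q) (V N) z - (deriv ^^ q) h z) sequentially"
      using eventually_ge_at_top[of N0]
    proof eventually_elim
      case (elim N)
      show ?case unfolding W_def by (rule higher_deriv_diff[OF V[OF elim] h(1) open_ball z])
    qed
    ultimately have "(\<lambda>N. (deriv ^^ q) (V N) z - (deriv ^^ q) h z) \<longlonglongrightarrow> 0"
      by (rule Lim_transform_eventually)
    moreover have "(\<lambda>N. (deriv ^^ q) (V N) z - (deriv ^^ q) h z) \<longlonglongrightarrow> 0 - (deriv ^^ q) h z"
      by (intro tendsto_intros d0 z)
    ultimately show ?thesis using LIMSEQ_unique by fastforce
  qed
  from higher_deriv_eq_0_imp_poly[OF h(1) r this]
  obtain P where P: "poly_deg_lt q P" "\<And>z. z \<in> ball w r \<Longrightarrow> h z = poly P z" by blast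
  have "num z = exp (poly P z) * den z" for z
  proof (rule analytic_continuation_open[of "ball w r" UNIV num "\<lambda>z. exp (poly P z) * den z"])
    show "(\<lambda>z. exp (poly P z) * den z) holomorphic_on UNIV" by (intro holomorphic_intros hol)
    show "num z = exp (poly P z) * den z" if "z \<in> ball w r" for z
      using h(2)[OF that] P(2)[OF that] nz(2)[of z] that by (simp add: field_simps)
  qed (use r hol in auto)
  with P(1) show ?thesis by blast
qed

section \<open>The zero-free factor on a disc\<close>

abbreviation zero_free_log ::
  "(complex \<Rightarrow> complex) \<Rightarrow> nat \<Rightarrow> real \<Rightarrow> real \<Rightarrow> real \<Rightarrow> (complex \<Rightarrow> complex) \<Rightarrow> bool" where
  "zero_free_log f q s K R L \<equiv> L holomorphic_on ball 0 R \<and>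
     (\<forall>z\<in>ball 0 R. f z = exp (L z) * zero_prod f R z) \<and>
     (\<forall>z. cmod z \<le> R / 4 \<longrightarrow> cmod ((deriv ^^ q) L z) \<le> K * R powr (s - real q))"

text \<open>The maximum principle on |z| = 2R bounds the zero-free factor by exp of a constant times
  R^s; Borel-Caratheodory then bounds its logarithm for |z| <= R/2, and Cauchy's estimate on discs
  of radius R/4 gains R^(-q) for |z| <= R/4.\<close>

lemma log_of_zero_free_part:
  fixes s :: real
  assumes hol: "f holomorphic_on UNIV" and f0: "f 0 \<noteq> 0" and C: "C \<ge> 0" and s: "s \<ge> 0" and q: "q \<ge> 1"
    and bd: "\<And>z. cmod (f z) \<le> exp (C * (1 + cmod z) powr s)"
  shows "\<exists>K\<ge>0. \<forall>R\<ge>1. \<exists>L. zero_free_log f q s K R L"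
proof -
  define K1 where "K1 = C * 3 powr s + \<bar>ln (cmod (f 0))\<bar> + 1"
  have "K1 > 0" using C by (simp add: K1_def add_nonneg_pos)
  have nz: "\<exists>z. f z \<noteq> 0" using f0 by blast
  show ?thesis
  proof (intro exI[of _ "fact q * (3 * K1) * 4 ^ q"] conjI allI impI)
    show "0 \<le> fact q * (3 * K1) * 4 ^ q" using \<open>K1 > 0\<close> by simp
    fix R :: real assume R: "R \<ge> 1"
    define Z where "Z = {a. f a = 0 \<and> cmod a < R}"
    have "finite Z" by (rule finite_subset[OF _ finite_zeros_cball[OF hol nz, of R]]) (auto simp: Z_def)
    obtain k where k: "k holomorphic_on UNIV" "\<And>z. f z = k z * (\<Prod>a\<in>Z. (z - a) ^ zmult f a)" "\<And>a. a \<in> Z \<Longrightarrow> k a \<noteq> 0"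
      using entire_factor_zeros[OF \<open>finite Z\<close> hol nz] by blast
    have knz: "k z \<noteq> 0" if "z \<in> ball 0 R" for z
    proof
      assume "k z = 0"
      then have "f z = 0" using k(2)[of z] by simp
      then have "z \<in> Z" using that by (simp add: Z_def)
      then show False using k(3) \<open>k z = 0\<close> by blast
    qed
    have k0: "k 0 \<noteq> 0" using knz R by simp
    define h where "h = (\<lambda>z. k z / k 0)"
    have hh: "h holomorphic_on UNIV" unfolding h_def by (intro holomorphic_intros k k0)
    obtain L0 where L0: "L0 holomorphic_on ball 0 R" "\<And>z. z \<in> ball 0 R \<Longrightarrow> exp (L0 z) = h z"
      by (rule holomorphic_logarithm_exists[of "ball 0 R" h 0])
         (use R knz k0 holomorphic_on_subset[OF hh] in \<open>auto simp: h_def\<close>)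
    have e0: "exp (L0 0) = 1" using L0(2)[of 0] R k0 by (simp add: h_def)
    \<comment> \<open>\<open>L0 0\<close> is a logarithm of 1, perhaps a nonzero multiple of 2 pi i.
      Subtracting it gives a logarithm of \<open>h\<close> that vanishes at 0, as Borel-Caratheodory
      requires.\<close>
    define L where "L = (\<lambda>z. L0 z - L0 0 + Ln (k 0))"
    have Lh: "L holomorphic_on ball 0 R" unfolding L_def by (intro holomorphic_intros L0)
    have Lk: "exp (L z) = k z" if "z \<in> ball 0 R" for z
      using L0(2)[OF that] e0 k0 by (simp add: L_def exp_add exp_diff h_def)
    define M where "M = K1 * R powr s"
    have "R powr s \<ge> 1" using R s by (simp add: ge_one_powr_ge_zero)
    have "M > 0" unfolding M_def using \<open>K1 > 0\<close> \<open>R powr s \<ge> 1\<close> by (intro mult_pos_pos) linarith+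
    \<comment> \<open>For |z| = 2R and |a| < R one has |z - a| >= |a|, so dividing out the zeros
      costs no more on this circle than at 0, and \<open>h\<close> is bounded by |f z| / |f
      0|.\<close>
    have front: "cmod (h z) \<le> exp M" if z: "cmod z = 2 * R" for z
    proof -
      define p1 p0 where "p1 = (\<Prod>a\<in>Z. cmod (z - a) ^ zmult f a)" and "p0 = (\<Prod>a\<in>Z. cmod a ^ zmult f a)"
      have f1: "cmod (f z) = cmod (k z) * p1" by (simp only: k(2)[of z] p1_def norm_mult prod_norm[symmetric] norm_power)
      have f2: "cmod (f 0) = cmod (k 0) * p0" by (simp add: k(2)[of 0] p0_def norm_mult prod_norm[symmetric] norm_power)
      have "p0 \<le> p1" unfolding p0_def p1_def
      proof (intro prod_mono conjI power_mono)
        fix a assume "a \<in> Z"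
        then show "cmod a \<le> cmod (z - a)" using norm_triangle_ineq2[of z a] z by (simp add: Z_def)
      qed auto
      moreover have "p0 > 0" unfolding p0_def using f0 by (intro prod_pos ballI zero_less_power) (auto simp: Z_def)
      ultimately have "p1 > 0" by linarith
      have "cmod (h z) * cmod (f 0) = cmod (k z) * p0" using k0 f2 by (simp add: h_def norm_divide)
      also have "\<dots> \<le> cmod (k z) * p1" using \<open>p0 \<le> p1\<close> by (intro mult_left_mono) auto
      also have "\<dots> \<le> exp (C * (1 + 2 * R) powr s)" using bd[of z] z f1 by simp
      finally have "cmod (h z) \<le> exp (C * (1 + 2 * R) powr s) / cmod (f 0)" using f0 by (simp add: field_simps)
      also have "\<dots> = exp (C * (1 + 2 * R) powr s - ln (cmod (f 0)))" using f0 by (simp add: exp_diff)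
      also have "\<dots> \<le> exp M"
      proof -
        have "(1 + 2 * R) powr s \<le> (3 * R) powr s" using R s by (intro powr_mono2) auto
        then have "C * (1 + 2 * R) powr s \<le> C * (3 powr s * R powr s)" unfolding powr_mult using C by (rule mult_left_mono)
        moreover have "- ln (cmod (f 0)) \<le> \<bar>ln (cmod (f 0))\<bar> * R powr s"
        proof -
          have "\<bar>ln (cmod (f 0))\<bar> * 1 \<le> \<bar>ln (cmod (f 0))\<bar> * R powr s"
            using \<open>R powr s \<ge> 1\<close> by (intro mult_left_mono) auto
          then show ?thesis by linarith
        qed
        moreover have "M = C * (3 powr s * R powr s) + \<bar>ln (cmod (f 0))\<bar> * R powr s + R powr s"
          by (simp add: M_def K1_def algebra_simps)
        ultimately show ?thesis using \<open>R powr s \<ge> 1\<close> by simp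
      qed
      finally show ?thesis .
    qed
    have hle: "cmod (h z) \<le> exp M" if z: "cmod z < R" for z
    proof (rule maximum_modulus_frontier[where S="ball 0 (2 * R)" and f=h])
      show "h holomorphic_on interior (ball 0 (2 * R))" using hh holomorphic_on_subset by blast
      show "continuous_on (closure (ball 0 (2 * R))) h" using hh holomorphic_on_imp_continuous_on continuous_on_subset by blast
      show "cmod (h w) \<le> exp M" if "w \<in> frontier (ball 0 (2 * R))" for w
        using that front R by (auto simp: frontier_ball)
    qed (use z R in auto)
    have Lle: "cmod (L z - Ln (k 0)) \<le> 2 * M" if z: "cmod z \<le> R / 2" for z
    proof -
      have "cmod (L0 z - L0 0) \<le> 2 * M"
      proof (rule Borel_Caratheodory_half[where f="\<lambda>z. L0 z - L0 0" and R=R])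
        show "(\<lambda>z. L0 z - L0 0) holomorphic_on ball 0 R" by (intro holomorphic_intros L0)
        show "Re (L0 w - L0 0) \<le> M" if w: "w \<in> ball 0 R" for w
        proof -
          have "exp (Re (L0 w - L0 0)) = cmod (exp (L0 w - L0 0))" by (simp only: norm_exp_eq_Re)
          also have "\<dots> = cmod (h w)" using L0(2)[OF w] e0 by (simp add: exp_diff)
          also have "\<dots> \<le> exp M" using hle w by simp
          finally show ?thesis by simp
        qed
      qed (use \<open>M > 0\<close> z R in auto)
      then show ?thesis by (simp add: L_def)
    qed
    have dL: "cmod ((deriv ^^ q) L z) \<le> fact q * (3 * K1) * 4 ^ q * R powr (s - real q)" if z: "cmod z \<le> R / 4" for z
    proof -
      have sub: "cmod w \<le> R / 2" if "w \<in> cball z (R / 4)" for w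
      proof -
        have "cmod (w - z) \<le> R / 4" using that by (simp add: dist_norm norm_minus_commute)
        then show ?thesis using norm_triangle_sub[of w z] z by linarith
      qed
      have sub': "cball z (R / 4) \<subseteq> ball 0 R" using sub R by fastforce
      have "cmod ((deriv ^^ q) L z) \<le> fact q * (3 * M) / (R / 4) ^ q"
      proof (rule Cauchy_higher_deriv_bound[where y="Ln (k 0)"])
        show "L holomorphic_on ball z (R / 4)" using Lh sub' holomorphic_on_subset ball_subset_cball by blast
        show "continuous_on (cball z (R / 4)) L" using Lh sub' holomorphic_on_imp_continuous_on continuous_on_subset by blast
        show "L w \<in> ball (Ln (k 0)) (3 * M)" if "w \<in> ball z (R / 4)" for w
        proof -
          have "cmod w \<le> R / 2" using sub that by auto
          from Lle[OF this] show ?thesis using \<open>M > 0\<close> by (simp add: dist_norm norm_minus_commute)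
        qed
      qed (use R q in auto)
      also have "\<dots> = fact q * (3 * K1) * 4 ^ q * (R powr s / R ^ q)"
        by (simp add: M_def power_divide)
      also have "R powr s / R ^ q = R powr (s - real q)" using R by (simp add: powr_diff powr_realpow)
      finally show ?thesis .
    qed
    show "\<exists>L. zero_free_log f q s (fact q * (3 * K1) * 4 ^ q) R L"
    proof (intro exI[of _ L] conjI ballI allI impI Lh dL)
      fix z assume z: "z \<in> ball (0::complex) R"
      show "f z = exp (L z) * zero_prod f R z"
        using k(2)[of z] unfolding Lk[OF z] Z_def .
    qed
  qed
qed

text \<open>The difference of z^(q+1) has degree q and leading coefficient q + 1, nonzero;
  subtracting a multiple of it removes the top coefficient of H.\<close>

lemma poly_difference_equation:
  "poly_deg_lt q H \<Longrightarrow> \<exists>S. poly_deg_lt (Suc q) S \<and> (\<forall>z. poly S (z + 1) - poly S z = poly H z)"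
proof (induction q arbitrary: H)
  case 0
  then have "H = 0" by (simp add: poly_deg_lt_def poly_eq_iff)
  then show ?case by (intro exI[of _ 0]) simp
next
  case (Suc q)
  define D where "D = ([:1, 1:] ^ Suc q - [:0, 1:] ^ Suc q :: complex poly)"
  define c where "c = coeff H q / of_nat (Suc q)"
  have D1: "poly_deg_lt (Suc q) D" unfolding D_def by (rule poly_deg_lt_shift_diff) auto
  have "coeff D q = of_nat (Suc q)"
  proof -
    have "coeff ([:1, 1::complex:] ^ Suc q) q = of_nat (Suc q choose q)"
      using coeff_linear_poly_power[of q "Suc q" "1::complex" 1] by simp
    moreover have "coeff ([:0, 1::complex:] ^ Suc q) q = 0"
      by (simp only: monom_altdef[of 1, simplified, symmetric] coeff_monom) simp
    ultimately show ?thesis by (simp add: D_def)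
  qed
  moreover have "of_nat (Suc q) \<noteq> (0::complex)" by (rule of_nat_neq_0)
  ultimately have "coeff (H - smult c D) q = 0"
    unfolding c_def coeff_diff coeff_smult by (simp only:) (simp only: nonzero_eq_divide_eq[symmetric] times_divide_eq_left nonzero_mult_div_cancel_right diff_self not_False_eq_True)
  moreover have "poly_deg_lt (Suc q) (H - smult c D)"
    by (intro poly_deg_lt_diff poly_deg_lt_smult Suc.prems D1)
  ultimately have "poly_deg_lt q (H - smult c D)"
    unfolding poly_deg_lt_def by (metis Suc_leI le_neq_implies_less)
  from Suc.IH[OF this] obtain S where S: "poly_deg_lt (Suc q) S" "\<And>z. poly S (z + 1) - poly S z = poly (H - smult c D) z" by blast
  define T where "T = S + smult c ([:0, 1:] ^ Suc q)"
  have "poly_deg_lt (Suc (Suc q)) T" unfolding T_def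
  proof (intro poly_deg_lt_add poly_deg_lt_smult)
    show "poly_deg_lt (Suc (Suc q)) S" using S(1) by (simp add: poly_deg_lt_def)
    show "poly_deg_lt (Suc (Suc q)) ([:0, 1:] ^ Suc q)"
      unfolding poly_deg_lt_alt by (simp only: degree_linear_power) simp
  qed
  moreover have "poly T (z + 1) - poly T z = poly H z" for z
  proof -
    have "poly T (z + 1) - poly T z = (poly S (z + 1) - poly S z) + c * ((z + 1) ^ Suc q - z ^ Suc q)"
      by (simp add: T_def poly_power algebra_simps del: power_Suc)
    also have "\<dots> = poly H z"
      unfolding S(2) by (simp add: D_def poly_power algebra_simps del: power_Suc)
    finally show ?thesis .
  qed
  ultimately show ?case by blast
qed

lemma exp_poly_growth:
  assumes P: "poly_deg_lt (Suc q) P" and tau: "real q \<le> \<tau>"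
  shows "exp_growth \<tau> (\<lambda>z. exp (poly P z))"
proof (intro exI[of _ "\<Sum>i\<le>degree P. cmod (coeff P i)"] conjI allI)
  show "0 \<le> (\<Sum>i\<le>degree P. cmod (coeff P i))" by (intro sum_nonneg) auto
  fix z
  have "cmod (poly P z) \<le> (\<Sum>i\<le>degree P. cmod (coeff P i) * cmod z ^ i)"
    unfolding poly_altdef by (rule order_trans[OF norm_sum]) (simp add: norm_mult norm_power)
  also have "\<dots> \<le> (\<Sum>i\<le>degree P. cmod (coeff P i) * (1 + cmod z) powr \<tau>)"
  proof (rule sum_mono)
    fix i assume "i \<in> {..degree P}"
    show "cmod (coeff P i) * cmod z ^ i \<le> cmod (coeff P i) * (1 + cmod z) powr \<tau>"
    proof (cases "i \<le> q")
      case True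
      have "cmod z ^ i \<le> (1 + cmod z) ^ i" by (intro power_mono) auto
      also have "\<dots> = (1 + cmod z) powr real i" by (simp add: powr_realpow add_pos_nonneg)
      also have "\<dots> \<le> (1 + cmod z) powr \<tau>" using True tau by (intro powr_mono) auto
      finally show ?thesis by (intro mult_left_mono) auto
    next
      case False
      then have "coeff P i = 0" using P by (simp add: poly_deg_lt_def)
      then show ?thesis by simp
    qed
  qed
  also have "\<dots> = (\<Sum>i\<le>degree P. cmod (coeff P i)) * (1 + cmod z) powr \<tau>" by (simp add: sum_distrib_right)
  finally show "cmod (exp (poly P z)) \<le> exp ((\<Sum>i\<le>degree P. cmod (coeff P i)) * (1 + cmod z) powr \<tau>)"
    using norm_exp[of "poly P z"] by (meson exp_le_cancel_iff order_trans)
qed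

section \<open>Solving the shift equation\<close>

lemma uniform_limit_compose_arg:
  assumes "uniform_limit T F g sequentially" "\<And>z. z \<in> S \<Longrightarrow> \<phi> z \<in> T"
  shows "uniform_limit S (\<lambda>N z. F N (\<phi> z)) (\<lambda>z. g (\<phi> z)) sequentially"
proof (rule uniform_limitI)
  fix e :: real assume "e > 0"
  show "\<forall>\<^sub>F n in sequentially. \<forall>x\<in>S. dist (F n (\<phi> x)) (g (\<phi> x)) < e"
    using uniform_limitD[OF assms(1) \<open>e > 0\<close>] by eventually_elim (use assms(2) in blast)
qed

lemma holomorphic_compose_UNIV:
  assumes "h holomorphic_on UNIV" "\<phi> holomorphic_on UNIV"
  shows "(\<lambda>z. h (\<phi> z)) holomorphic_on UNIV"
  using holomorphic_on_compose_gen[OF assms(2,1)] by (simp add: o_def)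

text \<open>Moving right from the closed right half-plane, the modulus stays above both |a| and t,
  hence above their mean. This supplies \<open>cone\<close> in all three instances of
  \<open>shells\<close>.\<close>

lemma half_plane_cone:
  assumes "Re a \<ge> 0" "t \<ge> 0"
  shows "(cmod a + t) / 2 \<le> cmod (a + of_real t)"
proof -
  have "(cmod a)\<^sup>2 \<le> (cmod (a + of_real t))\<^sup>2"
    unfolding cmod_power2 using assms by (simp add: power_mono)
  then have "cmod a \<le> cmod (a + of_real t)" using power2_le_imp_le norm_ge_zero by blast
  moreover have "t \<le> cmod (a + of_real t)"
    using complex_Re_le_cmod[of "a + of_real t"] assms by simp
  ultimately show ?thesis by simp
qed

text \<open>The zeros in the closed unit disc form a finite set, the disc is uncountable.\<close>

lemma common_nonzero:
  assumes "finite H" "\<And>h. h \<in> H \<Longrightarrow> h holomorphic_on UNIV \<and> (\<exists>z. h z \<noteq> (0::complex))"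
  shows "\<exists>z. \<forall>h\<in>H. h z \<noteq> 0"
proof -
  have fin: "finite (\<Union>h\<in>H. {z \<in> cball 0 1. h z = 0})"
  proof (rule finite_UN_I[OF assms(1)])
    fix h assume "h \<in> H"
    from assms(2)[OF this] show "finite {z \<in> cball 0 1. h z = 0}"
      by (intro finite_zeros_cball) auto
  qed
  have "uncountable (cball (0::complex) 1)" by (rule uncountable_cball) simp
  then have "\<not> cball 0 1 \<subseteq> (\<Union>h\<in>H. {z \<in> cball 0 1. h z = 0})"
    using countable_finite[OF finite_subset[OF _ fin]] by (rule contrapos_nn)
  then obtain z where z: "z \<in> cball 0 1" "z \<notin> (\<Union>h\<in>H. {z \<in> cball 0 1. h z = 0})"
    unfolding subset_iff not_all not_imp by (elim exE conjE)
  have "h z \<noteq> 0" if "h \<in> H" for h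
  proof
    assume "h z = 0"
    then have "z \<in> {z \<in> cball 0 1. h z = 0}" using z(1) by simp
    with that have "z \<in> (\<Union>h\<in>H. {z \<in> cball 0 1. h z = 0})" by (rule UN_I[where B="\<lambda>h. {z \<in> cball 0 1. h z = 0}"])
    with z(2) show False by (rule notE)
  qed
  then show ?thesis by (intro exI[of _ z] ballI)
qed

lemma poly_deg_lt_pcompose_linear:
  assumes "poly_deg_lt q P" "degree Q \<le> 1"
  shows "poly_deg_lt q (pcompose P Q)"
proof (cases "P = 0")
  case False
  then have "degree P < q" using assms(1) by (simp add: poly_deg_lt_alt)
  moreover have "degree (pcompose P Q) \<le> degree P * 1"
    unfolding degree_pcompose using assms(2) by (intro mult_left_mono) auto
  ultimately show ?thesis by (simp add: poly_deg_lt_alt)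
qed simp

lemma growth_mult:
  assumes "exp_growth \<tau> f"
    and "exp_growth \<tau> g"
  shows "exp_growth \<tau> (\<lambda>z. f z * g z)"
proof -
  obtain K1 K2 where K: "K1 \<ge> 0" "K2 \<ge> 0" "\<And>z. cmod (f z) \<le> exp (K1 * (1 + cmod z) powr \<tau>)"
    "\<And>z. cmod (g z) \<le> exp (K2 * (1 + cmod z) powr \<tau>)" using assms by blast
  have "cmod (f z * g z) \<le> exp ((K1 + K2) * (1 + cmod z) powr \<tau>)" for z
    unfolding norm_mult distrib_right exp_add by (intro mult_mono K) auto
  then show ?thesis using K(1,2) by (intro exI[of _ "K1 + K2"]) auto
qed

lemma two_power_eq_powr: "(2::real) ^ N = 2 powr real N"
  by (simp add: powr_realpow)

lemma shell_index:
  fixes x \<rho> :: real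
  assumes "0 < \<rho>" "\<rho> \<le> x" "x < \<rho> * 2 ^ N"
  shows "\<exists>n<N. \<rho> * 2 ^ n \<le> x \<and> x < \<rho> * 2 ^ Suc n"
  using assms(3)
proof (induction N)
  case 0
  then show ?case using assms by simp
next
  case (Suc N)
  show ?case
  proof (cases "x < \<rho> * 2 ^ N")
    case True
    then show ?thesis using Suc.IH less_SucI by blast
  next
    case False
    then show ?thesis using Suc.prems by (intro exI[of _ N]) auto
  qed
qed

text \<open>The equation is cleared of denominators. Nonvanishing of \<open>B\<close> on the
  half-line t >= 0 prepares the later change of variable, which sends 0 to some point of it. The
  last clause supplies the poles of A/B that force the order up to
  \<open>\<sigma> + 1\<close>.\<close>

abbreviation unit_shift_solution ::
  "(complex \<Rightarrow> complex) \<Rightarrow> real \<Rightarrow> (complex \<Rightarrow> complex) \<Rightarrow> (complex \<Rightarrow> complex) \<Rightarrow> bool" where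
  "unit_shift_solution f \<sigma> A B \<equiv> A holomorphic_on UNIV \<and> B holomorphic_on UNIV \<and>
     (\<forall>z. A (z + 1) * B z = f z * A z * B (z + 1)) \<and>
     (\<forall>\<tau>>\<sigma> + 1. exp_growth \<tau> A) \<and>
     (\<forall>\<tau>>\<sigma> + 1. exp_growth \<tau> B) \<and>
     (\<forall>t::real\<ge>0. B (of_real t) \<noteq> 0) \<and>
     (\<forall>N. \<exists>S. finite S \<and> 2 powr (real N * (\<sigma> + 1)) \<le> real (card S) \<and>
        (\<forall>z\<in>S. B z = 0 \<and> A z \<noteq> 0 \<and> cmod z \<le> 4 * 2 ^ N))"

text \<open>
  The points of \<open>U N\<close> carry full rows \<open>u + \<int>\<close> of poles: \<open>sublocale B\<close> holds their left halves,
  together with the left rows of the zeros of \<open>f\<close> in the left half-plane, \<open>sublocale U\<close> their right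
  halves. By the choice of \<open>y\<close> no zero \<open>a\<close> of \<open>f\<close> has the imaginary part of such a \<open>u\<close>, hence
  the zeros \<open>a + 1, a + 2, \<dots>\<close> of the numerator cancel none of these poles.
\<close>
locale whittaker =
  fixes f :: "complex \<Rightarrow> complex" and \<sigma> :: real
  assumes hol: "f holomorphic_on UNIV" and f0: "f 0 \<noteq> 0" and sigma: "\<sigma> \<ge> 0"
    and growth: "\<And>s. s > \<sigma> \<Longrightarrow> exp_growth s f"
  fixes \<rho> y :: real
  assumes rho: "0 < \<rho>" "\<rho> \<le> 1" "\<And>z. cmod z < \<rho> \<Longrightarrow> f z \<noteq> 0"
    and y: "0 \<le> y" "y \<le> 1"
    and y_generic: "\<And>a N j. f a = 0 \<Longrightarrow> Im a \<noteq> y + 2 ^ N * (1 + real j / real (nat \<lceil>2 powr (real N * \<sigma>)\<rceil>))"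
begin

definition q :: nat where "q = nat \<lfloor>\<sigma>\<rfloor> + 1"

definition J :: "nat \<Rightarrow> nat" where "J N = nat \<lceil>2 powr (real N * \<sigma>)\<rceil>"

text \<open>The \<open>J N\<close> heights are equally spaced in the dyadic interval from 2^N to
  2^(N+1), translated by the generic \<open>y\<close>.\<close>

definition height :: "nat \<Rightarrow> nat \<Rightarrow> real" where "height N j = y + 2 ^ N * (1 + real j / real (J N))"

definition U :: "nat \<Rightarrow> complex set" where "U N = (\<lambda>j. \<i> * of_real (height N j)) ` {..<J N}"

text \<open>The scale \<open>\<rho>\<close> lies below the modulus of every zero or equals the least
  one, so the shells with N >= 0 catch all zeros of \<open>f\<close>.\<close>

definition sh :: "nat \<Rightarrow> complex set" where
  "sh N = {a. f a = 0 \<and> \<rho> * 2 ^ N \<le> cmod a \<and> cmod a < \<rho> * 2 ^ Suc N}"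

definition A1 where "A1 N = {a \<in> sh N. Re a \<ge> 0}"
definition A2 where "A2 N = {a \<in> sh N. Re a < 0}"
definition mU :: "complex \<Rightarrow> nat" where "mU a = 1"
text \<open>One multiplicity function for both kinds of centres: those from \<open>A2\<close> have
  negative real part, those from \<open>U\<close> lie on the imaginary axis.\<close>

definition mB where "mB a = (if Re a < 0 then zmult f a else 1)"

lemma nz: "\<exists>z. f z \<noteq> 0" using f0 by blast

lemma q: "1 \<le> q" "real q \<le> \<sigma> + 1" "\<sigma> < real q"
proof -
  have "real (nat \<lfloor>\<sigma>\<rfloor>) = of_int \<lfloor>\<sigma>\<rfloor>" using sigma by simp
  moreover have "of_int \<lfloor>\<sigma>\<rfloor> \<le> \<sigma>" "\<sigma> < of_int \<lfloor>\<sigma>\<rfloor> + 1" by linarith+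
  moreover have "real q = real (nat \<lfloor>\<sigma>\<rfloor>) + 1" by (simp add: q_def)
  ultimately show "real q \<le> \<sigma> + 1" "\<sigma> < real q" by linarith+
  show "1 \<le> q" by (simp add: q_def)
qed

lemma J: "2 powr (real N * \<sigma>) \<le> real (J N)" "real (J N) \<le> 2 * 2 powr (real N * \<sigma>)" "J N > 0"
proof -
  have p: "1 \<le> 2 powr (real N * \<sigma>)" using sigma by (simp add: ge_one_powr_ge_zero)
  have "real (J N) = of_int \<lceil>2 powr (real N * \<sigma>)\<rceil>" unfolding J_def by simp
  moreover have "2 powr (real N * \<sigma>) \<le> of_int \<lceil>2 powr (real N * \<sigma>)\<rceil>"
    "of_int \<lceil>2 powr (real N * \<sigma>)\<rceil> < 2 powr (real N * \<sigma>) + 1" by linarith+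
  ultimately show "2 powr (real N * \<sigma>) \<le> real (J N)" "real (J N) \<le> 2 * 2 powr (real N * \<sigma>)" "J N > 0"
    using p by linarith+
qed

lemma height: "2 ^ N \<le> height N j" "j < J N \<Longrightarrow> height N j \<le> 1 + 2 * 2 ^ N"
proof -
  have "2 ^ N * 1 \<le> 2 ^ N * (1 + real j / real (J N))" by (intro mult_left_mono) auto
  then show "2 ^ N \<le> height N j" unfolding height_def using y by linarith
  assume "j < J N"
  then have "real j / real (J N) \<le> 1" by simp
  then have "2 ^ N * (1 + real j / real (J N)) \<le> 2 ^ N * (1 + 1)" by (intro mult_left_mono) auto
  from add_mono[OF y(2) this] show "height N j \<le> 1 + 2 * 2 ^ N"
    by (simp only: height_def one_add_one mult.commute)
qed

lemma inj_height: "inj_on (height N) {..<J N}"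
  using J(3)[of N] by (auto simp: inj_on_def height_def)

lemma U:
  assumes "u \<in> U N"
  shows "\<exists>j<J N. Re u = 0 \<and> Im u = height N j \<and> cmod u = height N j"
proof -
  obtain j where j: "j < J N" "u = \<i> * of_real (height N j)" using assms by (auto simp: U_def)
  have "(0::real) \<le> 2 ^ N" by simp
  then have "height N j \<ge> 0" using height(1)[of N j] by linarith
  then have "Re u = 0 \<and> Im u = height N j \<and> cmod u = height N j" using j(2) by (simp add: norm_mult)
  with j(1) show ?thesis by blast
qed

lemma U_Im:
  assumes "u \<in> U N"
  shows "Im u > 0"
proof -
  obtain j where "Im u = height N j" using U[OF assms] by blast
  moreover have "(0::real) < 2 ^ N" by simp
  ultimately show ?thesis using height(1)[of N j] by linarith
qed

lemma U_lo: "u \<in> U N \<Longrightarrow> \<rho> * 2 ^ N \<le> cmod u"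
proof -
  assume "u \<in> U N"
  have "\<rho> * 2 ^ N \<le> 1 * 2 ^ N" using rho by (intro mult_right_mono) auto
  also have "1 * 2 ^ N \<le> cmod u" using U[OF \<open>u \<in> U N\<close>] height(1)[of N] by auto
  finally show ?thesis .
qed

lemma finite_sh: "finite (sh N)"
  by (rule finite_subset[OF _ finite_zeros_cball[OF hol nz, of "\<rho> * 2 ^ Suc N"]]) (auto simp: sh_def)

lemma finite_zeros_ball: "finite {a. f a = 0 \<and> cmod a < R}"
  by (rule finite_subset[OF _ finite_zeros_cball[OF hol nz, of R]]) auto

lemma sh_count:
  assumes "s > \<sigma>"
  shows "\<exists>K\<ge>0. \<forall>N. real (\<Sum>a\<in>sh N. zmult f a) \<le> K * 2 powr (real N * s)"
proof -
  obtain C where C: "C \<ge> 0" "\<And>z. cmod (f z) \<le> exp (C * (1 + cmod z) powr s)" using growth[OF assms] by blast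
  have s0: "s \<ge> 0" using assms sigma by simp
  obtain K where K: "K \<ge> 0" "\<And>R. R \<ge> 0 \<Longrightarrow> real (\<Sum>a | f a = 0 \<and> cmod a < R. zmult f a) \<le> K * (1 + R) powr s"
    using zero_count_bound[OF hol f0 C(1) s0 C(2)] by blast
  have "real (\<Sum>a\<in>sh N. zmult f a) \<le> K * 3 powr s * 2 powr (real N * s)" for N
  proof -
    have "real (\<Sum>a\<in>sh N. zmult f a) \<le> real (\<Sum>a | f a = 0 \<and> cmod a < \<rho> * 2 ^ Suc N. zmult f a)"
      by (intro of_nat_mono sum_mono2 finite_zeros_ball) (auto simp: sh_def)
    also have "\<dots> \<le> K * (1 + \<rho> * 2 ^ Suc N) powr s" by (rule K(2)) (use rho in auto)
    also have "\<dots> \<le> K * (3 * 2 ^ N) powr s"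
    proof (intro mult_left_mono powr_mono2 K s0)
      have "\<rho> * 2 ^ Suc N \<le> 1 * 2 ^ Suc N" using rho by (intro mult_right_mono) auto
      moreover have "(1::real) \<le> 2 ^ N" by simp
      moreover have "(2::real) ^ Suc N = 2 * 2 ^ N" by simp
      ultimately show "1 + \<rho> * 2 ^ Suc N \<le> 3 * 2 ^ N" by linarith
    qed (use rho in auto)
    also have "(3 * 2 ^ N) powr s = 3 powr s * 2 powr (real N * s)"
      unfolding two_power_eq_powr powr_mult powr_powr ..
    finally show ?thesis by (simp add: mult_ac)
  qed
  then show ?thesis using K(1) by (intro exI[of _ "K * 3 powr s"]) auto
qed

lemma J_count:
  assumes "s > \<sigma>" shows "real (J N) \<le> 2 * 2 powr (real N * s)"
proof -
  have "2 powr (real N * \<sigma>) \<le> 2 powr (real N * s)" using assms by (intro powr_mono mult_left_mono) auto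
  then show ?thesis using J(2)[of N] by linarith
qed

lemma card_U: "card (U N) = J N"
proof -
  have "inj_on (\<lambda>j. \<i> * of_real (height N j)) {..<J N}"
    using inj_height[of N] by (auto simp: inj_on_def)
  then show ?thesis unfolding U_def by (simp add: card_image)
qed

lemma finite_U: "finite (U N)" unfolding U_def by simp

text \<open>Rows start at a + 1 so that the factor produced by \<open>row_shift\<close> is a - z,
  the zero a of \<open>f\<close>.\<close>

sublocale G: shells q \<sigma> \<rho> A1 "zmult f" "\<lambda>a. a + 1"
proof
  show "finite (A1 N)" for N using finite_sh by (simp add: A1_def)
  show "\<rho> * 2 ^ N \<le> cmod a" if "a \<in> A1 N" for N a using that by (simp add: A1_def sh_def)
  show "(cmod a + real k) / 2 \<le> cmod (a + 1 + of_nat k)" if "a \<in> A1 N" for N a k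
    using half_plane_cone[of a "1 + real k"] that by (simp add: A1_def add_ac)
  show "\<exists>K\<ge>0. \<forall>N. real (\<Sum>a\<in>A1 N. zmult f a) \<le> K * 2 powr (real N * s)" if s: "s > \<sigma>" for s
  proof -
    obtain K where "K \<ge> 0" "\<And>N. real (\<Sum>a\<in>sh N. zmult f a) \<le> K * 2 powr (real N * s)" using sh_count[OF s] by blast
    moreover have "(\<Sum>a\<in>A1 N. zmult f a) \<le> (\<Sum>a\<in>sh N. zmult f a)" for N
      by (intro sum_mono2 finite_sh) (auto simp: A1_def)
    ultimately show ?thesis by (meson of_nat_mono order_trans)
  qed
qed (rule q rho(1,2))+

text \<open>The product is used at -z: the row -a, -a + 1, ... then gives the zeros a, a - 1, ... of
  the denominator, while the reflected centres satisfy the same cone condition.\<close>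

sublocale B: shells q \<sigma> \<rho> "\<lambda>N. A2 N \<union> U N" mB "\<lambda>a. - a"
proof
  show "finite (A2 N \<union> U N)" for N using finite_sh finite_U by (simp add: A2_def)
  show "\<rho> * 2 ^ N \<le> cmod a" if "a \<in> A2 N \<union> U N" for N a using that U_lo by (auto simp: A2_def sh_def)
  show "(cmod a + real k) / 2 \<le> cmod (- a + of_nat k)" if a: "a \<in> A2 N \<union> U N" for N a k
  proof -
    have "Re a \<le> 0" using a U[of a N] by (auto simp: A2_def)
    then show ?thesis using half_plane_cone[of "- a" "real k"] by simp
  qed
  show "\<exists>K\<ge>0. \<forall>N. real (\<Sum>a\<in>A2 N \<union> U N. mB a) \<le> K * 2 powr (real N * s)" if s: "s > \<sigma>" for s
  proof -
    obtain K where K: "K \<ge> 0" "\<And>N. real (\<Sum>a\<in>sh N. zmult f a) \<le> K * 2 powr (real N * s)" using sh_count[OF s] by blast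
    have "real (\<Sum>a\<in>A2 N \<union> U N. mB a) \<le> (K + 2) * 2 powr (real N * s)" for N
    proof -
      have "(\<Sum>a\<in>A2 N \<union> U N. mB a) \<le> (\<Sum>a\<in>A2 N. mB a) + (\<Sum>a\<in>U N. mB a)"
        by (simp add: sum_Un_nat finite_sh finite_U A2_def)
      also have "(\<Sum>a\<in>A2 N. mB a) = (\<Sum>a\<in>A2 N. zmult f a)" by (intro sum.cong) (auto simp: A2_def mB_def)
      also have "(\<Sum>a\<in>A2 N. zmult f a) \<le> (\<Sum>a\<in>sh N. zmult f a)"
        by (intro sum_mono2 finite_sh) (auto simp: A2_def)
      also have "(\<Sum>a\<in>U N. mB a) = (\<Sum>a\<in>U N. 1)"
      proof (intro sum.cong refl)
        fix u assume "u \<in> U N"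
        then have "Re u = 0" using U by blast
        then show "mB u = 1" by (simp add: mB_def)
      qed
      also have "\<dots> = J N" by (simp add: card_U)
      finally have "real (\<Sum>a\<in>A2 N \<union> U N. mB a) \<le> real (\<Sum>a\<in>sh N. zmult f a) + real (J N)" by linarith
      also have "\<dots> \<le> K * 2 powr (real N * s) + 2 * 2 powr (real N * s)"
        by (intro add_mono K J_count s)
      finally show ?thesis by (simp add: algebra_simps)
    qed
    then show ?thesis using K(1) by (intro exI[of _ "K + 2"]) auto
  qed
qed (rule q rho(1,2))+

sublocale U: shells q \<sigma> \<rho> U mU "\<lambda>a. a + 1"
proof
  show "(cmod a + real k) / 2 \<le> cmod (a + 1 + of_nat k)" if "a \<in> U N" for N a k
  proof -
    have "Re a \<ge> 0" using U[OF that] by auto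
    then show ?thesis using half_plane_cone[of a "1 + real k"] by (simp add: add_ac)
  qed
  show "\<exists>K\<ge>0. \<forall>N. real (\<Sum>a\<in>U N. mU a) \<le> K * 2 powr (real N * s)" if "s > \<sigma>" for s
    using J_count[OF that] by (intro exI[of _ 2]) (auto simp: card_U mU_def)
qed (rule q rho(1,2) finite_U U_lo, assumption?)+

text \<open>The radii \<open>\<rho>\<close> 2^N are shell boundaries, so the zeros removed from
  \<open>f\<close> on the disc are exactly those of the first N shells and match the partial
  products.\<close>

lemma zeros_ball_eq:
  "zero_prod f (\<rho> * 2 ^ N) z
   = (\<Prod>n<N. \<Prod>a\<in>A1 n. (z - a) ^ zmult f a) * (\<Prod>n<N. \<Prod>a\<in>A2 n. (z - a) ^ zmult f a)"
proof -
  have disj: "sh i \<inter> sh j = {}" if "i < j" for i j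
  proof -
    have "\<rho> * 2 ^ Suc i \<le> \<rho> * 2 ^ j" using that rho by (intro mult_left_mono power_increasing) auto
    then show ?thesis by (fastforce simp: sh_def)
  qed
  have "{a. f a = 0 \<and> cmod a < \<rho> * 2 ^ N} = (\<Union>n<N. sh n)"
  proof (intro equalityI subsetI)
    fix a assume a: "a \<in> {a. f a = 0 \<and> cmod a < \<rho> * 2 ^ N}"
    then have "\<rho> \<le> cmod a" using rho(3)[of a] by force
    then obtain n where "n < N" "\<rho> * 2 ^ n \<le> cmod a \<and> cmod a < \<rho> * 2 ^ Suc n"
      using shell_index[OF rho(1), of "cmod a" N] a by blast
    then show "a \<in> (\<Union>n<N. sh n)" using a by (auto simp: sh_def)
  next
    fix a assume "a \<in> (\<Union>n<N. sh n)"
    then obtain n where n: "n < N" "a \<in> sh n" by blast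
    have "\<rho> * 2 ^ Suc n \<le> \<rho> * 2 ^ N" using n rho by (intro mult_left_mono power_increasing) auto
    then show "a \<in> {a. f a = 0 \<and> cmod a < \<rho> * 2 ^ N}" using n by (auto simp: sh_def)
  qed
  then have "zero_prod f (\<rho> * 2 ^ N) z = (\<Prod>a\<in>(\<Union>n<N. sh n). (z - a) ^ zmult f a)"
    by (simp only:)
  also have "\<dots> = (\<Prod>n<N. \<Prod>a\<in>sh n. (z - a) ^ zmult f a)"
  proof (rule prod.UNION_disjoint)
    show "\<forall>i\<in>{..<N}. \<forall>j\<in>{..<N}. i \<noteq> j \<longrightarrow> sh i \<inter> sh j = {}"
      using disj by (metis inf_commute linorder_neqE_nat)
  qed (auto simp: finite_sh)
  also have "\<dots> = (\<Prod>n<N. (\<Prod>a\<in>A1 n. (z - a) ^ zmult f a) * (\<Prod>a\<in>A2 n. (z - a) ^ zmult f a))"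
  proof (intro prod.cong refl)
    fix n
    have "sh n = A1 n \<union> A2 n" by (auto simp: A1_def A2_def)
    moreover have "A1 n \<inter> A2 n = {}" by (auto simp: A1_def A2_def)
    ultimately show "(\<Prod>a\<in>sh n. (z - a) ^ zmult f a) = (\<Prod>a\<in>A1 n. (z - a) ^ zmult f a) * (\<Prod>a\<in>A2 n. (z - a) ^ zmult f a)"
      using finite_sh[of n] by (simp add: prod.union_disjoint)
  qed
  finally show ?thesis by (simp only: prod.distrib)
qed

definition D1 where "D1 N z = (\<Prod>n<N. \<Prod>a\<in>A1 n. (z - a) ^ zmult f a)"
definition D2 where "D2 N z = (\<Prod>n<N. \<Prod>a\<in>A2 n. (z - a) ^ zmult f a)"
definition DU where "DU N z = (\<Prod>n<N. \<Prod>u\<in>U n. z - u)"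
text \<open>Signs from writing a - z as -(z - a). They need not converge; a constant term of the
  exponent absorbs them.\<close>

definition \<epsilon>1 :: "nat \<Rightarrow> complex" where "\<epsilon>1 N = (\<Prod>n<N. \<Prod>a\<in>A1 n. (- 1) ^ zmult f a)"
definition \<epsilon>U :: "nat \<Rightarrow> complex" where "\<epsilon>U N = (\<Prod>n<N. \<Prod>u\<in>U n. - 1)"

lemma eps_nonzero: "\<epsilon>1 N \<noteq> 0" "\<epsilon>U N \<noteq> 0"
  by (auto simp: \<epsilon>1_def \<epsilon>U_def G.fin finite_U)

lemma G_shift: "\<exists>P. poly_deg_lt q P \<and> (\<forall>z. G.GN N (z + 1) = \<epsilon>1 N * D1 N z * exp (poly P z) * G.GN N z)"
proof -
  obtain P where P: "poly_deg_lt q P"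
    "\<And>z. G.GN N (z + 1) = (\<Prod>n<N. \<Prod>a\<in>A1 n. (a + 1 - 1 - z) ^ zmult f a) * exp (poly P z) * G.GN N z"
    using G.GN_shift[of N] by blast
  have "(\<Prod>n<N. \<Prod>a\<in>A1 n. (a + 1 - 1 - z) ^ zmult f a) = \<epsilon>1 N * D1 N z" for z
  proof -
    have "(a + 1 - 1 - z) = (- 1) * (z - a)" for a by simp
    then show ?thesis unfolding \<epsilon>1_def D1_def by (simp only: power_mult_distrib prod.distrib)
  qed
  then show ?thesis using P by auto
qed

lemma U_shift: "\<exists>P. poly_deg_lt q P \<and> (\<forall>z. U.GN N (z + 1) = \<epsilon>U N * DU N z * exp (poly P z) * U.GN N z)"
proof -
  obtain P where P: "poly_deg_lt q P"
    "\<And>z. U.GN N (z + 1) = (\<Prod>n<N. \<Prod>a\<in>U n. (a + 1 - 1 - z) ^ mU a) * exp (poly P z) * U.GN N z"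
    using U.GN_shift[of N] by blast
  have "(\<Prod>n<N. \<Prod>a\<in>U n. (a + 1 - 1 - z) ^ mU a) = \<epsilon>U N * DU N z" for z
  proof -
    have "(a + 1 - 1 - z) ^ mU a = (- 1) * (z - a)" for a by (simp add: mU_def)
    then show ?thesis unfolding \<epsilon>U_def DU_def by (simp only: prod.distrib)
  qed
  then show ?thesis using P by auto
qed

text \<open>The shift identity at -z - 1: reflection turns -a - 1 - (-z - 1) into z - a, so no sign
  arises, and the polynomial is composed with -1 - z.\<close>

lemma B_shift: "\<exists>P. poly_deg_lt q P \<and> (\<forall>z. B.GN N (- z) = D2 N z * DU N z * exp (poly P z) * B.GN N (- z - 1))"
proof -
  obtain P where P: "poly_deg_lt q P"
    "\<And>z. B.GN N (z + 1) = (\<Prod>n<N. \<Prod>a\<in>A2 n \<union> U n. (- a - 1 - z) ^ mB a) * exp (poly P z) * B.GN N z"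
    using B.GN_shift[of N] by blast
  have e: "(\<Prod>n<N. \<Prod>a\<in>A2 n \<union> U n. (- a - 1 - (- z - 1)) ^ mB a) = D2 N z * DU N z" for z
  proof -
    have "(\<Prod>a\<in>A2 n \<union> U n. (- a - 1 - (- z - 1)) ^ mB a) = (\<Prod>a\<in>A2 n. (z - a) ^ zmult f a) * (\<Prod>u\<in>U n. z - u)" for n
    proof -
      have "A2 n \<inter> U n = {}" using U[of _ n] by (fastforce simp: A2_def)
      then have "(\<Prod>a\<in>A2 n \<union> U n. (- a - 1 - (- z - 1)) ^ mB a)
        = (\<Prod>a\<in>A2 n. (- a - 1 - (- z - 1)) ^ mB a) * (\<Prod>a\<in>U n. (- a - 1 - (- z - 1)) ^ mB a)"
        using B.fin[of n] by (intro prod.union_disjoint) auto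
      also have "(\<Prod>a\<in>A2 n. (- a - 1 - (- z - 1)) ^ mB a) = (\<Prod>a\<in>A2 n. (z - a) ^ zmult f a)"
        by (intro prod.cong) (auto simp: A2_def mB_def)
      also have "(\<Prod>a\<in>U n. (- a - 1 - (- z - 1)) ^ mB a) = (\<Prod>u\<in>U n. z - u)"
      proof (intro prod.cong refl)
        fix u assume "u \<in> U n"
        then have "Re u = 0" using U by blast
        then show "(- u - 1 - (- z - 1)) ^ mB u = z - u" by (simp add: mB_def)
      qed
      finally show ?thesis .
    qed
    then show ?thesis unfolding D2_def DU_def by (simp only: prod.distrib)
  qed
  define Q where "Q = pcompose P [:- 1, - 1:]"
  have "poly_deg_lt q Q" unfolding Q_def by (rule poly_deg_lt_pcompose_linear[OF P(1)]) simp
  moreover have "B.GN N (- z) = D2 N z * DU N z * exp (poly Q z) * B.GN N (- z - 1)" for z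
  proof -
    have "poly [:- 1, - 1:] z = - z - 1" by simp
    then have "poly Q z = poly P (- z - 1)" by (simp only: Q_def poly_pcompose)
    then show ?thesis using P(2)[of "- z - 1"] unfolding e by simp
  qed
  ultimately show ?thesis by blast
qed

text \<open>With F0(z) = G(z) / (B(-z) U(z)), the quotient num/den is f(z) F0(z) / F0(z + 1): the
  defect of the products as a solution of the equation.\<close>

definition num where "num z = f z * G.G z * B.G (- z - 1) * U.G (z + 1)"
definition den where "den z = G.G (z + 1) * B.G (- z) * U.G z"
definition numN where "numN N z = f z * G.GN N z * B.GN N (- z - 1) * U.GN N (z + 1)"
definition denN where "denN N z = G.GN N (z + 1) * B.GN N (- z) * U.GN N z"

lemma shifts_holo:
  "G.G holomorphic_on UNIV" "(\<lambda>z. G.G (z + 1)) holomorphic_on UNIV"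
  "(\<lambda>z. B.G (- z)) holomorphic_on UNIV" "(\<lambda>z. B.G (- z - 1)) holomorphic_on UNIV"
  "U.G holomorphic_on UNIV" "(\<lambda>z. U.G (z + 1)) holomorphic_on UNIV"
  by (intro G.G_holo U.G_holo holomorphic_compose_UNIV[OF G.G_holo] holomorphic_compose_UNIV[OF B.G_holo] holomorphic_compose_UNIV[OF U.G_holo] holomorphic_intros)+

lemma num_den_holo: "num holomorphic_on UNIV" "den holomorphic_on UNIV"
  unfolding num_def[abs_def] den_def[abs_def] by (intro holomorphic_intros hol shifts_holo)+

lemma G0: "G.G 0 \<noteq> 0" "B.G 0 \<noteq> 0" "U.G 0 \<noteq> 0"
  unfolding G.G_product(4)[OF G.tau_ok] B.G_product(4)[OF B.tau_ok] U.G_product(4)[OF U.tau_ok]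
    G.shellf_0 B.shellf_0 U.shellf_0 by simp_all

text \<open>One disc without zeros is enough, since the identity found there extends to the whole
  plane.\<close>

lemma good_ball: "\<exists>w r. r > 0 \<and> (\<forall>z\<in>cball w r. num z \<noteq> 0 \<and> den z \<noteq> 0)"
proof -
  define H where "H = {f, G.G, \<lambda>z. G.G (z + 1), \<lambda>z. B.G (- z), \<lambda>z. B.G (- z - 1), U.G, \<lambda>z. U.G (z + 1)}"
  have "\<exists>z. \<forall>h\<in>H. h z \<noteq> 0"
  proof (rule common_nonzero)
    show "finite H" by (simp add: H_def)
    have "\<exists>z. G.G z \<noteq> 0" "\<exists>z. U.G z \<noteq> 0" "\<exists>z. G.G (z + 1) \<noteq> 0" "\<exists>z. U.G (z + 1) \<noteq> 0"
      "\<exists>z. B.G (- z) \<noteq> 0" "\<exists>z. B.G (- z - 1) \<noteq> 0"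
      using G0 by (auto intro: exI[of _ 0] exI[of _ "-1"])
    then show "h holomorphic_on UNIV \<and> (\<exists>z. h z \<noteq> 0)" if "h \<in> H" for h
      using that hol nz shifts_holo unfolding H_def by blast
  qed
  then obtain w where "\<forall>h\<in>H. h w \<noteq> 0" ..
  then have nw: "num w * den w \<noteq> 0" unfolding num_def den_def H_def by simp
  have "continuous_on UNIV (\<lambda>z. num z * den z)"
    by (intro holomorphic_on_imp_continuous_on holomorphic_intros num_den_holo)
  then have "isCont (\<lambda>z. num z * den z) w" by (simp add: continuous_on_eq_continuous_at)
  from continuous_at_avoid[OF this nw] obtain e where e: "e > 0" "\<And>z. dist w z < e \<Longrightarrow> num z * den z \<noteq> 0" by blast
  show ?thesis
  proof (intro exI[of _ w] exI[of _ "e / 2"] conjI ballI)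
    fix z assume "z \<in> cball w (e / 2)"
    then have "dist w z < e" using e(1) by simp
    from e(2)[OF this] show "num z \<noteq> 0" "den z \<noteq> 0" by auto
  qed (use e in simp)
qed

lemma num_den_ulim: "uniform_limit (cball w r) numN num sequentially" "uniform_limit (cball w r) denN den sequentially"
proof -
  define R where "R = cmod w + \<bar>r\<bar> + 1"
  have zb: "cmod z \<le> cmod w + \<bar>r\<bar>" if "z \<in> cball w r" for z
    using that norm_triangle_sub[of z w] by (simp add: dist_norm norm_minus_commute)
  have s: "z \<in> cball 0 R" "z + 1 \<in> cball 0 R" "- z \<in> cball 0 R" "- z - 1 \<in> cball 0 R" if "z \<in> cball w r" for z
    using zb[OF that] norm_triangle_ineq[of z 1] norm_triangle_ineq4[of "-z" 1] by (auto simp: R_def)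
  have c: "continuous_on (cball w r) h" if "h holomorphic_on UNIV" for h :: "complex \<Rightarrow> complex"
    using that holomorphic_on_imp_continuous_on continuous_on_subset by blast
  note u1 = uniform_limit_compose_arg[OF G.G_ulim[of R], of "cball w r"]
  note u2 = uniform_limit_compose_arg[OF B.G_ulim[of R], of "cball w r"]
  note u3 = uniform_limit_compose_arg[OF U.G_ulim[of R], of "cball w r"]
  have N: "numN = (\<lambda>N z. f z * G.GN N z * B.GN N (- z - 1) * U.GN N (z + 1))"
    "num = (\<lambda>z. f z * G.G z * B.G (- z - 1) * U.G (z + 1))"
    "denN = (\<lambda>N z. G.GN N (z + 1) * B.GN N (- z) * U.GN N z)"
    "den = (\<lambda>z. G.G (z + 1) * B.G (- z) * U.G z)"
    by (auto simp: numN_def num_def denN_def den_def fun_eq_iff)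
  show "uniform_limit (cball w r) numN num sequentially" unfolding N
    by (intro uniform_limit_mult_compact compact_cball uniform_limit_const_fun u1 u2 u3 s continuous_intros c hol shifts_holo)
  show "uniform_limit (cball w r) denN den sequentially" unfolding N
    by (intro uniform_limit_mult_compact compact_cball uniform_limit_const_fun u1 u2 u3 s continuous_intros c hol shifts_holo)
qed

text \<open>At level N the linear factors in the shifts of G and of B reproduce the zeros of
  \<open>f\<close> on the disc of radius \<open>\<rho>\<close> 2^N, and \<open>DU\<close> occurs on
  both sides. What remains is exp of \<open>L N\<close> plus a polynomial of degree below q, the
  situation of \<open>quotient_limit_exp_poly\<close>.\<close>

lemma num_den_quotient: "\<exists>H. poly_deg_lt q H \<and> (\<forall>z. num z = exp (poly H z) * den z)"
proof -
  obtain w r where wr: "r > 0" "\<And>z. z \<in> cball w r \<Longrightarrow> num z \<noteq> 0" "\<And>z. z \<in> cball w r \<Longrightarrow> den z \<noteq> 0"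
    using good_ball by blast
  \<comment> \<open>Strictly between: above \<open>\<sigma>\<close> the growth of \<open>f\<close>
    is known, below q the bound R^(s - q) tends to 0.\<close>
  define s where "s = (\<sigma> + real q) / 2"
  have s: "\<sigma> < s" "s < real q" "s \<ge> 0" using q sigma by (auto simp: s_def)
  obtain C where C: "C \<ge> 0" "\<And>z. cmod (f z) \<le> exp (C * (1 + cmod z) powr s)" using growth[OF s(1)] by blast
  obtain K where K: "K \<ge> 0" and KL: "\<forall>R\<ge>1. \<exists>L. zero_free_log f q s K R L"
    using log_of_zero_free_part[OF hol f0 C(1) s(3) q(1) C(2)] by blast
  define R where "R = (\<lambda>N::nat. \<rho> * 2 ^ N)"
  define M where "M = 4 * (cmod w + r) + 1"
  obtain N0 :: nat where n0: "M / \<rho> < real N0" using reals_Archimedean2 by blast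
  have N0: "R N \<ge> M" if "N \<ge> N0" for N
  proof -
    have "M / \<rho> < real N" using n0 that by simp
    also have "real N \<le> 2 ^ N" by (rule less_imp_le[OF of_nat_less_two_power])
    finally show ?thesis using rho(1) by (simp add: R_def field_simps)
  qed
  have M1: "M \<ge> 1" using wr(1) by (simp add: M_def)
  have in_ball: "z \<in> ball 0 (R N)" "cmod z \<le> R N / 4" if "N \<ge> N0" "z \<in> ball w r" for N z
  proof -
    have "cmod (z - w) < r" using that(2) by (simp add: dist_norm norm_minus_commute)
    then have "cmod z \<le> cmod w + r" using norm_triangle_sub[of z w] by linarith
    then have "4 * cmod z + 1 \<le> M" by (simp add: M_def)
    then have "4 * cmod z + 1 \<le> R N" using N0[OF that(1)] by (rule order_trans)
    then show "z \<in> ball 0 (R N)" "cmod z \<le> R N / 4" using norm_ge_zero[of z] by (simp_all, linarith)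
  qed
  have "\<forall>N\<in>{N0..}. \<exists>L. zero_free_log f q s K (R N) L"
  proof
    fix N assume "N \<in> {N0..}"
    then have "R N \<ge> 1" using order_trans[OF M1 N0[of N]] by simp
    from mp[OF spec[OF KL, of "R N"] this]
    show "\<exists>L. zero_free_log f q s K (R N) L" .
  qed
  from bchoice[OF this] obtain L where L: "\<forall>N\<in>{N0..}. zero_free_log f q s K (R N) (L N)" ..
  \<comment> \<open>The factorisation of \<open>f\<close> is a premise at each point, because it is
    available only inside the disc and for large N, while the polynomial is chosen for all N at
    once.\<close>
  have exP: "\<exists>P. poly_deg_lt q P \<and> (\<forall>z. f z = exp (L N z) * (D1 N z * D2 N z) \<longrightarrow> exp (L N z + poly P z) * denN N z = numN N z)" for N
  proof -
    obtain P1 where P1: "poly_deg_lt q P1" "\<And>z. G.GN N (z + 1) = \<epsilon>1 N * D1 N z * exp (poly P1 z) * G.GN N z" using G_shift[of N] by blast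
    obtain PU where PU: "poly_deg_lt q PU" "\<And>z. U.GN N (z + 1) = \<epsilon>U N * DU N z * exp (poly PU z) * U.GN N z" using U_shift[of N] by blast
    obtain PB where PB: "poly_deg_lt q PB" "\<And>z. B.GN N (- z) = D2 N z * DU N z * exp (poly PB z) * B.GN N (- z - 1)" using B_shift[of N] by blast
    \<comment> \<open>Exponent of the shift in the numerator minus those in the denominator; the
      constant carries the quotient of the signs.\<close>
    define P where "P = PU - P1 - PB + [:Ln (\<epsilon>U N / \<epsilon>1 N):]"
    have "poly_deg_lt q P" unfolding P_def by (intro poly_deg_lt_add poly_deg_lt_diff P1 PU PB poly_deg_lt_const q)
    moreover have "exp (L N z + poly P z) * denN N z = numN N z" if "f z = exp (L N z) * (D1 N z * D2 N z)" for z
    proof -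
      have "exp (Ln (\<epsilon>U N / \<epsilon>1 N)) = \<epsilon>U N / \<epsilon>1 N" by (rule exp_Ln) (use eps_nonzero in simp)
      then have e: "exp (L N z + poly P z) = exp (L N z) * (exp (poly PU z) / (exp (poly P1 z) * exp (poly PB z))) * (\<epsilon>U N / \<epsilon>1 N)"
        by (simp add: P_def exp_add exp_diff)
      show ?thesis unfolding e denN_def numN_def P1(2) PU(2) PB(2) that
        using eps_nonzero(1)[of N] by (simp add: field_simps)
    qed
    ultimately show ?thesis by blast
  qed
  from choice[OF allI[OF exP]] obtain P where P': "\<forall>N. poly_deg_lt q (P N) \<and> 
    (\<forall>z. f z = exp (L N z) * (D1 N z * D2 N z) \<longrightarrow> exp (L N z + poly (P N) z) * denN N z = numN N z)" ..
  have P: "poly_deg_lt q (P N)"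
    "f z = exp (L N z) * (D1 N z * D2 N z) \<Longrightarrow> exp (L N z + poly (P N) z) * denN N z = numN N z" for N z
    using P' by blast+
  define V where "V = (\<lambda>N z. L N z + poly (P N) z)"
  have Lb: "L N holomorphic_on ball w r" if "N \<ge> N0" for N
    using L that in_ball(1)[OF that] by (meson atLeast_iff holomorphic_on_subset subsetI)
  show ?thesis
  proof (rule quotient_limit_exp_poly[OF wr(1) q(1) num_den_holo num_den_ulim wr(2,3), where V=V and ?N0.0=N0])
    show "V N holomorphic_on ball w r" if "N \<ge> N0" for N
      unfolding V_def by (intro holomorphic_intros Lb that)
    show "exp (V N z) * denN N z = numN N z" if N: "N \<ge> N0" and z: "z \<in> ball w r" for N z
    proof -
      have "f z = exp (L N z) * zero_prod f (R N) z"
        using L N in_ball(1)[OF N z] by blast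
      then have "f z = exp (L N z) * (D1 N z * D2 N z)"
        unfolding R_def zeros_ball_eq D1_def D2_def .
      then show ?thesis unfolding V_def by (rule P(2))
    qed
    show "(\<lambda>N. (deriv ^^ q) (V N) z) \<longlonglongrightarrow> 0" if z: "z \<in> ball w r" for z
    proof (rule Lim_null_comparison)
      \<comment> \<open>The q-th derivative annihilates \<open>P N\<close>, whose coefficients may
        behave arbitrarily as N grows.\<close>
      have ex: "(deriv ^^ q) (V N) z = (deriv ^^ q) (L N) z" if "N \<ge> N0" for N
      proof -
        have "(deriv ^^ q) (V N) z = (deriv ^^ q) (L N) z + (deriv ^^ q) (poly (P N)) z"
          unfolding V_def by (rule higher_deriv_add[OF Lb[OF that] _ open_ball z]) (intro holomorphic_intros)
        also have "(deriv ^^ q) (poly (P N)) z = 0"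
          unfolding higher_deriv_poly poly_deg_lt_higher_pderiv[OF P(1)] by simp
        finally show ?thesis by simp
      qed
      show "\<forall>\<^sub>F N in sequentially. norm ((deriv ^^ q) (V N) z) \<le> K * (\<rho> powr (s - real q) * (2 powr (s - real q)) ^ N)"
        using eventually_ge_at_top[of N0]
      proof eventually_elim
        case (elim N)
        have "norm ((deriv ^^ q) (L N) z) \<le> K * R N powr (s - real q)"
          using L elim in_ball(2)[OF elim z] by blast
        also have "R N powr (s - real q) = \<rho> powr (s - real q) * (2 powr (s - real q)) ^ N"
          unfolding R_def powr_mult two_power_eq_powr powr_powr by (simp add: powr_power mult.commute)
        finally show ?case unfolding ex[OF elim] .
      qed
      have "2 powr (s - real q) < 2 powr (0::real)" using s by (intro powr_less_mono) auto
      then have "(\<lambda>N. K * (\<rho> powr (s - real q) * (2 powr (s - real q)) ^ N)) \<longlonglongrightarrow> K * (\<rho> powr (s - real q) * 0)"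
        by (intro tendsto_intros LIMSEQ_realpow_zero) auto
      then show "(\<lambda>N. K * (\<rho> powr (s - real q) * (2 powr (s - real q)) ^ N)) \<longlonglongrightarrow> 0" by simp
    qed
  qed
qed

lemma growth_compose:
  assumes "exp_growth \<tau> h" and "\<And>z. cmod (\<phi> z) = cmod z"
  shows "exp_growth \<tau> (\<lambda>z. h (\<phi> z))"
  using assms by metis

text \<open>Multiplying the numerator by exp S with S(z + 1) - S(z) = H cancels the defect exp H and
  adds no zeros or poles.\<close>

lemma solution:
  "\<exists>A B. unit_shift_solution f \<sigma> A B"
proof -
  obtain H where H: "poly_deg_lt q H" "\<And>z. num z = exp (poly H z) * den z" using num_den_quotient by blast
  obtain S where S: "poly_deg_lt (Suc q) S" "\<And>z. poly S (z + 1) - poly S z = poly H z"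
    using poly_difference_equation[OF H(1)] by blast
  define A where "A = (\<lambda>z. G.G z * exp (poly S z))"
  define B where "B = (\<lambda>z. B.G (- z) * U.G z)"
  have eq: "A (z + 1) * B z = f z * A z * B (z + 1)" for z
  proof -
    have "poly S (z + 1) = poly H z + poly S z" using S(2)[of z] by (simp add: algebra_simps)
    then have "A (z + 1) * B z = exp (poly S z) * (exp (poly H z) * den z)"
      by (simp add: A_def B_def den_def exp_add mult_ac)
    also have "\<dots> = exp (poly S z) * num z" by (simp only: H(2))
    also have "\<dots> = f z * A z * B (z + 1)" by (simp add: A_def B_def num_def mult_ac)
    finally show ?thesis .
  qed
  have gA: "exp_growth \<tau> A" if "\<tau> > \<sigma> + 1" for \<tau>
    unfolding A_def by (intro growth_mult G.G_growth exp_poly_growth[OF S(1)]) (use that q in auto)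
  have gB: "exp_growth \<tau> B" if "\<tau> > \<sigma> + 1" for \<tau>
    unfolding B_def by (intro growth_mult U.G_growth growth_compose[OF B.G_growth] that) simp
  \<comment> \<open>The rows from \<open>A2\<close> stay in Re z < 0 and those from \<open>U\<close>
    in Im z > 0, so both miss the nonnegative reals.\<close>
  have Bt: "B (of_real t) \<noteq> 0" if t: "t \<ge> 0" for t
  proof
    assume "B (of_real t) = 0"
    then consider "B.G (- of_real t) = 0" | "U.G (of_real t) = 0" by (auto simp: B_def)
    then show False
    proof cases
      case 1
      then obtain N a k where a: "a \<in> A2 N \<union> U N" "- of_real t = - a + of_nat k" unfolding B.G_eq_0 by blast
      have "a = of_nat k - - of_real t" unfolding a(2) by simp
      then have "Re a \<ge> 0" "Im a = 0" using t by auto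
      then show False using a(1) U_Im[of a N] by (auto simp: A2_def)
    next
      case 2
      then obtain N u k where u: "u \<in> U N" "of_real t = u + 1 + of_nat k" unfolding U.G_eq_0 by blast
      have "u = of_real t - 1 - of_nat k" unfolding u(2) by simp
      then have "Im u = 0" by simp
      then show False using U_Im[OF u(1)] by simp
    qed
  qed
  have poles: "\<exists>S. finite S \<and> 2 powr (real N * (\<sigma> + 1)) \<le> real (card S) \<and>
        (\<forall>z\<in>S. B z = 0 \<and> A z \<noteq> 0 \<and> cmod z \<le> 4 * 2 ^ N)" for N
  proof -
    \<comment> \<open>The first 2^N points to the right on each of the \<open>J N\<close> rows: at
      least 2^(N \<open>\<sigma>\<close>) 2^N points, of modulus at most (1 + 2 * 2^N) + 2^N <= 4 *
      2^N.\<close>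
    define pt where "pt = (\<lambda>(j::nat, k::nat). \<i> * of_real (height N j) + 1 + of_nat k)"
    define T where "T = pt ` ({..<J N} \<times> {..<2 ^ N})"
    have inj: "inj_on pt ({..<J N} \<times> {..<2 ^ N})"
    proof (rule inj_onI, clarify)
      fix j k j' k' assume j: "j < J N" "j' < J N" and e: "pt (j, k) = pt (j', k')"
      have "Im (pt (j, k)) = height N j" "Re (pt (j, k)) = 1 + real k" for j k by (simp_all add: pt_def)
      then have "height N j = height N j'" "real k = real k'" using e by (metis, metis add_left_cancel)
      then show "j = j' \<and> k = k'" using inj_height[of N] j by (auto simp: inj_on_def)
    qed
    have "card T = J N * 2 ^ N" unfolding T_def by (simp add: card_image[OF inj] card_cartesian_product)
    moreover have "2 powr (real N * (\<sigma> + 1)) = 2 powr (real N * \<sigma>) * 2 ^ N"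
      by (simp add: two_power_eq_powr distrib_left powr_add)
    ultimately have "2 powr (real N * (\<sigma> + 1)) \<le> real (card T)" using J(1)[of N] by (simp add: mult_right_mono)
    moreover have "finite T" by (simp add: T_def)
    moreover have "B z = 0 \<and> A z \<noteq> 0 \<and> cmod z \<le> 4 * 2 ^ N" if zT: "z \<in> T" for z
    proof (intro conjI)
      obtain j k where jk: "j < J N" "k < 2 ^ N" "z = \<i> * of_real (height N j) + 1 + of_nat k"
        using zT by (auto simp: T_def pt_def)
      define u where "u = \<i> * of_real (height N j)"
      have u: "u \<in> U N" using jk by (auto simp: U_def u_def)
      have "U.G z = 0" unfolding U.G_eq_0 using u jk(3) unfolding u_def[symmetric] by (intro exI[of _ N] bexI[of _ u]) (auto simp: mU_def)
      then show "B z = 0" by (simp add: B_def)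
      show "A z \<noteq> 0"
      proof
        assume "A z = 0"
        then have "G.G z = 0" by (simp add: A_def)
        then obtain n a k' where a: "a \<in> A1 n" "z = a + 1 + of_nat k'" unfolding G.G_eq_0 by blast
        have "Im a = Im z" unfolding a(2) by simp
        also have "\<dots> = height N j" unfolding jk(3) by simp
        finally have "Im a = height N j" .
        moreover have "f a = 0" using a(1) by (simp add: A1_def sh_def)
        ultimately show False using y_generic[of a N j] unfolding height_def J_def by simp
      qed
      have h: "0 \<le> height N j" "height N j \<le> 1 + 2 * 2 ^ N"
        using height(1)[of N j] height(2)[OF jk(1)] zero_le_power[of "2::real" N] by linarith+
      have "cmod z \<le> cmod (\<i> * of_real (height N j)) + cmod (1 + of_nat k)"
        unfolding jk(3) add.assoc by (rule norm_triangle_ineq)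
      also have "cmod (\<i> * of_real (height N j)) = height N j" using h by (simp add: norm_mult)
      also have "cmod (1 + of_nat k) = real (Suc k)" by (metis norm_of_nat of_nat_Suc)
      finally have "cmod z \<le> height N j + real (Suc k)" .
      moreover have "real (Suc k) \<le> 2 ^ N" using jk(2) by (metis Suc_leI of_nat_le_iff of_nat_numeral of_nat_power)
      moreover have "(1::real) \<le> 2 ^ N" by simp
      ultimately show "cmod z \<le> 4 * 2 ^ N" using h by linarith
    qed
    ultimately show ?thesis by blast
  qed
  have "A holomorphic_on UNIV" "B holomorphic_on UNIV"
    unfolding A_def B_def by (intro holomorphic_intros shifts_holo)+
  then show ?thesis using eq gA gB Bt poles by blast
qed

end

section \<open>Choice of the generic height and reduction to unit shift\<close>

lemma growth_affine:
  fixes h :: "complex \<Rightarrow> complex"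
  assumes "exp_growth s h" and s: "s \<ge> 0"
  shows "exp_growth s (\<lambda>z. h (a * z + b))"
proof -
  obtain K where K: "K \<ge> 0" "\<And>z. cmod (h z) \<le> exp (K * (1 + cmod z) powr s)" using assms by blast
  define \<kappa> where "\<kappa> = 1 + cmod a + cmod b"
  have "cmod (h (a * z + b)) \<le> exp (K * \<kappa> powr s * (1 + cmod z) powr s)" for z
  proof -
    have "cmod (a * z + b) \<le> cmod a * cmod z + cmod b"
      using norm_triangle_ineq[of "a * z" b] by (simp add: norm_mult)
    moreover have "\<kappa> * (1 + cmod z) = 1 + cmod z + cmod a + cmod a * cmod z + cmod b + cmod b * cmod z"
      by (simp add: \<kappa>_def algebra_simps)
    moreover have "cmod b * cmod z \<ge> 0" by simp
    ultimately have "1 + cmod (a * z + b) \<le> \<kappa> * (1 + cmod z)"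
      using norm_ge_zero[of z] norm_ge_zero[of a] by linarith
    then have "(1 + cmod (a * z + b)) powr s \<le> (\<kappa> * (1 + cmod z)) powr s"
      using s by (intro powr_mono2) auto
    also have "\<dots> = \<kappa> powr s * (1 + cmod z) powr s" by (rule powr_mult)
    finally have "K * (1 + cmod (a * z + b)) powr s \<le> K * (\<kappa> powr s * (1 + cmod z) powr s)"
      using K(1) by (rule mult_left_mono)
    then show ?thesis using K(2)[of "a * z + b"] by (smt (verit) exp_le_cancel_iff mult.assoc)
  qed
  moreover have "K * \<kappa> powr s \<ge> 0" using K(1) by simp
  ultimately show ?thesis by blast
qed

lemma countable_zeros:
  assumes hol: "f holomorphic_on UNIV" and nz: "\<exists>z. f z \<noteq> (0::complex)"
  shows "countable {z. f z = 0}"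
proof -
  have "{z. f z = 0} = (\<Union>n::nat. {z \<in> cball 0 (real n). f z = 0})"
  proof (intro equalityI subsetI)
    fix z assume "z \<in> {z. f z = 0}"
    moreover obtain n where "cmod z \<le> real n" using real_arch_simple by blast
    ultimately show "z \<in> (\<Union>n::nat. {z \<in> cball 0 (real n). f z = 0})" by auto
  next
    fix z assume "z \<in> (\<Union>n::nat. {z \<in> cball 0 (real n). f z = 0})"
    then show "z \<in> {z. f z = 0}" by blast
  qed
  moreover have "countable (\<Union>n::nat. {z \<in> cball 0 (real n). f z = 0})"
    by (rule countable_UN, simp, rule countable_finite, rule finite_zeros_cball[OF hol nz])
  ultimately show ?thesis by simp
qed

lemma shift_equation_solution:
  assumes hol: "f holomorphic_on UNIV" and f0: "f 0 \<noteq> 0" and sigma: "\<sigma> \<ge> 0"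
    and growth: "\<forall>s>\<sigma>. exp_growth s f"
  shows "\<exists>A B. unit_shift_solution f \<sigma> A B"
proof -
  have nz: "\<exists>z. f z \<noteq> 0" using f0 by blast
  have "isCont f 0" using holomorphic_on_imp_continuous_on[OF hol] by (simp add: continuous_on_eq_continuous_at)
  from continuous_at_avoid[OF this f0] obtain e where e: "e > 0" "\<And>z. dist 0 z < e \<Longrightarrow> f z \<noteq> 0" by blast
  define \<rho> where "\<rho> = min e 1"
  have rho: "0 < \<rho>" "\<rho> \<le> 1" "\<And>z. cmod z < \<rho> \<Longrightarrow> f z \<noteq> 0" using e by (auto simp: \<rho>_def)
  define c where "c = (\<lambda>(N::nat) (j::nat). 2 ^ N * (1 + real j / real (nat \<lceil>2 powr (real N * \<sigma>)\<rceil>)))"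
  \<comment> \<open>The heights \<open>y\<close> for which a zero of \<open>f\<close> and an extra
    pole share an imaginary part form a countable set, which cannot cover [0, 1].\<close>
  define X where "X = (\<lambda>(a, N, j). Im a - c N j) ` ({a. f a = 0} \<times> (UNIV :: nat set) \<times> (UNIV :: nat set))"
  have "countable X" unfolding X_def
    by (intro countable_image countable_SIGMA countable_zeros[OF hol nz]) auto
  moreover have "uncountable {0..1::real}" by (simp add: uncountable_closed_interval)
  ultimately have "\<not> {0..1} \<subseteq> X" using countable_subset by metis
  then obtain y where "y \<in> {0..1}" "y \<notin> X"
    unfolding subset_iff not_all not_imp by (elim exE conjE)
  then have y: "0 \<le> y" "y \<le> 1" "y \<notin> X" by auto
  have gen: "Im a \<noteq> y + c N j" if "f a = 0" for a N j
  proof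
    assume "Im a = y + c N j"
    then have "y = (\<lambda>(a, N, j). Im a - c N j) (a, N, j)" by simp
    then have "y \<in> X" unfolding X_def by (rule image_eqI) (use that in simp)
    with y(3) show False by simp
  qed
  interpret whittaker f \<sigma> \<rho> y
    by standard (use hol f0 sigma growth rho y gen in \<open>auto simp: c_def\<close>)
  show ?thesis by (rule solution)
qed

text \<open>The substitution z/\<open>\<eta>\<close> + t turns the step \<open>\<eta>\<close> into
  1. The translation by t >= 0 lets \<open>f\<close> vanish at 0: t is chosen so that the
  transformed function does not, and \<open>B' 0\<close> is \<open>B t\<close>, nonzero on the
  half-line.\<close>

lemma shift_equation_solution_affine:
  fixes \<eta> :: complex
  assumes eta: "\<eta> \<noteq> 0" and hol: "f holomorphic_on UNIV" and nz: "\<exists>z. f z \<noteq> 0" and sigma: "\<sigma> \<ge> 0"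
    and growth: "\<forall>s>\<sigma>. exp_growth s f"
  shows "\<exists>A B. A holomorphic_on UNIV \<and> B holomorphic_on UNIV \<and>
     (\<forall>z. A (z + \<eta>) * B z = f z * A z * B (z + \<eta>)) \<and>
     (\<forall>\<tau>>\<sigma> + 1. exp_growth \<tau> A) \<and>
     (\<forall>\<tau>>\<sigma> + 1. exp_growth \<tau> B) \<and>
     B 0 \<noteq> 0 \<and>
     (\<exists>D>0. \<forall>N. \<exists>S. finite S \<and> 2 powr (real N * (\<sigma> + 1)) \<le> real (card S) \<and>
        (\<forall>z\<in>S. B z = 0 \<and> A z \<noteq> 0 \<and> cmod z \<le> D * 2 ^ N))"
proof -
  \<comment> \<open>Zeros are countable, while the segment from 0 to -\<open>\<eta>\<close> is
    not.\<close>
  have "\<exists>t\<in>{0..1}. f (- \<eta> * of_real t) \<noteq> 0"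
  proof (rule ccontr)
    assume "\<not> (\<exists>t\<in>{0..1}. f (- \<eta> * of_real t) \<noteq> 0)"
    then have "(\<lambda>t. - \<eta> * of_real t) ` {0..1} \<subseteq> {z. f z = 0}" by (simp add: image_subset_iff)
    then have "countable ((\<lambda>t. - \<eta> * of_real t) ` {0..1::real})"
      using countable_zeros[OF hol nz] countable_subset by blast
    moreover have "inj_on (\<lambda>t. - \<eta> * of_real t) {0..1::real}" using eta by (auto simp: inj_on_def)
    ultimately have "countable {0..1::real}" using countable_image_inj_eq by blast
    then show False using uncountable_closed_interval[of 0 "1::real"] by simp
  qed
  then obtain t where "t \<in> {0..1}" and ft: "f (- \<eta> * of_real t) \<noteq> 0" by (elim bexE)
  then have t: "t \<ge> 0" by simp
  define g where "g = (\<lambda>w. f (\<eta> * w + - \<eta> * of_real t))"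
  have g: "g holomorphic_on UNIV" "g 0 \<noteq> 0"
    unfolding g_def by (intro holomorphic_compose_UNIV[OF hol] holomorphic_intros) (use ft in simp)
  have gg: "\<forall>s>\<sigma>. exp_growth s g"
  proof (intro allI impI)
    fix s assume "s > \<sigma>"
    with growth have "exp_growth s f" by blast
    then show "exp_growth s g"
      unfolding g_def by (rule growth_affine) (use \<open>s > \<sigma>\<close> sigma in auto)
  qed
  from shift_equation_solution[OF g sigma gg]
  obtain A B where AB: "A holomorphic_on UNIV" "B holomorphic_on UNIV"
    and eq1: "\<forall>z. A (z + 1) * B z = g z * A z * B (z + 1)"
    and gA: "\<forall>\<tau>>\<sigma> + 1. exp_growth \<tau> A"
    and gB: "\<forall>\<tau>>\<sigma> + 1. exp_growth \<tau> B"
    and Bt: "\<forall>t::real\<ge>0. B (of_real t) \<noteq> 0"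
    and SS: "\<forall>N. \<exists>S. finite S \<and> 2 powr (real N * (\<sigma> + 1)) \<le> real (card S) \<and>
        (\<forall>z\<in>S. B z = 0 \<and> A z \<noteq> 0 \<and> cmod z \<le> 4 * 2 ^ N)"
    by (elim exE conjE)
  define \<phi> where "\<phi> = (\<lambda>z. 1 / \<eta> * z + of_real t)"
  define A' B' where "A' = (\<lambda>z. A (\<phi> z))" and "B' = (\<lambda>z. B (\<phi> z))"
  have ph: "\<phi> (z + \<eta>) = \<phi> z + 1" "g (\<phi> z) = f z" for z
    using eta by (simp_all add: \<phi>_def g_def field_simps)
  have hol': "A' holomorphic_on UNIV" "B' holomorphic_on UNIV"
    unfolding A'_def B'_def \<phi>_def
    by (intro holomorphic_compose_UNIV[OF AB(1)] holomorphic_compose_UNIV[OF AB(2)] holomorphic_intros)+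
  have eq: "A' (z + \<eta>) * B' z = f z * A' z * B' (z + \<eta>)" for z
    using spec[OF eq1, of "\<phi> z"] by (simp add: A'_def B'_def ph)
  have gA': "exp_growth \<tau> A'" if "\<tau> > \<sigma> + 1" for \<tau>
    unfolding A'_def \<phi>_def using mp[OF spec[OF gA] that] by (rule growth_affine) (use that sigma in auto)
  have gB': "exp_growth \<tau> B'" if "\<tau> > \<sigma> + 1" for \<tau>
    unfolding B'_def \<phi>_def using mp[OF spec[OF gB] that] by (rule growth_affine) (use that sigma in auto)
  have B0: "B' 0 \<noteq> 0" using mp[OF spec[OF Bt] t] by (simp add: B'_def \<phi>_def)
  define D where "D = cmod \<eta> * (4 + t)"
  have "D > 0" using eta t by (simp add: D_def)
  have S': "\<exists>S. finite S \<and> 2 powr (real N * (\<sigma> + 1)) \<le> real (card S) \<and>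
        (\<forall>z\<in>S. B' z = 0 \<and> A' z \<noteq> 0 \<and> cmod z \<le> D * 2 ^ N)" for N
  proof -
    obtain S where S: "finite S" "2 powr (real N * (\<sigma> + 1)) \<le> real (card S)"
      "\<And>z. z \<in> S \<Longrightarrow> B z = 0 \<and> A z \<noteq> 0 \<and> cmod z \<le> 4 * 2 ^ N" using SS by blast
    define \<psi> where "\<psi> = (\<lambda>w. \<eta> * (w - of_real t))"
    have inv: "\<phi> (\<psi> w) = w" for w using eta by (simp add: \<phi>_def \<psi>_def)
    have "card (\<psi> ` S) = card S" by (rule card_image) (metis inj_onI inv)
    moreover have "B' z = 0 \<and> A' z \<noteq> 0 \<and> cmod z \<le> D * 2 ^ N" if z: "z \<in> \<psi> ` S" for z
    proof -
      obtain w where w: "w \<in> S" "z = \<psi> w" using z by blast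
      have "cmod (w - of_real t) \<le> cmod w + cmod (of_real t)" by (rule norm_triangle_ineq4)
      also have "\<dots> \<le> 4 * 2 ^ N + t" using S(3)[OF w(1)] t by simp
      also have "\<dots> \<le> (4 + t) * 2 ^ N"
      proof -
        have "t * 1 \<le> t * 2 ^ N" using t by (intro mult_left_mono) auto
        then show ?thesis by (simp add: distrib_right)
      qed
      finally have "cmod \<eta> * cmod (w - of_real t) \<le> cmod \<eta> * ((4 + t) * 2 ^ N)" by (rule mult_left_mono) simp
      then have "cmod z \<le> D * 2 ^ N" unfolding w(2) \<psi>_def norm_mult D_def by (simp only: mult.assoc)
      then show ?thesis using S(3)[OF w(1)] by (simp add: A'_def B'_def w(2) inv)
    qed
    ultimately show ?thesis using S(1,2) by (intro exI[of _ "\<psi> ` S"]) auto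
  qed
  show ?thesis
    by (rule exI[of _ A'], rule exI[of _ B']) (use hol' eq gA' gB' B0 \<open>D > 0\<close> S' in blast)
qed

section \<open>The characteristic of a quotient of entire functions\<close>

text \<open>Summation and integration are exchanged: a pole at z enters the integrand as 1/t from t
  = |z| on and contributes ln (r / |z|) per unit of multiplicity.\<close>

lemma counting_function_eq:
  assumes fin: "finite {z. is_pole F z \<and> cmod z \<le> r}" and p0: "\<not> is_pole F 0" and r: "r > 0"
  shows "counting_function r F = (\<Sum>z | is_pole F z \<and> cmod z \<le> r. real (nat (- zorder F z)) * ln (r / cmod z))"
proof -
  define P where "P = {z. is_pole F z \<and> cmod z \<le> r}"
  have P0: "0 < cmod z" if "z \<in> P" for z using that p0 by (auto simp: P_def)
  have z0: "pole_count 0 F = 0" unfolding pole_count_def using p0 by (intro sum.neutral) auto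
  have pc: "(real (pole_count t F) - real (pole_count 0 F)) / t
     = (\<Sum>z\<in>P. real (nat (- zorder F z)) * (if cmod z \<le> t then 1 / t else 0))" if "t \<in> {0..r}" for t
  proof -
    have "pole_count t F = (\<Sum>z\<in>{z \<in> P. cmod z \<le> t}. nat (- zorder F z))"
      unfolding pole_count_def P_def using that by (intro sum.cong) auto
    also have "\<dots> = (\<Sum>z\<in>P. if cmod z \<le> t then nat (- zorder F z) else 0)"
      using fin unfolding P_def[symmetric] by (rule sum.inter_filter)
    finally have "real (pole_count t F) / t = (\<Sum>z\<in>P. real (if cmod z \<le> t then nat (- zorder F z) else 0) / t)"
      by (simp add: sum_divide_distrib)
    also have "\<dots> = (\<Sum>z\<in>P. real (nat (- zorder F z)) * (if cmod z \<le> t then 1 / t else 0))"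
      by (intro sum.cong) auto
    finally show ?thesis by (simp only: z0 of_nat_0 diff_zero)
  qed
  have one: "((\<lambda>t. if a \<le> t then 1 / t else 0) has_integral ln (r / a)) {0..r}" if a: "0 < a" "a \<le> r" for a
  proof -
    have "((\<lambda>t. 1 / t) has_integral (ln r - ln a)) {a..r}"
    proof (rule fundamental_theorem_of_calculus[OF a(2)])
      fix x assume "x \<in> {a..r}"
      then have "(ln has_real_derivative 1 / x) (at x within {a..r})"
        using a by (intro has_field_derivative_at_within[OF DERIV_ln_divide]) simp
      then show "(ln has_vector_derivative 1 / x) (at x within {a..r})"
        by (simp only: has_real_derivative_iff_has_vector_derivative)
    qed
    then have "((\<lambda>t. if t \<in> {a..r} then 1 / t else 0) has_integral (ln r - ln a)) {0..r}"
      using a by (subst has_integral_restrict) auto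
    then have "((\<lambda>t. if a \<le> t then 1 / t else 0) has_integral (ln r - ln a)) {0..r}"
      by (rule has_integral_eq[rotated]) auto
    then show ?thesis using a by (simp add: ln_div)
  qed
  have "((\<lambda>t. \<Sum>z\<in>P. real (nat (- zorder F z)) * (if cmod z \<le> t then 1 / t else 0))
     has_integral (\<Sum>z\<in>P. real (nat (- zorder F z)) * ln (r / cmod z))) {0..r}"
    using fin P0 unfolding P_def[symmetric]
    by (intro has_integral_sum has_integral_mult_right one) (auto simp: P_def)
  then have "((\<lambda>t. (real (pole_count t F) - real (pole_count 0 F)) / t)
     has_integral (\<Sum>z\<in>P. real (nat (- zorder F z)) * ln (r / cmod z))) {0..r}"
    by (rule has_integral_eq[rotated]) (simp only: pc)
  then have "integral {0..r} (\<lambda>t. (real (pole_count t F) - real (pole_count 0 F)) / t)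
     = (\<Sum>z\<in>P. real (nat (- zorder F z)) * ln (r / cmod z))" by (rule integral_unique)
  then show ?thesis unfolding counting_function_def P_def[symmetric] by (simp add: z0)
qed

lemma proximity_nonneg: "proximity_function r g \<ge> 0"
proof -
  have "integral {0..2*pi} (\<lambda>t. log_plus (cmod (g (circ r t)))) \<ge> 0"
    by (cases "(\<lambda>t. log_plus (cmod (g (circ r t)))) integrable_on {0..2*pi}")
       (auto simp: not_integrable_integral intro: integral_nonneg)
  then show ?thesis by (simp add: proximity_function_def)
qed

lemma tendsto_log_plus:
  assumes "(f \<longlongrightarrow> l) F"
  shows "((\<lambda>x. log_plus (f x)) \<longlongrightarrow> log_plus l) F"
  unfolding log_plus_def by (intro tendsto_ln tendsto_max tendsto_const assms) auto

locale entire_quotient =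
  fixes A B :: "complex \<Rightarrow> complex"
  assumes holA: "A holomorphic_on UNIV" and holB: "B holomorphic_on UNIV"
    and Anz: "\<exists>z. A z \<noteq> 0" and B0: "B 0 \<noteq> 0"
begin

text \<open>\<open>A\<close> and \<open>B\<close> may have common zeros; \<open>remove_sings\<close>
  fills in the removable singularities and gives the value 0 at poles, as being nicely meromorphic
  demands.\<close>

definition F where "F = remove_sings (\<lambda>z. A z / B z)"

lemma Bnz: "\<exists>z. B z \<noteq> 0" using B0 by blast

lemma ana: "A analytic_on S" "B analytic_on S"
  using holA holB analytic_on_open[OF open_UNIV] analytic_on_subset by blast+

lemma mero0: "(\<lambda>z. A z / B z) meromorphic_on S"
  by (intro meromorphic_on_divide analytic_on_imp_meromorphic_on ana)

lemma nice: "F nicely_meromorphic_on UNIV"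
  unfolding F_def by (rule remove_sings_nicely_meromorphic[OF mero0])

lemma F_eq: "B z \<noteq> 0 \<Longrightarrow> F z = A z / B z"
  unfolding F_def by (intro remove_sings_at_analytic analytic_on_divide ana) auto

lemma iso: "isolated_singularity_at (\<lambda>z. A z / B z) z"
  by (rule meromorphic_on_isolated_singularity[OF mero0])

lemma pole_iff: "is_pole F z \<longleftrightarrow> is_pole (\<lambda>z. A z / B z) z" and zorder_F: "zorder F z = zorder (\<lambda>z. A z / B z) z"
  unfolding F_def using iso by simp_all

lemma ev_nz: "eventually (\<lambda>w. A w \<noteq> 0) (at z)" "eventually (\<lambda>w. B w \<noteq> 0) (at z)"
proof -
  obtain a where "A a \<noteq> 0" using Anz by blast
  then have "eventually (\<lambda>w. A w \<noteq> 0 \<and> w \<in> UNIV) (at z)"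
    by (intro non_zero_neighbour_alt[OF holA open_UNIV connected_UNIV]) auto
  then show "eventually (\<lambda>w. A w \<noteq> 0) (at z)" by simp
  have "eventually (\<lambda>w. B w \<noteq> 0 \<and> w \<in> UNIV) (at z)"
    by (rule non_zero_neighbour_alt[OF holB open_UNIV connected_UNIV UNIV_I UNIV_I B0])
  then show "eventually (\<lambda>w. B w \<noteq> 0) (at z)" by simp
qed

lemma pole_imp: "is_pole F z \<Longrightarrow> B z = 0"
proof (rule ccontr)
  assume "is_pole F z" "B z \<noteq> 0"
  then have "(\<lambda>z. A z / B z) analytic_on {z}" by (intro analytic_on_divide ana) auto
  then have "\<not> is_pole (\<lambda>z. A z / B z) z" by (rule analytic_at_imp_no_pole)
  with \<open>is_pole F z\<close> show False by (simp add: pole_iff)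
qed

lemma pole_if: "B z = 0 \<Longrightarrow> A z \<noteq> 0 \<Longrightarrow> is_pole F z"
  unfolding pole_iff
proof (rule is_pole_divide)
  show "isCont A z" using analytic_at_imp_isCont ana(1) by blast
  have "isCont B z" using analytic_at_imp_isCont ana(2) by blast
  moreover assume "B z = 0"
  ultimately have "B \<midarrow>z\<rightarrow> 0" by (simp add: isCont_def)
  then show "filterlim B (at 0) (at z)" using ev_nz(2) by (intro filterlim_atI)
qed

text \<open>Zeros of \<open>A\<close> can only lower the order of a pole; the inequality suffices
  for an upper bound of the counting function.\<close>

lemma pole_mult: "nat (- zorder F z) \<le> zmult B z"
proof -
  have fA: "frequently (\<lambda>w. A w \<noteq> 0) (at z)" and fB: "frequently (\<lambda>w. B w \<noteq> 0) (at z)"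
    by (rule eventually_frequently[OF at_neq_bot ev_nz(1)], rule eventually_frequently[OF at_neq_bot ev_nz(2)])
  have "zorder F z = zorder A z - zorder B z"
    unfolding zorder_F by (intro zorder_divide analytic_on_imp_meromorphic_on ana fA fB)
  moreover have "zorder A z \<ge> 0" by (rule zorder_ge_0[OF ana(1) fA])
  ultimately show ?thesis by (simp add: zmult_def)
qed

lemma pole_mult_pos: "is_pole F z \<Longrightarrow> 1 \<le> nat (- zorder F z)"
proof -
  assume p: "is_pole F z"
  have "isolated_singularity_at F z" unfolding F_def using iso by simp
  then have "zorder F z < 0" using p by (rule isolated_pole_imp_neg_zorder)
  then show ?thesis by simp
qed

lemma finite_poles: "finite {z. is_pole F z \<and> cmod z \<le> r}"
  by (rule finite_subset[OF _ finite_zeros_cball[OF holB Bnz, of r]]) (use pole_imp in auto)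

lemma no_pole_0: "\<not> is_pole F 0" using pole_imp B0 by blast

lemma counting_nonneg_terms: "z \<in> {z. is_pole F z \<and> cmod z \<le> r} \<Longrightarrow> 0 < cmod z \<and> 0 \<le> ln (r / cmod z)"
proof -
  assume z: "z \<in> {z. is_pole F z \<and> cmod z \<le> r}"
  then have "0 < cmod z" using no_pole_0 by auto
  then show ?thesis using z by (auto intro!: ln_ge_zero simp: field_simps)
qed

text \<open>Seen from radius 2r, each pole in |z| <= r contributes at least ln 2 to the counting
  function, and the proximity function is nonnegative.\<close>

lemma counting_lower:
  assumes S: "\<And>z. z \<in> S \<Longrightarrow> B z = 0 \<and> A z \<noteq> 0 \<and> cmod z \<le> r" and r: "r > 0"
  shows "ln 2 * real (card S) \<le> nevanlinna_characteristic (2 * r) F"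
proof -
  have sub: "S \<subseteq> {z. is_pole F z \<and> cmod z \<le> 2 * r}" using S r pole_if by force
  have "ln 2 * real (card S) = (\<Sum>z\<in>S. 1 * ln 2)" by simp
  also have "\<dots> \<le> (\<Sum>z\<in>S. real (nat (- zorder F z)) * ln (2 * r / cmod z))"
  proof (intro sum_mono mult_mono)
    fix z assume z: "z \<in> S"
    have pole: "is_pole F z" using z S pole_if by blast
    show "1 \<le> real (nat (- zorder F z))" using pole_mult_pos[OF pole] by linarith
    have "0 < cmod z" using pole no_pole_0 by auto
    then have "2 \<le> 2 * r / cmod z" using S[OF z] by (simp add: field_simps)
    then show "ln 2 \<le> ln (2 * r / cmod z)" by (subst ln_le_cancel_iff) auto
  qed auto
  also have "\<dots> \<le> (\<Sum>z | is_pole F z \<and> cmod z \<le> 2 * r. real (nat (- zorder F z)) * ln (2 * r / cmod z))"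
    using counting_nonneg_terms[of _ "2 * r"] by (intro sum_mono2 finite_poles sub) auto
  also have "\<dots> = counting_function (2 * r) F"
    using counting_function_eq[OF finite_poles no_pole_0, of "2 * r"] r by simp
  finally show ?thesis using proximity_nonneg[of "2 * r" F] by (simp add: nevanlinna_characteristic_def)
qed

definition NB where "NB r = zero_log_sum B r"

lemma finB: "finite {a. B a = 0 \<and> cmod a < r}"
  by (rule finite_subset[OF _ finite_zeros_cball[OF holB Bnz, of r]]) auto

lemma counting_le_NB: "r > 0 \<Longrightarrow> counting_function r F \<le> NB r"
proof -
  assume r: "r > 0"
  have pos: "0 < cmod a" if "B a = 0" for a using that B0 by auto
  have "counting_function r F = (\<Sum>z | is_pole F z \<and> cmod z \<le> r. real (nat (- zorder F z)) * ln (r / cmod z))"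
    by (rule counting_function_eq[OF finite_poles no_pole_0 r])
  also have "\<dots> \<le> (\<Sum>z | is_pole F z \<and> cmod z \<le> r. real (zmult B z) * ln (r / cmod z))"
    by (intro sum_mono mult_right_mono of_nat_mono pole_mult) (use counting_nonneg_terms in blast)
  \<comment> \<open>Poles on the circle itself carry the weight ln 1 = 0, which reconciles the
    closed disc of the counting function with the open disc of \<open>NB\<close>.\<close>
  also have "\<dots> = (\<Sum>z | is_pole F z \<and> cmod z < r. real (zmult B z) * ln (r / cmod z))"
  proof (rule sum.mono_neutral_right[OF finite_poles])
    show "\<forall>z\<in>{z. is_pole F z \<and> cmod z \<le> r} - {z. is_pole F z \<and> cmod z < r}. real (zmult B z) * ln (r / cmod z) = 0"
    proof
      fix z assume "z \<in> {z. is_pole F z \<and> cmod z \<le> r} - {z. is_pole F z \<and> cmod z < r}"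
      then have "cmod z = r" by auto
      then show "real (zmult B z) * ln (r / cmod z) = 0" using r by simp
    qed
  qed auto
  also have "\<dots> \<le> NB r" unfolding NB_def
  proof (rule sum_mono2[OF finB])
    show "{z. is_pole F z \<and> cmod z < r} \<subseteq> {a. B a = 0 \<and> cmod a < r}" using pole_imp by blast
    fix a assume "a \<in> {a. B a = 0 \<and> cmod a < r} - {z. is_pole F z \<and> cmod z < r}"
    then have "0 < cmod a" "cmod a < r" using pos by blast+
    then have "1 \<le> r / cmod a" by simp
    then show "0 \<le> real (zmult B a) * ln (r / cmod a)" by (intro mult_nonneg_nonneg ln_ge_zero) auto
  qed
  finally show ?thesis .
qed

lemma proximity_F_good:
  assumes r: "r > 0" and circ: "\<And>z. cmod z = r \<Longrightarrow> B z \<noteq> 0"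
  shows "proximity_function r F + NB r \<le> proximity_function r A + proximity_function r B - ln (cmod (B 0))"
proof -
  have "F (circ r t) = A (circ r t) / B (circ r t)" for t
    using r by (intro F_eq circ) (simp add: norm_mult)
  then have "proximity_function r F = proximity_function r (\<lambda>z. A z / B z)"
    by (simp add: proximity_function_def)
  then show ?thesis
    using proximity_quotient_le[OF holB B0 r circ holA] unfolding NB_def by simp
qed

lemma isCont_F: "\<not> is_pole F z \<Longrightarrow> isCont F z"
  using nicely_meromorphic_on_imp_analytic_at[OF nice] analytic_at_imp_isCont by blast

lemma F_pole_eq: "is_pole F z \<Longrightarrow> F z = 0"
  unfolding pole_iff unfolding F_def by (rule remove_sings_at_pole)

text \<open>Circles carrying zeros of \<^term>\<open>B\<close> are approximated from inside by zero-free ones, and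
  Fatou's lemma is applied; the convention \<^prop>\<open>F z = 0\<close> at poles makes the limit inequality hold
  at every point of the circle.\<close>
lemma characteristic_upper:
  assumes r: "r > 0" and mono: "\<And>s. 0 < s \<Longrightarrow> s \<le> r \<Longrightarrow> proximity_function s A + proximity_function s B - ln (cmod (B 0)) \<le> M"
  shows "nevanlinna_characteristic r F \<le> M"
proof -
  \<comment> \<open>The 2 keeps the lower bound positive already for n = 0.\<close>
  have "\<exists>s. r * (1 - 1 / (real n + 2)) < s \<and> s < r \<and> (\<forall>z. cmod z = s \<longrightarrow> B z \<noteq> 0)" for n
  proof -
    have "r * (1 - 1 / (real n + 2)) < r * 1" using r by (intro mult_strict_left_mono) auto
    then have "r * (1 - 1 / (real n + 2)) < r" by simp
    from zero_free_circle[OF holB Bnz this] show ?thesis by metis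
  qed
  then obtain s where s: "\<And>n. r * (1 - 1 / (real n + 2)) < s n" "\<And>n. s n < r" "\<And>n z. cmod z = s n \<Longrightarrow> B z \<noteq> 0"
    by metis
  have s0: "s n > 0" for n
  proof -
    have "r * (1 - 1 / (real n + 2)) \<ge> 0" using r by (intro mult_nonneg_nonneg) auto
    then show ?thesis using s(1)[of n] by linarith
  qed
  have slim: "s \<longlonglongrightarrow> r"
  proof (rule tendsto_sandwich)
    show "(\<lambda>n. r * (1 - 1 / (real n + 2))) \<longlonglongrightarrow> r" by real_asymp
    show "(\<lambda>n. r) \<longlonglongrightarrow> r" by (rule tendsto_const)
  qed (use s in \<open>auto intro: less_imp_le always_eventually\<close>)
  define Z where "Z = {a. B a = 0 \<and> cmod a < r}"
  have a0: "cmod a > 0" if "B a = 0" for a using that B0 by auto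
  have "finite Z" unfolding Z_def by (rule finB)
  \<comment> \<open>Eventually the smaller circles enclose all zeros of modulus below r, so
    \<open>NB (s n)\<close> is a sum over the fixed finite set \<open>Z\<close> and its limit may be
    taken termwise.\<close>
  have "eventually (\<lambda>n. \<forall>a\<in>Z. cmod a < s n) sequentially"
    by (rule eventually_ball_finite[OF \<open>finite Z\<close>]) (use order_tendstoD(1)[OF slim] in \<open>auto simp: Z_def\<close>)
  then have evN: "eventually (\<lambda>n. (\<Sum>a\<in>Z. real (zmult B a) * ln (s n / cmod a)) = NB (s n)) sequentially"
  proof eventually_elim
    case (elim n)
    then have "{a. B a = 0 \<and> cmod a < s n} = Z" using s(2)[of n] by (auto simp: Z_def)
    then show ?case by (simp add: NB_def)
  qed
  have "(\<lambda>n. \<Sum>a\<in>Z. real (zmult B a) * ln (s n / cmod a)) \<longlonglongrightarrow> (\<Sum>a\<in>Z. real (zmult B a) * ln (r / cmod a))"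
    by (intro tendsto_intros slim) (use a0 r in \<open>auto simp: Z_def\<close>)
  then have Nlim: "(\<lambda>n. NB (s n)) \<longlonglongrightarrow> NB r"
    using evN unfolding NB_def[of r] Z_def[symmetric] by (rule Lim_transform_eventually)
  have prox: "proximity_function (s n) F \<le> M - NB (s n)" for n
    using proximity_F_good[OF s0[of n] s(3)[of _ n]] mono[OF s0, of n] s(2)[of n] by linarith
  define u where "u = (\<lambda>n t. log_plus (cmod (F (circ (s n) t))))"
  define v where "v = (\<lambda>t. log_plus (cmod (F (circ r t))))"
  have cu: "continuous_on {0..2*pi} (u n)" for n
    unfolding u_def
  proof (intro continuous_intros continuous_at_imp_continuous_on ballI)
    fix t
    have "B (circ (s n) t) \<noteq> 0" using s0[of n] by (intro s(3)[of _ n]) (simp add: norm_mult)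
    then have "isCont F (circ (s n) t)" using pole_imp isCont_F by blast
    moreover have "isCont cis t"
      using continuous_on_cis[OF continuous_on_id, of UNIV] by (simp add: continuous_on_eq_continuous_at)
    then have "isCont (\<lambda>t. circ (s n) t) t" by (intro continuous_intros)
    ultimately show "isCont (\<lambda>t. F (circ (s n) t)) t"
      by (rule isCont_o2[rotated])
  qed
  have Iu: "(u n has_integral (2 * pi * proximity_function (s n) F)) {0..2*pi}" for n
    using integrable_integral[OF integrable_continuous_interval[OF cu[of n]]]
    by (simp add: proximity_function_def u_def)
  have nnu: "(\<integral>\<^sup>+ t. ennreal (u n t) * indicator {0..2*pi} t \<partial>lborel) = ennreal (2 * pi * proximity_function (s n) F)" for n
    by (rule nn_integral_has_integral_lebesgue'[OF _ Iu]) (simp add: u_def)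
  have meas: "(\<lambda>t. ennreal (u n t) * indicator {0..2*pi} t) \<in> borel_measurable lborel" for n
  proof -
    have "(\<lambda>t. indicator {0..2*pi} t *\<^sub>R u n t) \<in> borel_measurable borel"
      by (rule borel_measurable_continuous_on_indicator[OF _ cu]) simp
    then have "(\<lambda>t. ennreal (indicator {0..2*pi} t *\<^sub>R u n t)) \<in> borel_measurable lborel"
      by simp
    also have "(\<lambda>t. ennreal (indicator {0..2*pi} t *\<^sub>R u n t)) = (\<lambda>t. ennreal (u n t) * indicator {0..2*pi} t)"
      by (auto simp: indicator_def)
    finally show ?thesis .
  qed
  have vle: "ennreal (v t) \<le> liminf (\<lambda>n. ennreal (u n t))" for t
  proof (cases "is_pole F (circ r t)")
    case True
    then have "v t = 0" by (simp add: v_def F_pole_eq log_plus_def)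
    then show ?thesis by simp
  next
    case False
    have "(\<lambda>n. circ (s n) t) \<longlonglongrightarrow> circ r t" by (intro tendsto_intros slim)
    then have "(\<lambda>n. F (circ (s n) t)) \<longlonglongrightarrow> F (circ r t)"
      using isCont_F[OF False] isCont_tendsto_compose by blast
    then have "(\<lambda>n. cmod (F (circ (s n) t))) \<longlonglongrightarrow> cmod (F (circ r t))" by (rule tendsto_norm)
    then have "(\<lambda>n. u n t) \<longlonglongrightarrow> v t"
      unfolding u_def v_def by (rule tendsto_log_plus)
    then have "(\<lambda>n. ennreal (u n t)) \<longlonglongrightarrow> ennreal (v t)" by (rule tendsto_ennrealI)
    then have "liminf (\<lambda>n. ennreal (u n t)) = ennreal (v t)" by (intro lim_imp_Liminf) auto
    then show ?thesis by simp
  qed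
  have "proximity_function r F \<le> M - NB r"
  proof (cases "v integrable_on {0..2*pi}")
    case True
    then have Iv: "(v has_integral (2 * pi * proximity_function r F)) {0..2*pi}"
      using integrable_integral[OF True] by (simp add: proximity_function_def v_def)
    have "ennreal (2 * pi * proximity_function r F) = (\<integral>\<^sup>+ t. ennreal (v t) * indicator {0..2*pi} t \<partial>lborel)"
      by (rule nn_integral_has_integral_lebesgue'[OF _ Iv, symmetric]) (simp add: v_def)
    also have "\<dots> \<le> (\<integral>\<^sup>+ t. liminf (\<lambda>n. ennreal (u n t) * indicator {0..2*pi} t) \<partial>lborel)"
      by (rule nn_integral_mono) (use vle in \<open>auto simp: indicator_def\<close>)
    also have "\<dots> \<le> liminf (\<lambda>n. \<integral>\<^sup>+ t. ennreal (u n t) * indicator {0..2*pi} t \<partial>lborel)"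
      by (rule nn_integral_liminf[OF meas])
    also have "\<dots> = liminf (\<lambda>n. ennreal (2 * pi * proximity_function (s n) F))" by (simp only: nnu)
    also have "\<dots> \<le> liminf (\<lambda>n. ennreal (2 * pi * (M - NB (s n))))"
      by (intro Liminf_mono always_eventually allI ennreal_leI mult_left_mono prox) auto
    also have "\<dots> = ennreal (2 * pi * (M - NB r))"
      by (intro lim_imp_Liminf tendsto_ennrealI tendsto_intros Nlim) auto
    finally have le: "ennreal (2 * pi * proximity_function r F) \<le> ennreal (2 * pi * (M - NB r))" .
    \<comment> \<open>\<open>ennreal\<close> truncates negative numbers, so the inequality returns
      to the reals only for a nonnegative right side; it is a limit of bounds for proximity
      functions.\<close>
    have "0 \<le> M - NB r"
    proof (rule LIMSEQ_le_const[OF tendsto_diff[OF tendsto_const Nlim]])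
      show "\<exists>N. \<forall>n\<ge>N. 0 \<le> M - NB (s n)" using prox proximity_nonneg order_trans by blast
    qed
    then have "0 \<le> 2 * pi * (M - NB r)" by simp
    with le have "2 * pi * proximity_function r F \<le> 2 * pi * (M - NB r)" by (subst (asm) ennreal_le_iff)
    then show ?thesis by (subst (asm) mult_le_cancel_left_pos) auto
  next
    \<comment> \<open>Here the integral has its default value 0, and the sign of M - NB r is all
      that is left to check.\<close>
    case False
    then have "proximity_function r F = 0"
      by (simp add: proximity_function_def not_integrable_integral v_def[symmetric])
    moreover have "0 \<le> M - NB r"
    proof (rule LIMSEQ_le_const[OF tendsto_diff[OF tendsto_const Nlim]])
      show "\<exists>N. \<forall>n\<ge>N. 0 \<le> M - NB (s n)" using prox proximity_nonneg order_trans by blast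
    qed
    ultimately show ?thesis by simp
  qed
  then show ?thesis using counting_le_NB[OF r] by (simp add: nevanlinna_characteristic_def)
qed

lemma order_le:
  assumes gA: "exp_growth s A"
    and gB: "exp_growth s B"
    and s: "0 \<le> s" "s < \<tau>"
  shows "order_of_growth F \<le> ereal \<tau>"
proof -
  obtain KA KB where K: "KA \<ge> 0" "KB \<ge> 0" "\<And>z. cmod (A z) \<le> exp (KA * (1 + cmod z) powr s)"
    "\<And>z. cmod (B z) \<le> exp (KB * (1 + cmod z) powr s)" using gA gB by blast
  define c where "c = \<bar>ln (cmod (B 0))\<bar>"
  define K where "K = (KA + KB) * 2 powr s + c"
  have T: "nevanlinna_characteristic r F \<le> K * r powr s" if r: "r \<ge> 1" for r
  proof (rule characteristic_upper)
    fix x :: real assume x: "0 < x" "x \<le> r"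
    have "1 + x \<le> 2 * r" using x r by simp
    then have "(1 + x) powr s \<le> (2 * r) powr s" using x s by (intro powr_mono2) auto
    then have le: "(1 + x) powr s \<le> 2 powr s * r powr s" by (simp only: powr_mult)
    have "proximity_function x A \<le> KA * (1 + x) powr s"
      by (rule proximity_le) (use K x in auto)
    also have "\<dots> \<le> KA * (2 powr s * r powr s)" using le K(1) by (rule mult_left_mono)
    finally have 1: "proximity_function x A \<le> KA * (2 powr s * r powr s)" .
    have "proximity_function x B \<le> KB * (1 + x) powr s"
      by (rule proximity_le) (use K x in auto)
    also have "\<dots> \<le> KB * (2 powr s * r powr s)" using le K(2) by (rule mult_left_mono)
    finally have 2: "proximity_function x B \<le> KB * (2 powr s * r powr s)" .
    have "c * 1 \<le> c * r powr s" using r s by (intro mult_left_mono ge_one_powr_ge_zero) (auto simp: c_def)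
    then have 3: "- ln (cmod (B 0)) \<le> c * r powr s" unfolding c_def by linarith
    have "K * r powr s = KA * (2 powr s * r powr s) + KB * (2 powr s * r powr s) + c * r powr s"
      by (simp add: K_def algebra_simps)
    then show "proximity_function x A + proximity_function x B - ln (cmod (B 0)) \<le> K * r powr s"
      using 1 2 3 by linarith
  qed (use r in auto)
  have "filterlim (\<lambda>r::real. r powr (\<tau> - s)) at_top at_top"
    using s by real_asymp
  then have "eventually (\<lambda>r. K \<le> r powr (\<tau> - s)) at_top" by (simp add: filterlim_at_top)
  then have "eventually (\<lambda>r. ereal (log_plus (nevanlinna_characteristic r F) / ln r) \<le> ereal \<tau>) at_top"
    using eventually_gt_at_top[of 1]
  proof eventually_elim
    case (elim r)
    have "K * r powr s \<le> r powr (\<tau> - s) * r powr s" using elim by (intro mult_right_mono) auto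
    also have "\<dots> = r powr \<tau>" by (simp flip: powr_add)
    also have "\<dots> = exp (\<tau> * ln r)" using elim by (simp add: powr_def)
    finally have "nevanlinna_characteristic r F \<le> exp (\<tau> * ln r)" using T[of r] elim by simp
    then have "log_plus (nevanlinna_characteristic r F) \<le> log_plus (exp (\<tau> * ln r))" by (rule log_plus_mono)
    also have "\<dots> = \<tau> * ln r" using elim s by (simp add: log_plus_exp)
    finally show ?case using elim by (simp add: field_simps)
  qed
  then show ?thesis unfolding order_of_growth_def by (rule Limsup_bounded)
qed

text \<open>A smaller order would give T(r) <= r^s with s < \<open>\<tau>\<close> for all large r,
  contradicted at the radii 2 D 2^N, where the poles in \<open>S\<close> force T to be at least ln 2
  * 2^(N \<open>\<tau>\<close>).\<close>

lemma order_ge: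
  assumes D: "D > 0"
    and S: "\<And>N. \<exists>S. finite S \<and> 2 powr (real N * \<tau>) \<le> real (card S) \<and>
        (\<forall>z\<in>S. B z = 0 \<and> A z \<noteq> 0 \<and> cmod z \<le> D * 2 ^ N)"
  shows "ereal \<tau> \<le> order_of_growth F"
proof (rule ccontr)
  assume "\<not> ereal \<tau> \<le> order_of_growth F"
  then have "order_of_growth F < ereal \<tau>" by simp
  then obtain s where s: "order_of_growth F < ereal s" "s < \<tau>"
    using ereal_dense2 by (metis ereal_less_eq(3) less_ereal.simps(1) not_le)
  obtain r0 where r0: "\<And>r. r \<ge> r0 \<Longrightarrow> nevanlinna_characteristic r F \<le> r powr s"
    using eventually_characteristic_le[OF s(1)] by (auto simp: eventually_at_top_linorder)
  have "filterlim (\<lambda>N. ln 2 * 2 powr (real N * (\<tau> - s))) at_top sequentially"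
    using s by real_asymp
  then have "eventually (\<lambda>N. (2 * D) powr s < ln 2 * 2 powr (real N * (\<tau> - s))) sequentially"
    by (simp add: filterlim_at_top_dense)
  moreover have "filterlim (\<lambda>N. 2 * D * 2 ^ N) at_top sequentially" using D by real_asymp
  then have "eventually (\<lambda>N. r0 \<le> 2 * D * 2 ^ N) sequentially" by (simp add: filterlim_at_top)
  ultimately have "eventually (\<lambda>N. (2 * D) powr s < ln 2 * 2 powr (real N * (\<tau> - s)) \<and> r0 \<le> 2 * D * 2 ^ N) sequentially"
    by (rule eventually_conj)
  then obtain N where N: "(2 * D) powr s < ln 2 * 2 powr (real N * (\<tau> - s))" "r0 \<le> 2 * D * 2 ^ N"
    using eventually_happens'[OF sequentially_bot] by blast
  obtain S where S: "2 powr (real N * \<tau>) \<le> real (card S)" "\<And>z. z \<in> S \<Longrightarrow> B z = 0 \<and> A z \<noteq> 0 \<and> cmod z \<le> D * 2 ^ N"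
    using S[of N] by blast
  have "ln 2 * 2 powr (real N * \<tau>) \<le> ln 2 * real (card S)" using S(1) by (intro mult_left_mono) auto
  also have "\<dots> \<le> nevanlinna_characteristic (2 * (D * 2 ^ N)) F"
    by (rule counting_lower[OF S(2)]) (use D in auto)
  also have "\<dots> \<le> (2 * (D * 2 ^ N)) powr s" by (rule r0) (use N(2) in \<open>simp add: mult.assoc\<close>)
  also have "\<dots> = (2 * D) powr s * 2 powr (real N * s)"
    unfolding two_power_eq_powr by (simp only: powr_powr powr_mult mult.assoc[symmetric])
  also have "\<dots> < (ln 2 * 2 powr (real N * (\<tau> - s))) * 2 powr (real N * s)"
    using N(1) by (intro mult_strict_right_mono) auto
  also have "\<dots> = ln 2 * 2 powr (real N * \<tau>)"
    by (simp add: mult.assoc right_diff_distrib flip: powr_add)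
  finally show False by simp
qed

text \<open>Where the denominators do not vanish this is the equation for \<open>A\<close> and
  \<open>B\<close>. Those points fill a punctured neighbourhood of z, and both sides are continuous
  at z by \<open>np\<close>, which settles points with removable singularities.\<close>

lemma shift_equation_F:
  assumes eq: "\<And>z. A (z + \<eta>) * B z = f z * A z * B (z + \<eta>)" and holf: "f holomorphic_on UNIV"
    and np: "\<not> is_pole F z" "\<not> is_pole F (z + \<eta>)"
  shows "F (z + \<eta>) = f z * F z"
proof -
  define d where "d = (\<lambda>w. F (w + \<eta>) - f w * F w)"
  have "isCont (\<lambda>w. F (w + \<eta>)) z"
    by (rule isCont_o2[where g=F]) (use isCont_F[OF np(2)] in auto)
  moreover have "isCont f z" using holomorphic_on_imp_continuous_on[OF holf] by (simp add: continuous_on_eq_continuous_at)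
  ultimately have "isCont d z" unfolding d_def by (intro continuous_intros isCont_F[OF np(1)])
  then have 1: "(d \<longlongrightarrow> d z) (at z)" by (simp add: isCont_def)
  have "(\<lambda>w. B (w + \<eta>)) holomorphic_on UNIV" by (intro holomorphic_compose_UNIV[OF holB] holomorphic_intros)
  then have "eventually (\<lambda>w. B (w + \<eta>) \<noteq> 0 \<and> w \<in> UNIV) (at z)"
    by (rule non_zero_neighbour_alt[OF _ open_UNIV connected_UNIV UNIV_I UNIV_I, of _ "- \<eta>"]) (simp add: B0)
  then have "eventually (\<lambda>w. d w = 0) (at z)" using ev_nz(2)[of z]
  proof eventually_elim
    case (elim w)
    then show ?case using eq[of w] by (simp add: d_def F_eq field_simps)
  qed
  then have 2: "(d \<longlongrightarrow> 0) (at z)" by (rule tendsto_eventually)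
  have "d z = 0" by (rule tendsto_unique[OF at_neq_bot 1 2])
  then show ?thesis by (simp add: d_def)
qed

end

theorem corollary9p3:
  fixes \<eta> :: complex and \<sigma> :: real and \<Psi> :: "complex \<Rightarrow> complex"
  assumes "\<eta> \<noteq> 0"
    and "\<Psi> holomorphic_on UNIV"
    and "\<exists>z. \<Psi> z \<noteq> 0"
    and "order_of_growth \<Psi> = ereal \<sigma>"
  shows "\<exists>F. F nicely_meromorphic_on UNIV
           \<and> (\<forall>z. \<not> is_pole F z \<and> \<not> is_pole F (z + \<eta>) \<longrightarrow> F (z + \<eta>) = \<Psi> z * F z)
           \<and> order_of_growth F = ereal (\<sigma> + 1)"
proof -
  have sigma: "\<sigma> \<ge> 0" using order_of_growth_nonneg[of \<Psi>] assms(4) by simp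
  have "\<forall>s>\<sigma>. exp_growth s (\<lambda>z. \<Psi> z)"
    using entire_order_imp_growth[OF assms(2,3)] assms(4) by simp
  from shift_equation_solution_affine[OF assms(1-3) sigma this]
  obtain A B D where holAB: "A holomorphic_on UNIV" "B holomorphic_on UNIV"
    and eq: "\<forall>z. A (z + \<eta>) * B z = \<Psi> z * A z * B (z + \<eta>)"
    and gA: "\<forall>\<tau>>\<sigma> + 1. exp_growth \<tau> A"
    and gB: "\<forall>\<tau>>\<sigma> + 1. exp_growth \<tau> B"
    and B0: "B 0 \<noteq> 0" and D: "D > 0"
    and S: "\<forall>N. \<exists>S. finite S \<and> 2 powr (real N * (\<sigma> + 1)) \<le> real (card S) \<and>
        (\<forall>z\<in>S. B z = 0 \<and> A z \<noteq> 0 \<and> cmod z \<le> D * 2 ^ N)"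
    by (elim exE conjE)
  \<comment> \<open>The pole supply for N = 0 already has at least one point, and \<open>A\<close>
    does not vanish there.\<close>
  have "\<exists>z. A z \<noteq> 0"
  proof -
    obtain S where "2 powr (real 0 * (\<sigma> + 1)) \<le> real (card S)" "\<forall>z\<in>S. A z \<noteq> 0" using S by blast
    then show ?thesis by (cases "S = {}") auto
  qed
  with holAB B0 interpret entire_quotient A B by unfold_locales
  have "order_of_growth F \<le> ereal (\<sigma> + 1)"
  proof (rule ereal_le_epsilon2)
    fix e :: real assume "e > 0"
    \<comment> \<open>Growth is known only for exponents above \<open>\<sigma> + 1\<close>, and
      \<open>order_le\<close> loses a little more; e/2 is spent on each.\<close>
    have "order_of_growth F \<le> ereal (\<sigma> + 1 + e)"
      by (rule order_le[of "\<sigma> + 1 + e / 2"]) (use gA gB \<open>e > 0\<close> sigma in auto)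
    then show "order_of_growth F \<le> ereal (\<sigma> + 1) + ereal e" by simp
  qed
  moreover have "ereal (\<sigma> + 1) \<le> order_of_growth F" by (rule order_ge[OF D]) (use S in blast)
  ultimately have "order_of_growth F = ereal (\<sigma> + 1)" by (rule antisym)
  moreover have "F (z + \<eta>) = \<Psi> z * F z" if "\<not> is_pole F z" "\<not> is_pole F (z + \<eta>)" for z
    by (rule shift_equation_F[OF _ assms(2) that]) (use eq in blast)
  ultimately show ?thesis using nice by blast
qed

end
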